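(* Let $d=1$ and let the weighting $\mathbf{w}=\mathbf{w}(\mathbf{m})$ be the state-dependent shifted Maxwellian described in the context, and let $\mathbf{m}\in\mathcal{R}^w_M$. Denote $$\mathcal{G}:=\sum_l\Delta v_lf^{\ast}_l\,\mathbf{p}(v_l)\Big(\frac{\partial\kappa_l}{\partial\mathbf{m}}\Big)^T,\qquad \mathcal{G}_v:=\sum_l\Delta v_lv_lf^{\ast}_l\,\mathbf{p}(v_l)\Big(\frac{\partial\kappa_l}{\partial\mathbf{m}}\Big)^T.$$ Then the flux Jacobian is $$\mathbf{F}'(\mathbf{m})=\mathcal{K}\mathcal{H}^{-1}+\lambda R,\qquad R:=\mathcal{K}\mathcal{H}^{-1}\mathcal{G}-\mathcal{G}_v$$ (which is in general no longer symmetrized by $\mathcal{H}^{-1}$). Nevertheless the system $\partial_t\mathbf{m}+\partial_x\mathbf{F}(\mathbf{m})=0$ remains strictly hyperbolic, with characteristic speeds (eigenvalues of $\mathbf{F}'(\mathbf{m})$) $\tilde\theta_1,\ldots,\tilde\theta_M$ real, pairwise distinct and satisfying $|\tilde\theta_i-\theta_i|\le\lambda\|\mathcal{H}^{-1/2}R\mathcal{H}^{1/2}\|_2$ for each $i$, provided that $$\lambda\,\|\mathcal{H}^{-1/2}R\mathcal{H}^{1/2}\|_2<\frac12\min_{i\ne j}|\theta_i-\theta_j|,$$ where $\theta_1,\ldots,\theta_M$ are the nodes of the $M$-point Gauss quadrature rule of the measure $\mu^{\ast}=\sum_l\Delta v_lf^{\ast}_l(\mathbf{m})\delta_{v_l}$.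 In particular, for $\lambda=0$ the closure ($\mathbf{f}^{\ast}$ and $\mathbf{F}$) does not depend on $\mathbf{w}$, and for every $\mathbf{m}\in\mathcal{R}_M$: with $\eta(\mathbf{m})=\sum_l\Delta v_lf^{\ast}_l\log f^{\ast}_l$ and $\psi(\mathbf{m})=\sum_l\Delta v_lv_lf^{\ast}_l\log f^{\ast}_l$, $\eta$ is strictly convex on $\mathcal{R}_M$, $\nabla\eta=-\mathbf{y}^{\ast}$, $\nabla^2\eta=\mathcal{H}^{-1}\succ0$, $\nabla\psi=\mathbf{F}'^T\nabla\eta$, $\mathbf{F}'=\mathcal{K}\mathcal{H}^{-1}$ (so $\mathcal{H}^{-1}$ is a symmetrizer), and the eigenvalues of $\mathbf{F}'(\mathbf{m})$ are the Gauss nodes $\theta_i$, which are real, pairwise distinct and satisfy $v_1<\theta_1<\cdots<\theta_M<v_N$.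
   Context: Fixed data: integers $N>M\ge3$ (so that density, momentum and energy are among the constrained moments); distinct velocity nodes $v_1<\cdots<v_N$ in $\mathbb{R}$; quadrature weights $\Delta v_l>0$; $\lambda\ge0$. $p_k(v)=v^{k-1}$, $k=1,\ldots,M$, $\mathbf{p}=(p_1,\ldots,p_M)^T$; $\mathbf{A}\in\mathbb{R}^{M\times N}$, $\mathbf{A}_{kl}=\Delta v_lp_k(v_l)$, assumed of rank $M$; $\mathbf{A}_{\mathrm{next}}=(\Delta v_lv_l^M)_l$. The nodes, $\Delta v_l$ and $\mathbf{A}$ are fixed. $\mathcal{R}_M=\{\mathbf{A}\mathbf{f}:\mathbf{f}\in\mathbb{R}^N,\ f_l>0\ \forall l\}$ is the realizability cone; $\mathbf{m}=(m_1,\ldots,m_M)^T$. State-dependent weighting: with $\bar v=m_2/m_1$ and $e(\mathbf{m})=m_3/m_1-\bar v^2$, set $w_l(\mathbf{m})=\exp(-\beta(v_l-\bar v)^2)$, where $\beta=\beta(\mathbf{m})>0$ is fixed by $$\frac{\sum_l\Delta v_l(v_l-\bar v)^2e^{-\beta(v_l-\bar v)^2}}{\sum_l\Delta v_le^{-\beta(v_l-\bar v)^2}}=e(\mathbf{m}).$$ It is well defined and real-analytic on the open set $$\mathcal{R}^w_M=\Big\{\mathbf{m}\in\mathcal{R}_M:\ \min_l(v_l-\bar v)^2<e(\mathbf{m})<\frac{\sum_l\Delta v_l(v_l-\bar v)^2}{\sum_l\Delta v_l}\Big\}.$$ Put $\kappa_l(\mathbf{m})=1/(\Delta v_lw_l(\mathbf{m}))$;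 $\partial\kappa_l/\partial\mathbf{m}$ is its gradient, a column vector. Reconstruction: given $\mathbf{m}$ and weights $w_l>0$, $f^{\ast}_l=w_lg^{\ast}_l$, where $\mathbf{g}^{\ast}$ is the unique (positive) minimizer of $\sum_l\Delta v_lw_lg_l\log(w_lg_l)+\lambda\sum_l|g_l|$ over $g_l\ge0$ with $\sum_l\mathbf{A}_{kl}w_lg_l=m_k$, $k=1,\ldots,M$ ($0\log0=0$); here $w_l=w_l(\mathbf{m})$. Equivalently $f^{\ast}_l=\exp(-1-\lambda\kappa_l-(\mathbf{y}^{\ast})^T\mathbf{p}(v_l))$, where $\mathbf{y}^{\ast}$ minimizes $\mathbf{y}^T\mathbf{m}+\sum_l\Delta v_l\exp(-1-\lambda\kappa_l-\mathbf{y}^T\mathbf{p}(v_l))$ over $\mathbf{y}\in\mathbb{R}^M$. Flux: $\mathbf{F}(\mathbf{m})=(m_2,\ldots,m_M,\mathbf{A}_{\mathrm{next}}\mathbf{f}^{\ast}(\mathbf{m}))^T=\sum_l\Delta v_lv_l\mathbf{p}(v_l)f^{\ast}_l(\mathbf{m})$, with Jacobian $\mathbf{F}'$. Gram matrices: $\mathcal{H}=\sum_l\Delta v_lf^{\ast}_l\mathbf{p}(v_l)\mathbf{p}(v_l)^T$ (symmetric positive definite), $\mathcal{K}=\sum_l\Delta v_lv_lf^{\ast}_l\mathbf{p}(v_l)\mathbf{p}(v_l)^T$. $\|\cdot\|_2$ is the spectral norm. The nodes of the $M$-point Gauss rule of $\mu^{\ast}$ are the zeros, ordered increasingly, of the degree-$M$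 orthogonal polynomial of $\mu^{\ast}$. Strictly hyperbolic means that $\mathbf{F}'$ has $M$ pairwise distinct real eigenvalues. *)

theory Defs
  imports "HOL-Analysis.Analysis" "HOL-Computational_Algebra.Polynomial"
begin

text \<open>The notation \<open>real ^ 'a\<close> fixes the sort of every occurrence of \<open>'a\<close>; these synonyms leave it to
  be inferred from one annotation. In \<open>('a, 'b) rmat\<close> the rows are indexed by \<open>'b\<close>.\<close>

type_synonym 'a rvec = "(real, 'a) vec"
type_synonym ('a, 'b) rmat = "((real, 'a) vec, 'b) vec"

section \<open>Indices, moments, realizability\<close>

text \<open>Moments live in \<open>real ^ 'm\<close>, velocity nodes and weights in \<open>real ^ 'n\<close>, where the
  index types are finite and linearly ordered, so that \<open>M\<close> and \<open>N\<close> are their cardinalities.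
  The position of an index is counted from 0: the component at position \<open>j\<close> of a moment vector is
  the moment of order \<open>j\<close>, called \<open>m\<^sub>j\<^sub>+\<^sub>1\<close> in the usual 1-based numbering.\<close>

definition pos :: "'m::{finite,linorder} \<Rightarrow> nat" where
  "pos k = card {..<k}"

definition mom :: "'m::{finite,linorder} rvec \<Rightarrow> nat \<Rightarrow> real" where
  "mom m j = m $ (THE k. pos k = j)"

definition pvec :: "real \<Rightarrow> 'm::{finite,linorder} rvec" where
  "pvec x = (\<chi> k. x ^ pos k)"

definition moment_mat :: "'n::finite rvec \<Rightarrow> 'n rvec \<Rightarrow> ('n, 'm::{finite,linorder}) rmat" where
  "moment_mat v dv = (\<chi> k l. dv $ l * pvec (v $ l) $ k)"

definition realizable :: "'n::finite rvec \<Rightarrow> 'n rvec \<Rightarrow> ('m::{finite,linorder} rvec) set" where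
  "realizable v dv = {moment_mat v dv *v f | f. \<forall>l. 0 < f $ l}"

section \<open>Shifted Maxwellian weighting\<close>

definition vbar :: "'m::{finite,linorder} rvec \<Rightarrow> real" where
  "vbar m = mom m 1 / mom m 0"

definition inten :: "'m::{finite,linorder} rvec \<Rightarrow> real" where
  "inten m = mom m 2 / mom m 0 - (vbar m)\<^sup>2"

definition beta :: "'n::finite rvec \<Rightarrow> 'n rvec \<Rightarrow> 'm::{finite,linorder} rvec \<Rightarrow> real" where
  "beta v dv m = (THE b. 0 < b \<and>
     (\<Sum>l\<in>UNIV. dv $ l * (v $ l - vbar m)\<^sup>2 * exp (- b * (v $ l - vbar m)\<^sup>2))
       / (\<Sum>l\<in>UNIV. dv $ l * exp (- b * (v $ l - vbar m)\<^sup>2)) = inten m)"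

definition maxw :: "'n::finite rvec \<Rightarrow> 'n rvec \<Rightarrow> 'm::{finite,linorder} rvec \<Rightarrow> 'n rvec" where
  "maxw v dv m = (\<chi> l. exp (- beta v dv m * (v $ l - vbar m)\<^sup>2))"

definition realizable_w ::
    "'n::finite rvec \<Rightarrow> 'n rvec \<Rightarrow> ('m::{finite,linorder} rvec) set" where
  "realizable_w v dv = {m \<in> realizable v dv.
     Min (range (\<lambda>l. (v $ l - vbar m)\<^sup>2)) < inten m \<and>
     inten m < (\<Sum>l\<in>UNIV. dv $ l * (v $ l - vbar m)\<^sup>2) / (\<Sum>l\<in>UNIV. dv $ l)}"

definition kappa :: "'n::finite rvec \<Rightarrow> 'n rvec \<Rightarrow> 'n \<Rightarrow> real" where
  "kappa dv w l = 1 / (dv $ l * w $ l)"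

section \<open>Reconstruction and flux\<close>

text \<open>Since \<open>ln 0 = 0\<close>, the convention \<open>0 log 0 = 0\<close> is automatic.\<close>

definition primal_obj :: "real \<Rightarrow> 'n::finite rvec \<Rightarrow> 'n rvec \<Rightarrow> 'n rvec \<Rightarrow> real" where
  "primal_obj lam dv w g =
     (\<Sum>l\<in>UNIV. dv $ l * w $ l * g $ l * ln (w $ l * g $ l)) + lam * (\<Sum>l\<in>UNIV. \<bar>g $ l\<bar>)"

definition feasible ::
    "'n::finite rvec \<Rightarrow> 'n rvec \<Rightarrow> 'n rvec \<Rightarrow> 'm::{finite,linorder} rvec \<Rightarrow> 'n rvec \<Rightarrow> bool" where
  "feasible v dv w m g \<longleftrightarrow> (\<forall>l. 0 \<le> g $ l) \<and> moment_mat v dv *v (\<chi> l. w $ l * g $ l) = m"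

definition gstar ::
    "real \<Rightarrow> 'n::finite rvec \<Rightarrow> 'n rvec \<Rightarrow> 'n rvec \<Rightarrow> 'm::{finite,linorder} rvec \<Rightarrow> 'n rvec" where
  "gstar lam v dv w m = (THE g. is_arg_min (primal_obj lam dv w) (feasible v dv w m) g)"

definition fstar ::
    "real \<Rightarrow> 'n::finite rvec \<Rightarrow> 'n rvec \<Rightarrow> 'n rvec \<Rightarrow> 'm::{finite,linorder} rvec \<Rightarrow> 'n rvec" where
  "fstar lam v dv w m = (\<chi> l. w $ l * gstar lam v dv w m $ l)"

definition dual_obj ::
    "real \<Rightarrow> 'n::finite rvec \<Rightarrow> 'n rvec \<Rightarrow> 'n rvec \<Rightarrow> 'm::{finite,linorder} rvec \<Rightarrow> 'm rvec \<Rightarrow> real" where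
  "dual_obj lam v dv w m y =
     y \<bullet> m + (\<Sum>l\<in>UNIV. dv $ l * exp (- 1 - lam * kappa dv w l - y \<bullet> pvec (v $ l)))"

definition ystar ::
    "real \<Rightarrow> 'n::finite rvec \<Rightarrow> 'n rvec \<Rightarrow> 'n rvec \<Rightarrow> 'm::{finite,linorder} rvec \<Rightarrow> 'm rvec" where
  "ystar lam v dv w m = (THE y. is_arg_min (dual_obj lam v dv w m) (\<lambda>_. True) y)"

text \<open>Here the weighting \<open>W\<close> is a function of the state. By the moment constraints the flux equals
  \<open>m\<close> shifted up by one order, with the moment of order \<open>CARD('m)\<close> of the reconstruction as its last
  component.\<close>

definition flux ::
    "real \<Rightarrow> 'n::finite rvec \<Rightarrow> 'n rvec \<Rightarrow> ('m::{finite,linorder} rvec \<Rightarrow> 'n rvec)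
      \<Rightarrow> 'm rvec \<Rightarrow> 'm rvec" where
  "flux lam v dv W m =
     (\<Sum>l\<in>UNIV. (dv $ l * v $ l * fstar lam v dv (W m) m $ l) *\<^sub>R pvec (v $ l))"

definition eta ::
    "real \<Rightarrow> 'n::finite rvec \<Rightarrow> 'n rvec \<Rightarrow> ('m::{finite,linorder} rvec \<Rightarrow> 'n rvec)
      \<Rightarrow> 'm rvec \<Rightarrow> real" where
  "eta lam v dv W m =
     (\<Sum>l\<in>UNIV. dv $ l * fstar lam v dv (W m) m $ l * ln (fstar lam v dv (W m) m $ l))"

definition psi ::
    "real \<Rightarrow> 'n::finite rvec \<Rightarrow> 'n rvec \<Rightarrow> ('m::{finite,linorder} rvec \<Rightarrow> 'n rvec)
      \<Rightarrow> 'm rvec \<Rightarrow> real" where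
  "psi lam v dv W m =
     (\<Sum>l\<in>UNIV. dv $ l * v $ l * fstar lam v dv (W m) m $ l * ln (fstar lam v dv (W m) m $ l))"

section \<open>Gradients and matrices\<close>

definition grad :: "('a::real_inner \<Rightarrow> real) \<Rightarrow> 'a \<Rightarrow> 'a" where
  "grad f x = (THE D. GDERIV f x :> D)"

definition gramH :: "'n::finite rvec \<Rightarrow> 'n rvec \<Rightarrow> 'n rvec \<Rightarrow> ('m::{finite,linorder}, 'm) rmat" where
  "gramH v dv f = (\<chi> i j. \<Sum>l\<in>UNIV. dv $ l * f $ l * pvec (v $ l) $ i * pvec (v $ l) $ j)"

definition gramK :: "'n::finite rvec \<Rightarrow> 'n rvec \<Rightarrow> 'n rvec \<Rightarrow> ('m::{finite,linorder}, 'm) rmat" where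
  "gramK v dv f =
     (\<chi> i j. \<Sum>l\<in>UNIV. dv $ l * v $ l * f $ l * pvec (v $ l) $ i * pvec (v $ l) $ j)"

definition matG ::
    "'n::finite rvec \<Rightarrow> 'n rvec \<Rightarrow> ('m::{finite,linorder} rvec \<Rightarrow> 'n rvec) \<Rightarrow> 'n rvec \<Rightarrow> 'm rvec
      \<Rightarrow> ('m, 'm) rmat" where
  "matG v dv W f m = (\<chi> i j. \<Sum>l\<in>UNIV.
     dv $ l * f $ l * pvec (v $ l) $ i * grad (\<lambda>m'. kappa dv (W m') l) m $ j)"

definition matGv ::
    "'n::finite rvec \<Rightarrow> 'n rvec \<Rightarrow> ('m::{finite,linorder} rvec \<Rightarrow> 'n rvec) \<Rightarrow> 'n rvec \<Rightarrow> 'm rvec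
      \<Rightarrow> ('m, 'm) rmat" where
  "matGv v dv W f m = (\<chi> i j. \<Sum>l\<in>UNIV.
     dv $ l * v $ l * f $ l * pvec (v $ l) $ i * grad (\<lambda>m'. kappa dv (W m') l) m $ j)"

definition matR ::
    "'n::finite rvec \<Rightarrow> 'n rvec \<Rightarrow> ('m::{finite,linorder} rvec \<Rightarrow> 'n rvec) \<Rightarrow> 'n rvec \<Rightarrow> 'm rvec
      \<Rightarrow> ('m, 'm) rmat" where
  "matR v dv W f m =
     gramK v dv f ** matrix_inv (gramH v dv f) ** matG v dv W f m - matGv v dv W f m"

definition sym_pos_def :: "('m::finite, 'm) rmat \<Rightarrow> bool" where
  "sym_pos_def A \<longleftrightarrow> transpose A = A \<and> (\<forall>x. x \<noteq> 0 \<longrightarrow> 0 < x \<bullet> (A *v x))"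

text \<open>The principal square root of a symmetric positive definite matrix.\<close>

definition msqrt :: "('m::finite, 'm) rmat \<Rightarrow> ('m, 'm) rmat" where
  "msqrt A = (THE S. sym_pos_def S \<and> S ** S = A)"

definition spectral_norm :: "('m::finite, 'm) rmat \<Rightarrow> real" where
  "spectral_norm A = onorm ((*v) A)"

definition symmetrizer :: "('m::finite, 'm) rmat \<Rightarrow> ('m, 'm) rmat \<Rightarrow> bool" where
  "symmetrizer S A \<longleftrightarrow> sym_pos_def S \<and> transpose (S ** A) = S ** A"

text \<open>All complex eigenvalues of a real matrix.\<close>

definition eigenvalues :: "('m::finite, 'm) rmat \<Rightarrow> complex set" where
  "eigenvalues A =
     {z. \<exists>x :: complex ^ 'm. x \<noteq> 0 \<and> (\<chi> i j. complex_of_real (A $ i $ j)) *v x = z *s x}"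

definition strictly_hyperbolic_at :: "('m::finite rvec \<Rightarrow> 'm rvec) \<Rightarrow> 'm rvec \<Rightarrow> bool" where
  "strictly_hyperbolic_at F m \<longleftrightarrow> F differentiable (at m) \<and>
     card {x :: real. complex_of_real x \<in> eigenvalues (jacobian F (at m))} = CARD('m)"

definition strictly_convex_on :: "'a::real_vector set \<Rightarrow> ('a \<Rightarrow> real) \<Rightarrow> bool" where
  "strictly_convex_on S f \<longleftrightarrow> convex S \<and>
     (\<forall>x\<in>S. \<forall>y\<in>S. \<forall>t. x \<noteq> y \<longrightarrow> 0 < t \<longrightarrow> t < 1 \<longrightarrow>
        f ((1 - t) *\<^sub>R x + t *\<^sub>R y) < (1 - t) * f x + t * f y)"

section \<open>Gauss nodes\<close>

text \<open>The discrete measure with mass \<open>dv\<^sub>l f\<^sub>l\<close> at the node \<open>v\<^sub>l\<close>.\<close>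

definition mustar :: "'n::finite rvec \<Rightarrow> 'n rvec \<Rightarrow> 'n rvec \<Rightarrow> real measure" where
  "mustar v dv f =
     distr (point_measure UNIV (\<lambda>l. ennreal (dv $ l * f $ l))) borel (\<lambda>l. v $ l)"

definition orthogonal_poly :: "real measure \<Rightarrow> nat \<Rightarrow> real poly \<Rightarrow> bool" where
  "orthogonal_poly \<mu> n p \<longleftrightarrow> p \<noteq> 0 \<and> degree p = n \<and>
     (\<forall>q. degree q < n \<longrightarrow> integrable \<mu> (\<lambda>x. poly p x * poly q x) \<and>
        (LINT x|\<mu>. poly p x * poly q x) = 0)"

text \<open>The index type of \<open>\<theta>\<close> supplies both the number of nodes and their order. When \<open>\<mu>\<close> has
  at least \<open>CARD('m)\<close> support points, the orthogonal polynomial is unique up to a factor, hence at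
  most one \<open>\<theta>\<close> satisfies this predicate.\<close>

definition gauss_nodes :: "real measure \<Rightarrow> ('m::{finite,linorder} \<Rightarrow> real) \<Rightarrow> bool" where
  "gauss_nodes \<mu> \<theta> \<longleftrightarrow> strict_mono \<theta> \<and>
     (\<exists>p. orthogonal_poly \<mu> CARD('m) p \<and> range \<theta> = {x. poly p x = 0})"

end

theory Submission
  imports Defs
begin

text \<open>Let \<open>\<Phi>(y, c)\<close> be the moment vector of the density with components
  \<open>exp (- 1 - c\<^sub>l - y \<bullet> p(v\<^sub>l))\<close>. For fixed \<open>c\<close> the dual objective is strictly convex and coercive, so
  \<open>\<Phi>(y, c) = m\<close> has exactly one solution \<open>y\<close> for realizable \<open>m\<close>; by the tangent inequality of
  \<open>x log x\<close> its density is the primal minimizer. The inverse function theorem for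
  \<open>(y, c) \<mapsto> (\<Phi>(y, c), c)\<close>, applied with \<open>c = \<lambda> \<kappa>(m)\<close>, gives the flux Jacobian, once \<open>\<beta>\<close> is
  known to be differentiable, which is the inverse function theorem again.

  The matrix \<open>\<H>\<^sup>-\<^sup>1\<^sup>/\<^sup>2 (\<K> \<H>\<^sup>-\<^sup>1) \<H>\<^sup>1\<^sup>/\<^sup>2\<close> is symmetric. Its eigenvectors are the coefficients of polynomials
  \<open>b\<close> for which \<open>(x - \<theta>) b(x)\<close> is orthogonal to all polynomials of degree less than \<open>M\<close>, so its
  eigenvalues \<open>\<theta>\<close> are the Gauss nodes and are simple. A perturbation of norm below half their gap
  moves each of them within its own interval: by the Bauer-Fike bound the determinant keeps its sign
  between these intervals, and it changes sign across each of them.\<close>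

section \<open>Symmetric matrices\<close>

text \<open>\<open>gstar\<close>, \<open>ystar\<close>, \<open>beta\<close>, \<open>msqrt\<close>
  and \<open>grad\<close> are definite descriptions, so each becomes usable only after existence and
  uniqueness are settled. A second obstacle is that \<kappa> itself varies with m, so the equation
  for y cannot be differentiated at fixed weights. Keeping c as an independent argument separates
  the two dependences: the variation of m yields K H^-1, that of c yields R, and \<lambda> = 0 is
  the case c = 0 for every weighting. No eigenvalue is followed along the perturbation. M sign
  changes of a real determinant produce M distinct real eigenvalues, and these exhaust the complex
  spectrum. Conjugating by the square root of H makes the unperturbed matrix symmetric, so its
  eigenbasis is orthonormal and the bound carries no condition number; the factor 1/2 in the
  hypothesis keeps the intervals around the nodes disjoint. That H^-1 is in general no symmetrizer
  is shown by one explicit state with M = 3 and N = 4.\<close>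

lemma inner_matrix_transpose:
  fixes A :: "real ^ 'n ^ 'm"
  shows "(A *v x) \<bullet> y = x \<bullet> (transpose A *v y)"
  by (metis dot_lmul_matrix transpose_matrix_vector vector_transpose_matrix)

lemma inner_symmetric_matrix:
  fixes A :: "real ^ 'm ^ 'm"
  assumes "transpose A = A"
  shows "(A *v x) \<bullet> y = x \<bullet> (A *v y)"
  using inner_matrix_transpose[of A x y] assms by simp

lemma symmetric_matrixI:
  fixes A :: "real ^ 'm ^ 'm"
  assumes "\<And>x y. (A *v x) \<bullet> y = x \<bullet> (A *v y)"
  shows "transpose A = A"
proof -
  have "transpose A *v y = A *v y" for y
    by (rule vector_eq_rdot[THEN iffD1])
       (metis assms inner_matrix_transpose inner_commute)
  then show ?thesis
    by (simp add: matrix_eq)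
qed

text \<open>First-order condition at the minimum t = 0 of a quadratic, without derivatives: at t = -
  a / c with c > b and c > 0 the value is a^2 (b - c) / c^2, negative unless a = 0.\<close>

lemma linear_coeff_zero:
  fixes a b :: real
  assumes "\<And>t. 0 \<le> t * a + t\<^sup>2 * b"
  shows "a = 0"
proof (rule ccontr)
  assume "a \<noteq> 0"
  define c where "c = \<bar>b\<bar> + 1"
  have "c > 0" "b < c" by (auto simp: c_def)
  have "0 \<le> (- a / c) * a + (- a / c)\<^sup>2 * b" by (rule assms)
  also have "\<dots> = (a\<^sup>2 / c\<^sup>2) * (b - c)"
    using \<open>c > 0\<close> by (simp add: field_simps power2_eq_square)
  also have "\<dots> < 0"
    using \<open>a \<noteq> 0\<close> \<open>c > 0\<close> \<open>b < c\<close> by (intro mult_pos_neg) auto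
  finally show False by simp
qed

text \<open>A maximizer of the Rayleigh quotient over the unit sphere of an invariant subspace is an
  eigenvector.\<close>

lemma symmetric_eigenvector_in_subspace:
  fixes A :: "real ^ 'm ^ 'm"
  assumes sym: "transpose A = A" and S: "subspace S" and inv: "\<And>x. x \<in> S \<Longrightarrow> A *v x \<in> S"
    and nz: "S \<noteq> {0}"
  obtains x c where "x \<in> S" "norm x = 1" "A *v x = c *\<^sub>R x"
proof -
  obtain z where z: "z \<in> S" "z \<noteq> 0"
    using nz subspace_0[OF S] by auto
  let ?K = "sphere 0 1 \<inter> S"
  have K: "compact ?K"
    by (intro compact_Int_closed closed_subspace S compact_sphere)
  have "(1 / norm z) *\<^sub>R z \<in> ?K"
    using z S by (auto simp: subspace_mul)
  then have ne: "?K \<noteq> {}" by blast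
  have cont: "continuous_on ?K (\<lambda>x. x \<bullet> (A *v x))"
    by (intro continuous_intros linear_continuous_on matrix_vector_mul_bounded_linear)
  obtain x where x: "x \<in> ?K" and max: "\<And>y. y \<in> ?K \<Longrightarrow> y \<bullet> (A *v y) \<le> x \<bullet> (A *v x)"
    using continuous_attains_sup[OF K ne cont] by blast
  define c where "c = x \<bullet> (A *v x)"
  have bound: "y \<bullet> (A *v y) \<le> c * (y \<bullet> y)" if "y \<in> S" for y
  proof (cases "y = 0")
    case False
    have "(1 / norm y) *\<^sub>R y \<in> ?K"
      using False that S by (auto simp: subspace_mul)
    from max[OF this] show ?thesis
      using False by (simp add: c_def matrix_vector_mult_scaleR field_simps
        power2_norm_eq_inner[symmetric] power2_eq_square)
  qed simp
  have xS: "x \<in> S" and nx: "x \<bullet> x = 1"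
    using x by (auto simp: norm_eq_1)
  have crit: "z \<bullet> (c *\<^sub>R x - A *v x) = 0" if "z \<in> S" for z
  proof -
    \<comment> \<open>This is \<open>bound\<close> at x + t z; the constant term drops out because x
      is a unit vector and c = x . A x.\<close>
    have "0 \<le> t * (2 * (z \<bullet> (c *\<^sub>R x - A *v x))) + t\<^sup>2 * (c * (z \<bullet> z) - z \<bullet> (A *v z))" for t
    proof -
      have "x + t *\<^sub>R z \<in> S"
        using xS that S by (simp add: subspace_add subspace_mul)
      from bound[OF this] show ?thesis
        using nx inner_symmetric_matrix[OF sym, of x z]
        by (simp add: inner_simps algebra_simps power2_eq_square inner_commute c_def[symmetric])
    qed
    from linear_coeff_zero[OF this] show ?thesis by simp
  qed
  \<comment> \<open>The residual is orthogonal to S and, by invariance, lies in S; hence it is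
    zero.\<close>
  have "c *\<^sub>R x - A *v x \<in> S"
    using xS S inv by (simp add: subspace_diff subspace_mul)
  from crit[OF this] have "A *v x = c *\<^sub>R x" by simp
  with that xS nx show ?thesis by (simp add: norm_eq_1)
qed

text \<open>An indexed family rather than a set, so that possibly repeated eigenvalues can be
  attached to its members. With the coordinate type as index type it is a basis by counting.\<close>

definition orthonormal_family :: "('i::finite \<Rightarrow> 'a::euclidean_space) \<Rightarrow> bool" where
  "orthonormal_family u \<longleftrightarrow> (\<forall>i j. u i \<bullet> u j = (if i = j then 1 else 0))"

lemma orthonormal_family_expand:
  fixes u :: "'m::finite \<Rightarrow> real ^ 'm"
  assumes u: "orthonormal_family u"
  shows "(\<Sum>i\<in>UNIV. (x \<bullet> u i) *\<^sub>R u i) = x"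
proof -
  have inj: "inj u"
    using u unfolding inj_def orthonormal_family_def by (metis zero_neq_one)
  have orth: "pairwise orthogonal (range u)"
    using u by (auto simp: pairwise_def orthogonal_def orthonormal_family_def)
  have n1: "norm y = 1" if "y \<in> range u" for y
    using that u by (auto simp: orthonormal_family_def norm_eq_1)
  have "independent (range u)"
    using orth n1 by (intro pairwise_orthogonal_independent) fastforce+
  moreover have "card (range u) = DIM(real ^ 'm)"
    using inj by (simp add: card_image)
  ultimately have "span (range u) = UNIV"
    by (metis card_eq_dim dim_UNIV finite_class.finite finite_imageI span_UNIV subset_UNIV
        subset_antisym span_mono card_ge_dim_independent le_refl)
  then have "(\<Sum>y\<in>range u. (x \<bullet> y) *\<^sub>R y) = x"
    by (intro orthonormal_basis_expand orth) (auto simp: n1)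
  then show ?thesis
    using inj by (simp add: sum.reindex)
qed

lemma orthonormal_family_inner:
  assumes "orthonormal_family u"
  shows "(\<Sum>i\<in>UNIV. f i *\<^sub>R u i) \<bullet> (\<Sum>i\<in>UNIV. g i *\<^sub>R u i) = (\<Sum>i\<in>UNIV. f i * g i)"
proof -
  have *: "u i \<bullet> u j = (if i = j then 1 else 0)" for i j
    using assms by (simp add: orthonormal_family_def)
  show ?thesis
    by (simp add: * inner_sum_left inner_sum_right if_distrib sum.delta mult.commute cong: if_cong)
qed

lemma orthonormal_family_coeff:
  assumes "orthonormal_family u"
  shows "(\<Sum>i\<in>UNIV. f i *\<^sub>R u i) \<bullet> u j = f j"
proof -
  have *: "u i \<bullet> u j = (if i = j then 1 else 0)" for i j
    using assms by (simp add: orthonormal_family_def)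
  show ?thesis
    by (simp add: * inner_sum_left if_distrib sum.delta cong: if_cong)
qed

text \<open>Take an orthonormal set of eigenvectors of maximal size. If it did not span, its
  orthogonal complement would be a non-zero invariant subspace by symmetry of A and would contain a
  further unit eigenvector.\<close>

theorem symmetric_matrix_eigenbasis:
  fixes A :: "real ^ 'm ^ 'm"
  assumes sym: "transpose A = A"
  obtains u :: "'m \<Rightarrow> real ^ 'm" and d where "orthonormal_family u" "\<And>i. A *v u i = d i *\<^sub>R u i"
proof -
  define P where "P B \<longleftrightarrow> pairwise orthogonal B \<and> (\<forall>x\<in>B. norm x = 1 \<and> (\<exists>c. A *v x = c *\<^sub>R x))"
    for B :: "(real ^ 'm) set"
  have ind: "independent B" if "P B" for B
    using that unfolding P_def by (intro pairwise_orthogonal_independent) auto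
  have fin: "finite B" "card B \<le> CARD('m)" if "P B" for B
    using independent_bound[OF ind[OF that]] by simp_all
  have "P {}" by (simp add: P_def)
  then obtain B where B: "P B" and max: "\<And>C. P C \<Longrightarrow> card C \<le> card B"
    using ex_has_greatest_nat[of P "{}" card "Suc CARD('m)"] fin(2) by (auto simp: less_Suc_eq_le)
  have "card B = CARD('m)"
  proof (rule ccontr)
    assume "card B \<noteq> CARD('m)"
    define S where "S = {x. \<forall>b\<in>B. b \<bullet> x = 0}"
    have S: "subspace S"
      by (auto simp: S_def subspace_def inner_simps)
    have inv: "A *v x \<in> S" if "x \<in> S" for x
      unfolding S_def
    proof (intro CollectI ballI)
      fix b assume "b \<in> B"
      with B obtain c where "A *v b = c *\<^sub>R b" by (auto simp: P_def)
      then show "b \<bullet> (A *v x) = 0"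
        using inner_symmetric_matrix[OF sym, of b x] that \<open>b \<in> B\<close> by (simp add: S_def)
    qed
    have "dim (span B) < DIM(real ^ 'm)"
      using \<open>card B \<noteq> CARD('m)\<close> fin[OF B] ind[OF B] by (simp add: dim_eq_card_independent)
    then have "span B \<noteq> UNIV" by (metis dim_UNIV less_irrefl)
    then obtain a where a: "a \<noteq> 0" "span B \<subseteq> {x. a \<bullet> x = 0}"
      using span_not_UNIV_orthogonal[of B] by auto
    then have "a \<in> S"
      by (auto simp: S_def inner_commute subset_eq span_base)
    with a have "S \<noteq> {0}" by auto
    then obtain x c where x: "x \<in> S" "norm x = 1" "A *v x = c *\<^sub>R x"
      using symmetric_eigenvector_in_subspace[OF sym S inv] by metis
    have "x \<notin> B"
      using x by (auto simp: S_def norm_eq_1)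
    have "P (insert x B)"
      using B x by (auto simp: P_def pairwise_insert orthogonal_def S_def inner_commute)
    from max[OF this] show False
      using \<open>x \<notin> B\<close> fin[OF B] by simp
  qed
  then obtain u where u: "bij_betw u (UNIV :: 'm set) B"
    using fin[OF B] by (metis finite_same_card_bij finite_class.finite_UNIV)
  have "orthonormal_family u"
    unfolding orthonormal_family_def
  proof (intro allI)
    fix i j
    have "u i \<in> B" "u j \<in> B" using u by (auto simp: bij_betw_def)
    moreover have "u i \<noteq> u j" if "i \<noteq> j"
      using u that by (auto simp: bij_betw_def inj_def)
    ultimately show "u i \<bullet> u j = (if i = j then 1 else 0)"
      using B by (auto simp: P_def pairwise_def orthogonal_def norm_eq_1)
  qed
  moreover have "\<forall>i. \<exists>c. A *v u i = c *\<^sub>R u i"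
    using u B by (auto simp: P_def bij_betw_def)
  ultimately show ?thesis
    using that by metis
qed

section \<open>The square root of a positive definite matrix\<close>

text \<open>The map \<open>g\<close> acts on each eigenvector of A by the square root of its
  eigenvalue.\<close>

lemma sym_pos_def_sqrt_exists:
  fixes A :: "real ^ 'm ^ 'm"
  assumes A: "sym_pos_def A"
  obtains S where "sym_pos_def S" "S ** S = A"
proof -
  obtain u :: "'m \<Rightarrow> real ^ 'm" and d where u: "orthonormal_family u"
    and d: "\<And>i. A *v u i = d i *\<^sub>R u i"
    using symmetric_matrix_eigenbasis[of A] A by (auto simp: sym_pos_def_def)
  have dpos: "d i > 0" for i
  proof -
    have "u i \<bullet> u i = 1" using u by (simp add: orthonormal_family_def)
    moreover from this have "u i \<noteq> 0" by auto
    ultimately show ?thesis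
      using A d[of i] unfolding sym_pos_def_def by (metis inner_scaleR_right mult.right_neutral)
  qed
  define g where "g x = (\<Sum>i\<in>UNIV. (sqrt (d i) * (x \<bullet> u i)) *\<^sub>R u i)" for x
  define S where "S = matrix g"
  have lin: "linear g"
    unfolding g_def
    by (intro linearI) (simp_all add: inner_simps algebra_simps sum.distrib scaleR_sum_right)
  then have S: "S *v x = g x" for x
    by (simp add: S_def matrix_works)
  have gu: "g x \<bullet> u i = sqrt (d i) * (x \<bullet> u i)" for x i
    unfolding g_def by (simp add: orthonormal_family_coeff[OF u])
  have gy: "g x \<bullet> y = (\<Sum>i\<in>UNIV. sqrt (d i) * (x \<bullet> u i) * (y \<bullet> u i))" for x y
  proof -
    have "g x \<bullet> y = g x \<bullet> (\<Sum>i\<in>UNIV. (y \<bullet> u i) *\<^sub>R u i)"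
      by (simp add: orthonormal_family_expand[OF u])
    then show ?thesis
      unfolding g_def by (simp add: orthonormal_family_inner[OF u])
  qed
  have "transpose S = S"
  proof (rule symmetric_matrixI)
    fix x y
    have "(S *v x) \<bullet> y = (S *v y) \<bullet> x"
      unfolding S gy by (simp add: mult_ac)
    then show "(S *v x) \<bullet> y = x \<bullet> (S *v y)"
      by (simp add: inner_commute)
  qed
  moreover have "0 < x \<bullet> (S *v x)" if "x \<noteq> 0" for x
  proof -
    obtain i where i: "x \<bullet> u i \<noteq> 0"
    proof (rule ccontr)
      assume "\<not> thesis"
      then have "\<And>i. x \<bullet> u i = 0" using that by blast
      then show False
        using orthonormal_family_expand[OF u, of x] \<open>x \<noteq> 0\<close> by simp
    qed
    have "0 < (\<Sum>i\<in>UNIV. sqrt (d i) * (x \<bullet> u i) * (x \<bullet> u i))"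
    proof (rule sum_pos2[of _ i])
      have "0 < (x \<bullet> u i) * (x \<bullet> u i)"
        using i not_real_square_gt_zero by blast
      then show "0 < sqrt (d i) * (x \<bullet> u i) * (x \<bullet> u i)"
        using dpos[of i] by (simp add: mult.assoc)
      show "0 \<le> sqrt (d j) * (x \<bullet> u j) * (x \<bullet> u j)" for j
        using dpos[of j] by (simp add: mult.assoc)
    qed auto
    then show ?thesis
      unfolding S using gy[of x x] by (simp add: inner_commute)
  qed
  moreover have "S ** S = A"
  proof -
    have "(S ** S) *v x = A *v x" for x
    proof -
      have "(S ** S) *v x = g (g x)"
        by (simp add: matrix_vector_mul_assoc[symmetric] S)
      also have "\<dots> = (\<Sum>i\<in>UNIV. (d i * (x \<bullet> u i)) *\<^sub>R u i)"
        unfolding g_def[of "g x"] gu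
        using dpos by (simp add: mult.assoc[symmetric] less_imp_le)
      also have "\<dots> = (\<Sum>i\<in>UNIV. (x \<bullet> u i) *\<^sub>R (A *v u i))"
        by (simp add: d mult.commute)
      also have "\<dots> = A *v (\<Sum>i\<in>UNIV. (x \<bullet> u i) *\<^sub>R u i)"
        by (simp add: linear_sum[OF matrix_vector_mul_linear] matrix_vector_mult_scaleR)
      finally show ?thesis
        by (simp add: orthonormal_family_expand[OF u])
    qed
    then show ?thesis by (simp add: matrix_eq)
  qed
  ultimately show ?thesis
    using that[of S] by (simp add: sym_pos_def_def)
qed

text \<open>If \<open>T u = t u\<close> and \<open>S\<^sup>2 = T\<^sup>2\<close>, then \<open>(S + t) (S u - t u) = 0\<close>, and \<open>S + t\<close> is injective.\<close>

lemma sym_pos_def_sqrt_unique: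
  fixes S T :: "real ^ 'm ^ 'm"
  assumes S: "sym_pos_def S" and T: "sym_pos_def T" and eq: "S ** S = T ** T"
  shows "S = T"
proof -
  obtain u :: "'m \<Rightarrow> real ^ 'm" and d where u: "orthonormal_family u"
    and d: "\<And>i. T *v u i = d i *\<^sub>R u i"
    using symmetric_matrix_eigenbasis[of T] T by (auto simp: sym_pos_def_def)
  have Su: "S *v u i = T *v u i" for i
  proof -
    have "u i \<bullet> u i = 1" using u by (simp add: orthonormal_family_def)
    moreover from this have "u i \<noteq> 0" by auto
    ultimately have dpos: "d i > 0"
      using T d[of i] unfolding sym_pos_def_def by (metis inner_scaleR_right mult.right_neutral)
    define z where "z = S *v u i - d i *\<^sub>R u i"
    have "S *v (S *v u i) = d i *\<^sub>R d i *\<^sub>R u i"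
      by (metis d eq matrix_vector_mul_assoc matrix_vector_mult_scaleR)
    then have "S *v z + d i *\<^sub>R z = 0"
      by (simp add: z_def matrix_vector_mult_diff_distrib matrix_vector_mult_scaleR algebra_simps)
    then have "z \<bullet> (S *v z) + d i * (z \<bullet> z) = 0"
      by (metis inner_add_right inner_scaleR_right inner_zero_right)
    then have "z = 0"
      using S dpos unfolding sym_pos_def_def
      by (metis add_less_le_mono add.right_neutral inner_ge_zero less_irrefl less_imp_le
          mult_nonneg_nonneg add_0)
    then show ?thesis by (simp add: z_def d)
  qed
  have "S *v x = T *v x" for x
  proof -
    have "S *v (\<Sum>i\<in>UNIV. (x \<bullet> u i) *\<^sub>R u i) = T *v (\<Sum>i\<in>UNIV. (x \<bullet> u i) *\<^sub>R u i)"
      by (simp add: linear_sum[OF matrix_vector_mul_linear] matrix_vector_mult_scaleR Su)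
    then show ?thesis by (simp add: orthonormal_family_expand[OF u])
  qed
  then show ?thesis by (simp add: matrix_eq)
qed

lemma msqrt:
  fixes A :: "real ^ 'm ^ 'm"
  assumes "sym_pos_def A"
  shows "sym_pos_def (msqrt A)" "msqrt A ** msqrt A = A"
proof -
  have "\<exists>!S. sym_pos_def S \<and> S ** S = A"
    using sym_pos_def_sqrt_exists[OF assms] sym_pos_def_sqrt_unique by metis
  from theI'[OF this] show "sym_pos_def (msqrt A)" "msqrt A ** msqrt A = A"
    unfolding msqrt_def by auto
qed

section \<open>Inverses of positive definite matrices\<close>

lemma matrix_inv_mult:
  fixes A :: "'a::semiring_1 ^ 'n ^ 'm"
  assumes "invertible A"
  shows "A ** matrix_inv A = mat 1" "matrix_inv A ** A = mat 1"
  using someI_ex[OF assms[unfolded invertible_def]] by (auto simp: matrix_inv_def)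

lemma sym_pos_def_invertible:
  fixes A :: "real ^ 'm ^ 'm"
  assumes "sym_pos_def A"
  shows "invertible A"
  unfolding invertible_left_inverse matrix_left_invertible_ker
  using assms unfolding sym_pos_def_def by (metis inner_zero_right less_irrefl)

lemma sym_pos_def_matrix_inv:
  fixes A :: "real ^ 'm ^ 'm"
  assumes "sym_pos_def A"
  shows "sym_pos_def (matrix_inv A)"
proof -
  note inv = matrix_inv_mult[OF sym_pos_def_invertible[OF assms]]
  have id: "A *v (matrix_inv A *v x) = x" for x
    by (simp add: matrix_vector_mul_assoc inv)
  have sym: "transpose A = A" using assms by (simp add: sym_pos_def_def)
  have "transpose (matrix_inv A) = matrix_inv A"
  proof (rule symmetric_matrixI)
    fix x y
    show "(matrix_inv A *v x) \<bullet> y = x \<bullet> (matrix_inv A *v y)"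
      using inner_symmetric_matrix[OF sym, of "matrix_inv A *v x" "matrix_inv A *v y"]
      by (simp add: id)
  qed
  moreover have "0 < x \<bullet> (matrix_inv A *v x)" if "x \<noteq> 0" for x
  proof -
    have "matrix_inv A *v x \<noteq> 0"
      using id[of x] that by auto
    with assms have "0 < (matrix_inv A *v x) \<bullet> (A *v (matrix_inv A *v x))"
      by (simp add: sym_pos_def_def)
    then show ?thesis by (simp add: id inner_commute)
  qed
  ultimately show ?thesis by (simp add: sym_pos_def_def)
qed

section \<open>Eigenvalues\<close>

abbreviation cmat :: "real ^ 'n ^ 'm \<Rightarrow> complex ^ 'n ^ 'm" where
  "cmat A \<equiv> \<chi> i j. complex_of_real (A $ i $ j)"

lemma cmat_mult: "cmat (A ** B) = cmat A ** cmat B"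
  by (simp add: matrix_matrix_mult_def vec_eq_iff)

lemma cmat_mat: "cmat (mat x) = mat (complex_of_real x)"
  by (simp add: mat_def vec_eq_iff)

text \<open>P carries an eigenvector x to P x, which is non-zero because Q recovers x. Used once in
  each direction, this gives equality of the spectra of similar matrices.\<close>

lemma eigenvalues_similar_subset:
  fixes A P Q :: "real ^ 'm ^ 'm"
  assumes "Q ** P = mat 1"
  shows "eigenvalues A \<subseteq> eigenvalues (P ** A ** Q)"
proof
  fix z assume "z \<in> eigenvalues A"
  then obtain x where x: "x \<noteq> 0" "cmat A *v x = z *s x"
    by (auto simp: eigenvalues_def)
  have QP: "cmat Q *v (cmat P *v x) = x"
    using assms by (simp add: matrix_vector_mul_assoc cmat_mult[symmetric] cmat_mat)
  have "cmat (P ** A ** Q) *v (cmat P *v x) = cmat P *v (cmat A *v x)"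
    unfolding cmat_mult by (simp add: matrix_vector_mul_assoc[symmetric] QP)
  also have "\<dots> = z *s (cmat P *v x)"
    by (simp add: x vector_scalar_commute)
  finally have "cmat (P ** A ** Q) *v (cmat P *v x) = z *s (cmat P *v x)" .
  moreover have "cmat P *v x \<noteq> 0"
    using QP x by auto
  ultimately show "z \<in> eigenvalues (P ** A ** Q)"
    by (auto simp: eigenvalues_def)
qed

lemma eigenvalues_similar:
  fixes A S :: "real ^ 'm ^ 'm"
  assumes "invertible S"
  shows "eigenvalues (matrix_inv S ** A ** S) = eigenvalues A"
proof
  note inv = matrix_inv_mult[OF assms]
  show "eigenvalues A \<subseteq> eigenvalues (matrix_inv S ** A ** S)"
    by (rule eigenvalues_similar_subset) (rule inv)
  have "S ** (matrix_inv S ** A ** S) ** matrix_inv S = (S ** matrix_inv S) ** A ** (S ** matrix_inv S)"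
    by (simp add: matrix_mul_assoc)
  also have "\<dots> = A" by (simp add: inv)
  finally show "eigenvalues (matrix_inv S ** A ** S) \<subseteq> eigenvalues A"
    using eigenvalues_similar_subset[of "matrix_inv S" S "matrix_inv S ** A ** S"] inv by simp
qed

lemma real_eigenvalueI:
  fixes A :: "real ^ 'm ^ 'm"
  assumes "x \<noteq> 0" "A *v x = t *\<^sub>R x"
  shows "complex_of_real t \<in> eigenvalues A"
proof -
  define y where "y = (\<chi> i. complex_of_real (x $ i))"
  have "cmat A *v y = (\<chi> i. complex_of_real ((A *v x) $ i))"
    by (simp add: y_def matrix_vector_mult_def vec_eq_iff)
  also have "\<dots> = complex_of_real t *s y"
    by (simp add: assms y_def vec_eq_iff)
  finally have "cmat A *v y = complex_of_real t *s y" .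
  moreover have "y \<noteq> 0"
    using assms(1) by (auto simp: y_def vec_eq_iff)
  ultimately show ?thesis by (auto simp: eigenvalues_def)
qed

text \<open>Applying A - t k to a vanishing combination removes the term k and multiplies the others
  by t i - t k, which is not zero. The coefficients change in this step, so the induction
  generalizes over \<open>c\<close>.\<close>

lemma eigenvectors_independent:
  fixes A :: "real ^ 'm ^ 'm" and x :: "'i \<Rightarrow> real ^ 'm"
  assumes "finite I" "inj t" "\<And>i. x i \<noteq> 0" "\<And>i. A *v x i = t i *\<^sub>R x i"
    and "(\<Sum>i\<in>I. c i *\<^sub>R x i) = 0" and "i \<in> I"
  shows "c i = 0"
  using assms(1,5,6)
proof (induction I arbitrary: c i)
  case (insert k I)
  have sum: "c k *\<^sub>R x k + (\<Sum>i\<in>I. c i *\<^sub>R x i) = 0"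
    using insert by simp
  then have "A *v (c k *\<^sub>R x k + (\<Sum>i\<in>I. c i *\<^sub>R x i)) - t k *\<^sub>R (c k *\<^sub>R x k + (\<Sum>i\<in>I. c i *\<^sub>R x i)) = 0"
    by simp
  moreover have "A *v (c k *\<^sub>R x k + (\<Sum>i\<in>I. c i *\<^sub>R x i)) =
      (c k * t k) *\<^sub>R x k + (\<Sum>i\<in>I. (c i * t i) *\<^sub>R x i)"
    by (simp add: matrix_vector_right_distrib linear_sum[OF matrix_vector_mul_linear]
        matrix_vector_mult_scaleR assms(4))
  ultimately have "(\<Sum>i\<in>I. (c i * (t i - t k)) *\<^sub>R x i) = 0"
    by (simp add: algebra_simps scaleR_sum_right sum_subtractf)
  from insert.IH[OF this] have "c j * (t j - t k) = 0" if "j \<in> I" for j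
    using that by blast
  then have 0: "c j = 0" if "j \<in> I" for j
    using that \<open>inj t\<close> \<open>k \<notin> I\<close> by (metis eq_iff_diff_eq_0 injD mult_eq_0_iff)
  with sum have "c k *\<^sub>R x k = 0" by simp
  with assms(3) 0 insert.prems show ?case by auto
qed simp

text \<open>In the basis of the eigenvectors the matrix is diagonal, also over the complex numbers.\<close>

lemma eigenvalues_eq:
  fixes A :: "real ^ 'm ^ 'm" and x :: "'m \<Rightarrow> real ^ 'm"
  assumes t: "inj t" and nz: "\<And>i. x i \<noteq> 0" and ev: "\<And>i. A *v x i = t i *\<^sub>R x i"
  shows "eigenvalues A = complex_of_real ` range t"
proof
  show "complex_of_real ` range t \<subseteq> eigenvalues A"
    using real_eigenvalueI[OF nz ev] by auto
next
  define X :: "real ^ 'm ^ 'm" where "X = (\<chi> i j. x j $ i)"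
  define D :: "real ^ 'm ^ 'm" where "D = (\<chi> i j. if i = j then t j else 0)"
  have Xc: "X *v c = (\<Sum>i\<in>UNIV. (c $ i) *\<^sub>R x i)" for c
    by (simp add: X_def matrix_vector_mult_def vec_eq_iff mult.commute)
  have "invertible X"
    unfolding invertible_left_inverse matrix_left_invertible_ker
  proof (intro allI impI)
    fix c assume "X *v c = 0"
    then have "c $ i = 0" for i
      using eigenvectors_independent[where I = UNIV and c = "\<lambda>i. c $ i" and i = i, OF _ t nz ev] Xc by simp
    then show "c = 0" by (simp add: vec_eq_iff)
  qed
  note inv = matrix_inv_mult[OF this]
  have AX: "A ** X = X ** D"
  proof -
    have "(A ** X) $ i $ j = (A *v x j) $ i" for i j
      by (simp add: X_def matrix_matrix_mult_def matrix_vector_mult_def)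
    moreover have "(X ** D) $ i $ j = (t j *\<^sub>R x j) $ i" for i j
      by (simp add: X_def D_def matrix_matrix_mult_def if_distrib sum.delta cong: if_cong)
    ultimately show ?thesis by (simp add: vec_eq_iff ev)
  qed
  have "matrix_inv X ** A ** X = D"
    by (simp add: AX matrix_mul_assoc[symmetric]) (simp add: matrix_mul_assoc inv)
  then have "eigenvalues A = eigenvalues D"
    using eigenvalues_similar[OF \<open>invertible X\<close>, of A] by simp
  also have "\<dots> \<subseteq> complex_of_real ` range t"
  proof
    fix z assume "z \<in> eigenvalues D"
    then obtain y where y: "y \<noteq> 0" "cmat D *v y = z *s y"
      by (auto simp: eigenvalues_def)
    then obtain i where "y $ i \<noteq> 0" by (auto simp: vec_eq_iff)
    have "(cmat D *v y) $ i = complex_of_real (t i) * y $ i"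
      by (simp add: D_def matrix_vector_mult_def if_distrib if_distribR sum.delta cong: if_cong)
    then have "z * y $ i = complex_of_real (t i) * y $ i"
      by (simp add: y)
    with \<open>y $ i \<noteq> 0\<close> show "z \<in> complex_of_real ` range t" by auto
  qed
  finally show "eigenvalues A \<subseteq> complex_of_real ` range t" .
qed

section \<open>Perturbation of a symmetric matrix with simple spectrum\<close>

text \<open>The product form of the intermediate value theorem, since the orientation of the sign
  change of a determinant is unknown.\<close>

lemma sign_change_root:
  fixes f :: "real \<Rightarrow> real"
  assumes "a \<le> b" "continuous_on {a..b} f" "f a * f b \<le> 0"
  obtains x where "a \<le> x" "x \<le> b" "f x = 0"
proof (cases "f a \<le> 0 \<and> 0 \<le> f b")
  case True
  with IVT'[of f a 0 b] assms that show ?thesis by blast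
next
  case False
  with assms(3) have "f b \<le> 0" "0 \<le> f a"
    by (auto simp: mult_le_0_iff)
  with IVT2'[of f b 0 a] assms that show ?thesis by blast
qed

text \<open>In the eigenbasis the squared norm of J w - x w is the sum of (c i)^2 (\<theta> i -
  x)^2. If x were farther than r from every \<theta> i, this norm would exceed r |w|, whereas J w -
  x w = - t E w. The scalar t is the homotopy parameter from J to J + E.\<close>

lemma bauer_fike_orthonormal:
  fixes J E :: "real ^ 'm ^ 'm" and u :: "'m \<Rightarrow> real ^ 'm"
  assumes u: "orthonormal_family u" and J: "\<And>i. J *v u i = \<theta> i *\<^sub>R u i"
    and E: "\<And>x. norm (E *v x) \<le> r * norm x" and t: "\<bar>t\<bar> \<le> 1"
    and w: "w \<noteq> 0" "(J + t *\<^sub>R E) *v w = x *\<^sub>R w"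
  shows "\<exists>i. \<bar>x - \<theta> i\<bar> \<le> r"
proof (rule ccontr)
  assume "\<not> ?thesis"
  then have far: "r < \<bar>x - \<theta> i\<bar>" for i by (meson not_less)
  have "0 \<le> r * norm w"
    using E[of w] norm_ge_zero order_trans by blast
  then have r: "0 \<le> r"
    using w by (simp add: zero_le_mult_iff)
  define c where "c i = w \<bullet> u i" for i
  have wc: "w = (\<Sum>i\<in>UNIV. c i *\<^sub>R u i)"
    by (simp add: c_def orthonormal_family_expand[OF u])
  have "J *v w - x *\<^sub>R w = (\<Sum>i\<in>UNIV. (c i * (\<theta> i - x)) *\<^sub>R u i)"
    by (subst (1 2) wc)
       (simp add: linear_sum[OF matrix_vector_mul_linear] matrix_vector_mult_scaleR J
          scaleR_sum_right sum_subtractf[symmetric] algebra_simps)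
  then have nJ: "(norm (J *v w - x *\<^sub>R w))\<^sup>2 = (\<Sum>i\<in>UNIV. (c i)\<^sup>2 * (\<theta> i - x)\<^sup>2)"
    unfolding power2_norm_eq_inner by (simp add: orthonormal_family_inner[OF u] power2_eq_square mult_ac)
  have nw: "(norm w)\<^sup>2 = (\<Sum>i\<in>UNIV. (c i)\<^sup>2)"
    unfolding power2_norm_eq_inner
    by (subst (1 2) wc) (simp add: orthonormal_family_inner[OF u] power2_eq_square)
  have sq: "r\<^sup>2 < (\<theta> i - x)\<^sup>2" for i
    using far[of i] r by (metis abs_minus_commute power2_abs power_strict_mono zero_less_numeral)
  obtain k where "c k \<noteq> 0"
  proof (rule ccontr)
    assume "\<not> thesis"
    then have "\<And>i. c i = 0" using that by blast
    then show False using wc w by simp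
  qed
  have "(\<Sum>i\<in>UNIV. (c i)\<^sup>2 * r\<^sup>2) < (\<Sum>i\<in>UNIV. (c i)\<^sup>2 * (\<theta> i - x)\<^sup>2)"
  proof (rule sum_strict_mono_ex1)
    show "\<forall>i\<in>UNIV. (c i)\<^sup>2 * r\<^sup>2 \<le> (c i)\<^sup>2 * (\<theta> i - x)\<^sup>2"
      using sq by (auto intro!: mult_left_mono simp: less_imp_le)
    show "\<exists>i\<in>UNIV. (c i)\<^sup>2 * r\<^sup>2 < (c i)\<^sup>2 * (\<theta> i - x)\<^sup>2"
      using sq[of k] \<open>c k \<noteq> 0\<close> by (auto intro!: bexI[of _ k] mult_strict_left_mono)
  qed simp
  then have "(r * norm w)\<^sup>2 < (norm (J *v w - x *\<^sub>R w))\<^sup>2"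
    unfolding nJ power_mult_distrib nw by (simp add: sum_distrib_left mult.commute)
  then have "r * norm w < norm (J *v w - x *\<^sub>R w)"
    by (rule power_less_imp_less_base) simp
  also have "J *v w - x *\<^sub>R w = - (t *\<^sub>R (E *v w))"
    using w(2) by (simp add: matrix_vector_mult_add_rdistrib scaleR_matrix_vector_assoc[symmetric] algebra_simps)
  also have "norm (- (t *\<^sub>R (E *v w))) \<le> 1 * norm (E *v w)"
    using t unfolding norm_minus_cancel norm_scaleR by (intro mult_right_mono) auto
  also have "\<dots> \<le> r * norm w" using E by simp
  finally show False by simp
qed

text \<open>The columns of \<open>U\<close> diagonalize J, and det U cancels. The product form shows
  the sign of the unperturbed determinant.\<close>

lemma det_orthonormal_eigenbasis:
  fixes J :: "real ^ 'm ^ 'm" and u :: "'m \<Rightarrow> real ^ 'm"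
  assumes u: "orthonormal_family u" and J: "\<And>i. J *v u i = \<theta> i *\<^sub>R u i"
  shows "det (x *\<^sub>R mat 1 - J) = (\<Prod>i\<in>UNIV. x - \<theta> i)"
proof -
  define U :: "real ^ 'm ^ 'm" where "U = (\<chi> i j. u j $ i)"
  define D :: "real ^ 'm ^ 'm" where "D = (\<chi> i j. if i = j then x - \<theta> j else 0)"
  have "transpose U ** U = mat 1"
  proof -
    have "(transpose U ** U) $ i $ j = u i \<bullet> u j" for i j
      by (simp add: U_def transpose_def matrix_matrix_mult_def inner_vec_def)
    then show ?thesis
      using u unfolding orthonormal_family_def by (simp add: vec_eq_iff mat_def)
  qed
  then have "det U \<noteq> 0"
    by (metis det_I det_mul mult_zero_right zero_neq_one)
  have "(x *\<^sub>R mat 1 - J) ** U = U ** D"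
  proof -
    have "((x *\<^sub>R mat 1 - J) ** U) $ i $ j = ((x *\<^sub>R mat 1 - J) *v u j) $ i" for i j
      by (simp add: U_def matrix_matrix_mult_def matrix_vector_mult_def)
    moreover have "(x *\<^sub>R mat 1 - J) *v u j = (x - \<theta> j) *\<^sub>R u j" for j
      by (simp add: matrix_vector_mult_diff_rdistrib J scaleR_matrix_vector_assoc[symmetric] algebra_simps)
    moreover have "(U ** D) $ i $ j = ((x - \<theta> j) *\<^sub>R u j) $ i" for i j
      by (simp add: U_def D_def matrix_matrix_mult_def if_distrib sum.delta cong: if_cong)
    ultimately show ?thesis by (simp add: vec_eq_iff)
  qed
  then have "det (x *\<^sub>R mat 1 - J) * det U = det U * det D"
    by (metis det_mul)
  moreover have "det D = (\<Prod>i\<in>UNIV. x - \<theta> i)"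
    by (subst det_diagonal) (auto simp: D_def)
  ultimately show ?thesis using \<open>det U \<noteq> 0\<close> by simp
qed

lemma kernel_of_det_zero:
  fixes A :: "real ^ 'm ^ 'm"
  assumes "det A = 0"
  obtains w where "w \<noteq> 0" "A *v w = 0"
  using assms invertible_det_nz[of A] unfolding invertible_left_inverse matrix_left_invertible_ker by blast

text \<open>By the Bauer--Fike bound \<open>det (x - J - t E)\<close> has no zero at \<open>x = \<theta>\<^sub>i \<plusminus> r'\<close> for
  \<open>0 \<le> t \<le> 1\<close>, so between these two points it changes sign for \<open>t = 1\<close> as it does for
  \<open>t = 0\<close>.\<close>

theorem simple_spectrum_perturbation:
  fixes J E :: "real ^ 'm ^ 'm" and u :: "'m \<Rightarrow> real ^ 'm"
  assumes u: "orthonormal_family u" and J: "\<And>i. J *v u i = \<theta> i *\<^sub>R u i"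
    and E: "\<And>x. norm (E *v x) \<le> r * norm x"
    and gap: "\<And>i j. i \<noteq> j \<Longrightarrow> 2 * d \<le> \<bar>\<theta> i - \<theta> j\<bar>" and "r < d"
  obtains \<theta>' where "inj \<theta>'" "eigenvalues (J + E) = complex_of_real ` range \<theta>'"
    "\<And>i. \<bar>\<theta>' i - \<theta> i\<bar> \<le> r"
proof -
  have "0 \<le> r"
  proof -
    \<comment> \<open>Any non-zero vector would do: the norm bound on E then forces r to be
      non-negative.\<close>
    define w :: "real ^ 'm" where "w = (\<chi> i. 1)"
    have "w \<noteq> 0" by (simp add: w_def vec_eq_iff)
    moreover have "0 \<le> r * norm w"
      using E[of w] norm_ge_zero order_trans by blast
    ultimately show ?thesis by (simp add: zero_le_mult_iff)
  qed
  \<comment> \<open>Being larger than r keeps the points \<theta> i - r' and \<theta> i + r' free of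
    eigenvalues; being smaller than d keeps the intervals between them disjoint for different
    i.\<close>
  define r' where "r' = (r + d) / 2"
  have r': "r < r'" "r' < d" using \<open>r < d\<close> by (auto simp: r'_def)
  define p where "p t x = det (x *\<^sub>R mat 1 - J - t *\<^sub>R E)" for t x
  have cont_t: "continuous_on S (\<lambda>t. p t x)" for x and S :: "real set"
    unfolding p_def det_def by (intro continuous_intros)
  have cont_x: "continuous_on S (\<lambda>x. p t x)" for t and S :: "real set"
    unfolding p_def det_def by (intro continuous_intros)
  have root: "\<exists>w. w \<noteq> 0 \<and> (J + t *\<^sub>R E) *v w = x *\<^sub>R w" if "p t x = 0" for t x
  proof -
    from that obtain w where "w \<noteq> 0" "(x *\<^sub>R mat 1 - J - t *\<^sub>R E) *v w = 0"
      unfolding p_def by (rule kernel_of_det_zero)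
    then show ?thesis
      by (intro exI[of _ w]) (simp add: matrix_vector_mult_diff_rdistrib
          matrix_vector_mult_add_rdistrib scaleR_matrix_vector_assoc[symmetric] algebra_simps)
  qed
  have near: "\<exists>j. \<bar>x - \<theta> j\<bar> \<le> r" if "p t x = 0" "\<bar>t\<bar> \<le> 1" for t x
    using root[OF that(1)] bauer_fike_orthonormal[OF u J E that(2)] by blast
  \<comment> \<open>A sign difference between t = 0 and t = 1 would give a root in t, hence an
    eigenvalue x of J + t E too far from all \<theta> j.\<close>
  have same_sign: "0 < p 0 x * p 1 x" if "\<And>j. r < \<bar>x - \<theta> j\<bar>" for x
  proof (rule ccontr)
    assume "\<not> ?thesis"
    then obtain t where "0 \<le> t" "t \<le> 1" "p t x = 0"
      using sign_change_root[OF _ cont_t, of 0 1 x] by (auto simp: not_less)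
    with near[of t x] that show False by (auto simp: not_le[symmetric])
  qed
  have p0: "p 0 x = (\<Prod>j\<in>UNIV. x - \<theta> j)" for x
    using det_orthonormal_eigenbasis[OF u J] by (simp add: p_def)
  have change: "p 0 (\<theta> i - r') * p 0 (\<theta> i + r') < 0" for i
  proof -
    \<comment> \<open>The factors at the two end points are paired for each j; only the factor with
      j = i is negative.\<close>
    have "p 0 (\<theta> i - r') * p 0 (\<theta> i + r') = (\<Prod>j\<in>UNIV. (\<theta> i - \<theta> j)\<^sup>2 - r'\<^sup>2)"
      unfolding p0 prod.distrib[symmetric] by (intro prod.cong) (auto simp: power2_eq_square algebra_simps)
    also have "\<dots> = - (r'\<^sup>2) * (\<Prod>j\<in>UNIV - {i}. (\<theta> i - \<theta> j)\<^sup>2 - r'\<^sup>2)"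
      by (subst prod.remove[of _ i]) auto
    also have "\<dots> < 0"
    proof (rule mult_neg_pos)
      show "- r'\<^sup>2 < 0" using r' \<open>0 \<le> r\<close> by simp
      show "0 < (\<Prod>j\<in>UNIV - {i}. (\<theta> i - \<theta> j)\<^sup>2 - r'\<^sup>2)"
      proof (rule prod_pos)
        fix j assume "j \<in> UNIV - {i}"
        then have "r' < \<bar>\<theta> i - \<theta> j\<bar>" using gap[of i j] r' \<open>0 \<le> r\<close> by auto
        then have "r'\<^sup>2 < \<bar>\<theta> i - \<theta> j\<bar>\<^sup>2"
          using r' \<open>0 \<le> r\<close> by (intro power_strict_mono) auto
        then show "0 < (\<theta> i - \<theta> j)\<^sup>2 - r'\<^sup>2" by simp
      qed
    qed
    finally show ?thesis .
  qed
  have far: "r < \<bar>\<theta> i + s * r' - \<theta> j\<bar>" if "\<bar>s\<bar> = 1" for i j s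
  proof (cases "i = j")
    case True
    then show ?thesis using that r' \<open>0 \<le> r\<close> by (simp add: abs_mult)
  next
    case False
    have "\<bar>s * r'\<bar> = r'" using that r' \<open>0 \<le> r\<close> by (simp add: abs_mult)
    then show ?thesis using gap[OF False] r' by linarith
  qed
  have "\<exists>x. \<bar>x - \<theta> i\<bar> \<le> r \<and> p 1 x = 0" for i
  proof -
    have "0 < p 0 (\<theta> i - r') * p 1 (\<theta> i - r')" "0 < p 0 (\<theta> i + r') * p 1 (\<theta> i + r')"
      using same_sign[of "\<theta> i - r'"] same_sign[of "\<theta> i + r'"] far[of 1 i] far[of "-1" i] by auto
    with change[of i] have "p 1 (\<theta> i - r') * p 1 (\<theta> i + r') \<le> 0"
      by (auto simp: zero_less_mult_iff mult_less_0_iff mult_le_0_iff)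
    then obtain x where x: "\<theta> i - r' \<le> x" "x \<le> \<theta> i + r'" "p 1 x = 0"
      using sign_change_root[OF _ cont_x, of "\<theta> i - r'" "\<theta> i + r'" 1] r' \<open>0 \<le> r\<close> by auto
    \<comment> \<open>The root is only known to lie within r' of \<theta> i. It is within r of some
      \<theta> j, and the gap forces j = i, which sharpens r' to r.\<close>
    obtain j where j: "\<bar>x - \<theta> j\<bar> \<le> r" using near[OF x(3)] by auto
    have "j = i"
    proof (rule ccontr)
      assume "j \<noteq> i"
      from gap[OF this] show False using j x r' by linarith
    qed
    with j x show ?thesis by blast
  qed
  then obtain \<theta>' where \<theta>': "\<And>i. \<bar>\<theta>' i - \<theta> i\<bar> \<le> r" "\<And>i. p 1 (\<theta>' i) = 0"
    by metis
  have inj: "inj \<theta>'"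
  proof (rule injI, rule ccontr)
    fix i j assume "\<theta>' i = \<theta>' j" "i \<noteq> j"
    with gap[of i j] \<theta>'(1)[of i] \<theta>'(1)[of j] \<open>r < d\<close> show False by linarith
  qed
  have "\<forall>i. \<exists>w. w \<noteq> 0 \<and> (J + E) *v w = \<theta>' i *\<^sub>R w"
    using root[OF \<theta>'(2)] by simp
  then obtain w where w: "\<And>i. w i \<noteq> 0" "\<And>i. (J + E) *v w i = \<theta>' i *\<^sub>R w i"
    by metis
  show thesis
    by (rule that[OF inj eigenvalues_eq[OF inj w] \<theta>'(1)])
qed

section \<open>Moment vectors and polynomials\<close>

lemma strict_mono_pos: "strict_mono (pos :: 'm::{finite,linorder} \<Rightarrow> nat)"
  unfolding pos_def by (intro strict_monoI psubset_card_mono) auto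

lemma pos_less: "pos (k :: 'm::{finite,linorder}) < CARD('m)"
  unfolding pos_def by (intro psubset_card_mono) auto

lemma bij_betw_pos: "bij_betw (pos :: 'm \<Rightarrow> nat) UNIV {..<CARD('m::{finite,linorder})}"
proof -
  have inj: "inj (pos :: 'm \<Rightarrow> nat)"
    using strict_mono_pos strict_mono_imp_inj_on by blast
  moreover have "range (pos :: 'm \<Rightarrow> nat) = {..<CARD('m)}"
    by (intro card_subset_eq) (auto simp: pos_less card_image inj)
  ultimately show ?thesis by (simp add: bij_betw_def)
qed

lemma pos_eq_iff: "pos j = pos k \<longleftrightarrow> j = (k :: 'm::{finite,linorder})"
  using bij_betw_pos by (metis bij_betw_def injD)

lemma ex_pos:
  assumes "j < CARD('m)"
  obtains k :: "'m::{finite,linorder}" where "pos k = j"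
  using bij_betw_pos[where 'm='m] assms unfolding bij_betw_def
  by (metis imageE lessThan_iff)

lemma sum_over_pos: "(\<Sum>k\<in>UNIV. g (pos (k :: 'm::{finite,linorder}))) = (\<Sum>j<CARD('m). g j)"
  by (rule sum.reindex_bij_betw[OF bij_betw_pos])

lemma mom_pos: "mom m (pos k) = m $ k"
  by (simp add: mom_def pos_eq_iff)

text \<open>Identifies vectors with polynomials of degree less than \<open>CARD('m)\<close>, so that
  Gram matrices express orthogonality of polynomials.\<close>

definition vpoly :: "'m::{finite,linorder} rvec \<Rightarrow> real poly" where
  "vpoly b = (\<Sum>k\<in>UNIV. monom (b $ k) (pos k))"

lemma poly_vpoly: "poly (vpoly b) x = b \<bullet> pvec x"
  by (simp add: vpoly_def pvec_def poly_sum poly_monom inner_vec_def)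

lemma coeff_vpoly: "coeff (vpoly b) (pos k) = b $ k"
  by (simp add: vpoly_def coeff_sum pos_eq_iff sum.delta)

lemma degree_vpoly: "degree (vpoly (b :: 'm::{finite,linorder} rvec)) < CARD('m)"
proof -
  have "pos k \<le> CARD('m) - 1" for k :: 'm
    using pos_less[of k] by simp
  then have "degree (vpoly b) \<le> CARD('m) - 1"
    unfolding vpoly_def by (intro degree_sum_le) (auto intro!: degree_monom_le[THEN order_trans])
  then show ?thesis by (metis Suc_pred' le_imp_less_Suc zero_less_card_finite)
qed

lemma vpoly_eq_0_iff [simp]: "vpoly b = 0 \<longleftrightarrow> b = 0"
proof
  assume "vpoly b = 0"
  then show "b = 0" using coeff_vpoly[of b] by (simp add: vec_eq_iff)
qed (simp add: vpoly_def)

lemma vpoly_diff: "vpoly (a - b) = vpoly a - vpoly b"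
  by (simp add: vpoly_def sum_subtractf diff_monom[symmetric])

lemma vpoly_scaleR: "vpoly (c *\<^sub>R b) = smult c (vpoly b)"
  by (rule poly_eqI) (simp add: vpoly_def coeff_sum sum_distrib_left if_distrib cong: if_cong)

lemma vpoly_surj:
  assumes "degree q < CARD('m)"
  obtains b :: "'m::{finite,linorder} rvec" where "vpoly b = q"
proof
  let ?b = "(\<chi> k. coeff q (pos k)) :: 'm rvec"
  show "vpoly ?b = q"
  proof (rule poly_eqI)
    fix n
    show "coeff (vpoly ?b) n = coeff q n"
    proof (cases "n < CARD('m)")
      case True
      then obtain k :: 'm where "pos k = n" by (rule ex_pos)
      then show ?thesis using coeff_vpoly[of ?b k] by simp
    next
      case False
      then show ?thesis
        using assms degree_vpoly[of ?b] by (simp add: coeff_eq_0)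
    qed
  qed
qed

text \<open>Supplies the increasing labelling by the index type that \<open>gauss_nodes\<close>
  demands.\<close>

lemma strict_mono_enumeration:
  fixes D :: "real set"
  assumes "finite D" "card D = CARD('m)"
  obtains \<theta> :: "'m::{finite,linorder} \<Rightarrow> real" where "strict_mono \<theta>" "range \<theta> = D"
proof
  let ?L = "sorted_list_of_set D"
  have len: "length ?L = CARD('m)" using assms by simp
  show "strict_mono (\<lambda>k::'m. ?L ! pos k)"
    using strict_sorted_list_of_set[of D] strict_mono_pos[where 'm='m] pos_less[where 'm='m] len
    by (intro strict_monoI) (metis sorted_wrt_nth_less strict_mono_less)
  have "range (\<lambda>k::'m. ?L ! pos k) = (!) ?L ` range (pos :: 'm \<Rightarrow> nat)"
    by auto
  also have "\<dots> = set ?L"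
    using bij_betw_pos[where 'm='m] len by (auto simp: bij_betw_def set_conv_nth)
  finally show "range (\<lambda>k::'m. ?L ! pos k) = D"
    using assms by simp
qed

locale velocity_grid =
  fixes v dv :: "'n::finite rvec"
  assumes inj_v: "inj (\<lambda>l. v $ l)" and dv_pos: "0 < dv $ l"
begin

lemma poly_zero_on_grid:
  assumes "degree q < CARD('n)" "\<And>l. poly q (v $ l) = 0"
  shows "q = 0"
proof (rule ccontr)
  assume "q \<noteq> 0"
  have "CARD('n) = card (range (\<lambda>l. v $ l))" using inj_v by (simp add: card_image)
  also have "\<dots> \<le> card {x. poly q x = 0}"
    using assms \<open>q \<noteq> 0\<close> by (intro card_mono poly_roots_finite) auto
  also have "\<dots> \<le> degree q" using \<open>q \<noteq> 0\<close> by (rule card_poly_roots_bound)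
  finally show False using assms by simp
qed

text \<open>A polynomial of degree less than M has too few roots to vanish at N distinct nodes.
  Positive definiteness of H, full rank of the moment matrix, and strictness and coercivity of the
  dual objective all rest on this.\<close>

lemma pvec_zero_on_grid:
  fixes b :: "'m::{finite,linorder} rvec"
  assumes "CARD('m) \<le> CARD('n)" "\<And>l. b \<bullet> pvec (v $ l) = 0"
  shows "b = 0"
  using poly_zero_on_grid[of "vpoly b"] degree_vpoly[of b] assms by (simp add: poly_vpoly)

lemma moment_mat_vec: "moment_mat v dv *v f = (\<Sum>l\<in>UNIV. (dv $ l * f $ l) *\<^sub>R pvec (v $ l))"
  by (simp add: moment_mat_def matrix_vector_mult_def vec_eq_iff mult_ac)

lemma rank_moment_mat:
  assumes "CARD('m) \<le> CARD('n)"
  shows "rank (moment_mat v dv :: ('n, 'm::{finite,linorder}) rmat) = CARD('m)"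
proof -
  let ?A = "moment_mat v dv :: ('n, 'm) rmat"
  have "inj ((*v) (transpose ?A))"
    unfolding matrix_left_invertible_injective[symmetric] matrix_left_invertible_ker
  proof (intro allI impI)
    fix b assume b: "transpose ?A *v b = 0"
    have "b \<bullet> pvec (v $ l) = 0" for l
    proof -
      have "(transpose ?A *v b) $ l = dv $ l * (b \<bullet> pvec (v $ l))"
        unfolding matrix_vector_mult_def transpose_def moment_mat_def
        by (simp add: inner_vec_def sum_distrib_left mult_ac)
      then show ?thesis using b dv_pos[of l] by simp
    qed
    then show "b = 0" using pvec_zero_on_grid assms by blast
  qed
  then show ?thesis
    using full_rank_injective[of "transpose ?A"] by (simp add: rank_transpose)
qed

section \<open>Gram matrices acting on coefficient vectors\<close>

lemma gramH_vec:
  "gramH v dv f *v b = (\<Sum>l\<in>UNIV. (dv $ l * f $ l * (b \<bullet> pvec (v $ l))) *\<^sub>R pvec (v $ l))"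
proof -
  have "(gramH v dv f *v b) $ i = (\<Sum>j\<in>UNIV. \<Sum>l\<in>UNIV. dv $ l * f $ l * pvec (v $ l) $ i * pvec (v $ l) $ j * b $ j)" for i
    by (simp add: gramH_def matrix_vector_mult_def sum_distrib_right)
  also have "\<dots> i = (\<Sum>l\<in>UNIV. dv $ l * f $ l * (b \<bullet> pvec (v $ l)) * pvec (v $ l) $ i)" for i
    by (subst sum.swap) (simp add: inner_vec_def sum_distrib_left sum_distrib_right mult_ac)
  finally show ?thesis by (simp add: vec_eq_iff)
qed

lemma gramK_vec:
  "gramK v dv f *v b = (\<Sum>l\<in>UNIV. (dv $ l * v $ l * f $ l * (b \<bullet> pvec (v $ l))) *\<^sub>R pvec (v $ l))"
proof -
  have "(gramK v dv f *v b) $ i = (\<Sum>j\<in>UNIV. \<Sum>l\<in>UNIV. dv $ l * v $ l * f $ l * pvec (v $ l) $ i * pvec (v $ l) $ j * b $ j)" for i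
    by (simp add: gramK_def matrix_vector_mult_def sum_distrib_right)
  also have "\<dots> i = (\<Sum>l\<in>UNIV. dv $ l * v $ l * f $ l * (b \<bullet> pvec (v $ l)) * pvec (v $ l) $ i)" for i
    by (subst sum.swap) (simp add: inner_vec_def sum_distrib_left sum_distrib_right mult_ac)
  finally show ?thesis by (simp add: vec_eq_iff)
qed

lemma transpose_gram: "transpose (gramH v dv f) = gramH v dv f" "transpose (gramK v dv f) = gramK v dv f"
  by (simp_all add: gramH_def gramK_def transpose_def mult_ac)

lemma sum_square_pos:
  assumes "\<And>l. 0 < f $ l" "g k \<noteq> 0"
  shows "0 < (\<Sum>l\<in>UNIV. dv $ l * f $ l * (g l)\<^sup>2)"
proof (rule sum_pos2[of _ k])
  show "0 < dv $ k * f $ k * (g k)\<^sup>2"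
    using assms dv_pos[of k] by simp
  show "0 \<le> dv $ l * f $ l * (g l)\<^sup>2" for l
    using assms(1)[of l] dv_pos[of l] by (simp add: less_imp_le)
qed auto

lemma sym_pos_def_gramH:
  assumes "CARD('m) \<le> CARD('n)" "\<And>l. 0 < f $ l"
  shows "sym_pos_def (gramH v dv f :: ('m::{finite,linorder}, 'm) rmat)"
proof -
  have "0 < b \<bullet> (gramH v dv f *v b)" if "b \<noteq> 0" for b :: "'m rvec"
  proof -
    obtain k where k: "b \<bullet> pvec (v $ k) \<noteq> 0"
      using pvec_zero_on_grid[OF assms(1), of b] \<open>b \<noteq> 0\<close> by metis
    have "0 < (\<Sum>l\<in>UNIV. dv $ l * f $ l * (b \<bullet> pvec (v $ l))\<^sup>2)"
      using assms(2) k by (rule sum_square_pos)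
    then show ?thesis
      by (simp add: gramH_vec inner_sum_right power2_eq_square mult_ac)
  qed
  then show ?thesis by (simp add: sym_pos_def_def transpose_gram)
qed

section \<open>Gauss nodes\<close>

lemma mustar_integral:
  fixes g :: "real \<Rightarrow> real"
  assumes "\<And>l. 0 < f $ l" "continuous_on UNIV g"
  shows "integrable (mustar v dv f) g" "(LINT x|mustar v dv f. g x) = (\<Sum>l\<in>UNIV. dv $ l * f $ l * g (v $ l))"
proof -
  have nn: "0 \<le> dv $ l * f $ l" for l
    using assms(1)[of l] dv_pos[of l] by simp
  have m: "(\<lambda>l. v $ l) \<in> measurable (point_measure UNIV (\<lambda>l. ennreal (dv $ l * f $ l))) borel"
    by (simp add: measurable_point_measure_eq1)
  have g: "g \<in> borel_measurable borel"
    using assms(2) by (rule borel_measurable_continuous_onI)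
  show "integrable (mustar v dv f) g"
    unfolding mustar_def integrable_distr_eq[OF m g]
    by (intro integrable_point_measure_finite) simp
  show "(LINT x|mustar v dv f. g x) = (\<Sum>l\<in>UNIV. dv $ l * f $ l * g (v $ l))"
    unfolding mustar_def integral_distr[OF m g]
    by (subst lebesgue_integral_point_measure_finite) (simp_all add: nn)
qed

text \<open>Every test polynomial of degree less than M is some \<open>vpoly b\<close>, so the
  orthogonality conditions say that b . s = 0 for all b, where s is the moment vector of p times f;
  hence s = 0.\<close>

lemma orthogonal_poly_mustar:
  assumes "\<And>l. 0 < f $ l"
  shows "orthogonal_poly (mustar v dv f) CARD('m) p \<longleftrightarrow> p \<noteq> 0 \<and> degree p = CARD('m) \<and>
    (\<Sum>l\<in>UNIV. (dv $ l * f $ l * poly p (v $ l)) *\<^sub>R (pvec (v $ l) :: 'm::{finite,linorder} rvec)) = 0"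
proof -
  have int: "integrable (mustar v dv f) (\<lambda>x. poly p x * poly q x)"
    "(LINT x|mustar v dv f. poly p x * poly q x) = (\<Sum>l\<in>UNIV. dv $ l * f $ l * (poly p (v $ l) * poly q (v $ l)))"
    for q
    by (intro mustar_integral assms continuous_intros)+
  let ?s = "\<Sum>l\<in>UNIV. (dv $ l * f $ l * poly p (v $ l)) *\<^sub>R (pvec (v $ l) :: 'm rvec)"
  have s: "b \<bullet> ?s = (\<Sum>l\<in>UNIV. dv $ l * f $ l * (poly p (v $ l) * poly (vpoly b) (v $ l)))" for b
    by (simp add: inner_sum_right poly_vpoly mult_ac)
  have "(\<forall>q. degree q < CARD('m) \<longrightarrow> (\<Sum>l\<in>UNIV. dv $ l * f $ l * (poly p (v $ l) * poly q (v $ l))) = 0)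
    \<longleftrightarrow> (\<forall>b. b \<bullet> ?s = 0)"
    unfolding s
  proof safe
    fix b :: "'m rvec"
    assume "\<forall>q. degree q < CARD('m) \<longrightarrow> (\<Sum>l\<in>UNIV. dv $ l * f $ l * (poly p (v $ l) * poly q (v $ l))) = 0"
    then show "(\<Sum>l\<in>UNIV. dv $ l * f $ l * (poly p (v $ l) * poly (vpoly b) (v $ l))) = 0"
      using degree_vpoly[of b] by blast
  next
    fix q :: "real poly"
    assume *: "\<forall>b :: 'm rvec. (\<Sum>l\<in>UNIV. dv $ l * f $ l * (poly p (v $ l) * poly (vpoly b) (v $ l))) = 0"
    assume "degree q < CARD('m)"
    then obtain b :: "'m rvec" where "vpoly b = q" by (rule vpoly_surj)
    with * show "(\<Sum>l\<in>UNIV. dv $ l * f $ l * (poly p (v $ l) * poly q (v $ l))) = 0"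
      by blast
  qed
  also have "\<dots> \<longleftrightarrow> ?s = 0"
    by (auto dest: spec[of _ ?s])
  finally show ?thesis
    unfolding orthogonal_poly_def int(2) using int(1) by simp
qed

text \<open>The orthogonal polynomials are, up to a factor, \<open>(x - d) b(x)\<close> where \<open>b\<close> is the coefficient
  vector of a generalized eigenvector, \<open>\<K> b = d \<H> b\<close>. The latter are obtained from the symmetric
  matrix \<open>\<H>\<^sup>-\<^sup>1\<^sup>/\<^sup>2 \<K> \<H>\<^sup>-\<^sup>1\<^sup>/\<^sup>2\<close>.\<close>

theorem gauss_nodes_eigenbasis:
  assumes MN: "CARD('m::{finite,linorder}) < CARD('n)" and f: "\<And>l. 0 < f $ l"
  defines "S \<equiv> msqrt (gramH v dv f) :: ('m::{finite,linorder}, 'm) rmat"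
  obtains \<theta> :: "'m::{finite,linorder} \<Rightarrow> real" and u :: "'m::{finite,linorder} \<Rightarrow> 'm rvec" where
    "gauss_nodes (mustar v dv f) \<theta>" "inj \<theta>" "orthonormal_family u"
    "\<And>i. (matrix_inv S ** gramK v dv f ** matrix_inv S) *v u i = \<theta> i *\<^sub>R u i"
    "\<And>i. \<exists>k. v $ k < \<theta> i" "\<And>i. \<exists>k. \<theta> i < v $ k"
proof -
  let ?H = "gramH v dv f :: ('m, 'm) rmat" and ?K = "gramK v dv f :: ('m, 'm) rmat"
  have Hpd: "sym_pos_def ?H" using sym_pos_def_gramH[OF less_imp_le[OF MN]] f by blast
  have Spd: "sym_pos_def S" and SS: "S ** S = ?H" unfolding S_def using msqrt[OF Hpd] by auto
  note inv = matrix_inv_mult[OF sym_pos_def_invertible[OF Spd]]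
  have Sinv: "transpose (matrix_inv S) = matrix_inv S"
    using sym_pos_def_matrix_inv[OF Spd] by (simp add: sym_pos_def_def)
  define J where "J = matrix_inv S ** ?K ** matrix_inv S"
  have "transpose J = J"
    unfolding J_def matrix_transpose_mul transpose_gram Sinv matrix_mul_assoc ..
  then obtain u :: "'m \<Rightarrow> 'm rvec" and d where u: "orthonormal_family u" and d: "\<And>i. J *v u i = d i *\<^sub>R u i"
    using symmetric_matrix_eigenbasis[of J] by auto
  have ui: "u i \<bullet> u j = (if i = j then 1 else 0)" for i j
    using u by (simp add: orthonormal_family_def)
  define b where "b i = matrix_inv S *v u i" for i
  have Sb: "S *v b i = u i" for i
    by (simp add: b_def matrix_vector_mul_assoc inv)
  have b0: "b i \<noteq> 0" for i
    using Sb[of i] ui[of i i] by auto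
  have Kb: "?K *v b i = d i *\<^sub>R (?H *v b i)" for i
  proof -
    have "S *v (J *v u i) = (S ** matrix_inv S) *v (?K *v b i)"
      by (simp add: J_def b_def matrix_vector_mul_assoc matrix_mul_assoc)
    then have "?K *v b i = S *v (d i *\<^sub>R u i)" by (simp add: inv d)
    also have "\<dots> = d i *\<^sub>R (?H *v b i)"
      by (simp add: matrix_vector_mult_scaleR SS[symmetric] matrix_vector_mul_assoc[symmetric] Sb)
    finally show ?thesis .
  qed
  define P where "P i = [:- d i, 1:] * vpoly (b i)" for i
  have P0: "P i \<noteq> 0" for i using b0[of i] by (simp add: P_def del: mult_pCons_left)
  \<comment> \<open>The moment vector of \<open>P i\<close> times f is K b - d H b, so the
    eigenvalue equation is exactly orthogonality.\<close>
  have PP: "(\<Sum>l\<in>UNIV. (dv $ l * f $ l * poly (P i) (v $ l)) *\<^sub>R (pvec (v $ l) :: 'm rvec)) = 0" for i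
  proof -
    have "(\<Sum>l\<in>UNIV. (dv $ l * f $ l * poly (P i) (v $ l)) *\<^sub>R (pvec (v $ l) :: 'm rvec)) = ?K *v b i - d i *\<^sub>R (?H *v b i)"
      unfolding gramK_vec gramH_vec P_def scaleR_sum_right sum_subtractf[symmetric]
      by (intro sum.cong refl) (simp add: poly_vpoly algebra_simps)
    then show ?thesis by (simp add: Kb)
  qed
  \<comment> \<open>For degree less than M the moment vector is H a, and H is definite. This fixes
    the degree of every \<open>P i\<close> and its uniqueness up to a factor.\<close>
  have orth0: "q = 0" if q: "degree q < CARD('m)"
    and o: "(\<Sum>l\<in>UNIV. (dv $ l * f $ l * poly q (v $ l)) *\<^sub>R (pvec (v $ l) :: 'm rvec)) = 0" for q
  proof -
    obtain a :: "'m rvec" where a: "vpoly a = q" using vpoly_surj[OF q] by blast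
    have "?H *v a = 0" using o by (simp add: gramH_vec a[symmetric] poly_vpoly)
    then have "a = 0" using Hpd unfolding sym_pos_def_def by (metis inner_zero_right less_irrefl)
    then show ?thesis using a vpoly_eq_0_iff[of a] by simp
  qed
  have degP: "degree (P i) = CARD('m)" for i
  proof -
    have "degree (P i) = Suc (degree (vpoly (b i)))"
      unfolding P_def using b0[of i] by (subst degree_mult_eq) (simp_all del: mult_pCons_left)
    then have "degree (P i) \<le> CARD('m)" using degree_vpoly[of "b i"] by simp
    moreover have "\<not> degree (P i) < CARD('m)"
      using orth0[OF _ PP] P0 by blast
    ultimately show ?thesis by simp
  qed
  \<comment> \<open>Cross-multiplication by the leading coefficients cancels the terms of degree M,
    so the difference falls under \<open>orth0\<close>.\<close>
  have lc: "smult (lead_coeff (P j)) (P i) = smult (lead_coeff (P i)) (P j)" for i j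
  proof -
    let ?q = "smult (lead_coeff (P j)) (P i) - smult (lead_coeff (P i)) (P j)"
    have "?q = 0"
    proof (rule orth0)
      have "degree ?q \<le> CARD('m)" by (intro degree_diff_le degree_smult_le[THEN order_trans]) (simp_all add: degP)
      moreover have "coeff ?q CARD('m) = 0" using degP by simp
      ultimately show "degree ?q < CARD('m)"
        by (metis coeff_0 degree_0 le_neq_implies_less leading_coeff_0_iff zero_less_card_finite)
      have "(\<Sum>l\<in>UNIV. (dv $ l * f $ l * poly ?q (v $ l)) *\<^sub>R (pvec (v $ l) :: 'm rvec)) =
        lead_coeff (P j) *\<^sub>R (\<Sum>l\<in>UNIV. (dv $ l * f $ l * poly (P i) (v $ l)) *\<^sub>R pvec (v $ l)) -
        lead_coeff (P i) *\<^sub>R (\<Sum>l\<in>UNIV. (dv $ l * f $ l * poly (P j) (v $ l)) *\<^sub>R pvec (v $ l))"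
        unfolding scaleR_sum_right sum_subtractf[symmetric]
        by (intro sum.cong refl) (simp add: algebra_simps)
      then show "(\<Sum>l\<in>UNIV. (dv $ l * f $ l * poly ?q (v $ l)) *\<^sub>R (pvec (v $ l) :: 'm rvec)) = 0"
        by (simp add: PP)
    qed
    then show ?thesis by simp
  qed
  \<comment> \<open>For equal eigenvalues the common factor x - d cancels from the proportional
    \<open>P i\<close> and \<open>P j\<close>. Then \<open>b i\<close> and \<open>b j\<close>, and
    so \<open>u i\<close> and \<open>u j\<close>, would be proportional, against
    orthonormality.\<close>
  have injd: "inj d"
  proof (rule injI, rule ccontr)
    fix i j assume eq: "d i = d j" and ne: "i \<noteq> j"
    define L where "L i = lead_coeff (P i)" for i
    have "[:- d j, 1:] * vpoly (L j *\<^sub>R b i - L i *\<^sub>R b j) = smult (L j) (P i) - smult (L i) (P j)"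
      unfolding vpoly_diff vpoly_scaleR P_def eq by (simp only: right_diff_distrib mult_smult_right)
    then have "[:- d j, 1:] * vpoly (L j *\<^sub>R b i - L i *\<^sub>R b j) = 0"
      using lc[of j i] by (simp add: L_def del: mult_pCons_left)
    then have "L j *\<^sub>R b i = L i *\<^sub>R b j" by (simp del: mult_pCons_left)
    then have "L j *\<^sub>R u i = L i *\<^sub>R u j"
      by (metis Sb matrix_vector_mult_scaleR)
    then have "L j * (u i \<bullet> u i) = L i * (u j \<bullet> u i)"
      by (metis inner_scaleR_left)
    then have "L j = 0" using ne by (simp add: ui)
    then show False using P0[of j] by (simp add: L_def)
  qed
  \<comment> \<open>An arbitrary index: all \<open>P i\<close> are proportional, so any of them
    serves as the orthogonal polynomial.\<close>
  obtain i0 :: 'm where True by blast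
  have roots: "range d = {x. poly (P i0) x = 0}"
  proof (rule card_seteq)
    show "finite {x. poly (P i0) x = 0}" using P0 by (rule poly_roots_finite)
    show "range d \<subseteq> {x. poly (P i0) x = 0}"
    proof clarify
      fix i
      have "lead_coeff (P i) * poly (P i0) (d i) = lead_coeff (P i0) * poly (P i) (d i)"
        using lc[of i i0] by (metis poly_smult)
      also have "poly (P i) (d i) = 0" by (simp add: P_def)
      finally show "poly (P i0) (d i) = 0" using P0[of i] by simp
    qed
    show "card {x. poly (P i0) x = 0} \<le> card (range d)"
      using card_poly_roots_bound[OF P0[of i0]] injd by (simp add: degP card_image)
  qed
  have "card (range d) = CARD('m)" using injd by (simp add: card_image)
  then obtain \<theta> :: "'m \<Rightarrow> real" where th: "strict_mono \<theta>" "range \<theta> = range d"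
    using strict_mono_enumeration[of "range d"] by auto
  then have "\<forall>i. \<exists>k. \<theta> i = d k" by auto
  \<comment> \<open>The map \<open>s\<close> reorders the eigenbasis so that its eigenvalues
    increase.\<close>
  then obtain s where s: "\<And>i. \<theta> i = d (s i)" by metis
  have injth: "inj \<theta>" using th(1) strict_mono_imp_inj_on by blast
  have injs: "inj s" using injth s by (metis injD injI)
  show thesis
  proof (rule that[of \<theta> "u \<circ> s"])
    have "orthogonal_poly (mustar v dv f) CARD('m) (P i0)"
      unfolding orthogonal_poly_mustar[OF f] using P0 degP PP by blast
    then show "gauss_nodes (mustar v dv f) \<theta>"
      unfolding gauss_nodes_def using th roots by auto
    show "inj \<theta>" by fact
    show "orthonormal_family (u \<circ> s)"
      using injs by (auto simp: orthonormal_family_def ui dest: injD)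
    show "(matrix_inv S ** ?K ** matrix_inv S) *v (u \<circ> s) i = \<theta> i *\<^sub>R (u \<circ> s) i" for i
      using d[of "s i"] by (simp add: s J_def)
    \<comment> \<open>Pairing K b = d H b with b shows that d i is the mean of the nodes for the
      non-negative weights dv f b(v)^2, hence lies between the extreme nodes.\<close>
    have mean: "(\<Sum>l\<in>UNIV. dv $ l * f $ l * (b i \<bullet> pvec (v $ l))\<^sup>2 * (v $ l - d i)) = 0" for i
    proof -
      have "b i \<bullet> (?K *v b i) - d i * (b i \<bullet> (?H *v b i)) = 0" by (simp add: Kb)
      then show ?thesis
        by (simp add: gramK_vec gramH_vec inner_sum_right sum_distrib_left sum_subtractf[symmetric]
            power2_eq_square algebra_simps)
    qed
    \<comment> \<open>Strictness of these bounds: otherwise \<open>P i\<close>, of degree M < N,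
      would vanish at all N nodes.\<close>
    have ne: "\<exists>l. v $ l \<noteq> d i \<and> b i \<bullet> pvec (v $ l) \<noteq> 0" for i
    proof (rule ccontr)
      assume "\<not> ?thesis"
      then have "poly (P i) (v $ l) = 0" for l
        by (auto simp: P_def poly_vpoly)
      then show False using poly_zero_on_grid[of "P i"] degP MN P0 by simp
    qed
    show "\<exists>k. v $ k < \<theta> i" for i
    proof (rule ccontr)
      assume "\<not> ?thesis"
      then have le: "0 \<le> v $ k - d (s i)" for k by (auto simp: s not_less)
      obtain l where l: "v $ l \<noteq> d (s i)" "b (s i) \<bullet> pvec (v $ l) \<noteq> 0" using ne by blast
      have "0 < (\<Sum>l\<in>UNIV. dv $ l * f $ l * (b (s i) \<bullet> pvec (v $ l))\<^sup>2 * (v $ l - d (s i)))"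
        by (rule sum_pos2[of _ l])
           (use l le[of l] dv_pos f le in \<open>auto simp: less_le\<close>)
      with mean[of "s i"] show False by simp
    qed
    show "\<exists>k. \<theta> i < v $ k" for i
    proof (rule ccontr)
      assume "\<not> ?thesis"
      then have le: "0 \<le> d (s i) - v $ k" for k by (auto simp: s not_less)
      obtain l where l: "v $ l \<noteq> d (s i)" "b (s i) \<bullet> pvec (v $ l) \<noteq> 0" using ne by blast
      have "0 < (\<Sum>l\<in>UNIV. dv $ l * f $ l * (b (s i) \<bullet> pvec (v $ l))\<^sup>2 * (d (s i) - v $ l))"
        by (rule sum_pos2[of _ l])
           (use l le[of l] dv_pos f le in \<open>auto simp: less_le\<close>)
      also have "\<dots> = - (\<Sum>l\<in>UNIV. dv $ l * f $ l * (b (s i) \<bullet> pvec (v $ l))\<^sup>2 * (v $ l - d (s i)))"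
        by (simp add: sum_negf[symmetric] algebra_simps)
      finally show False using mean[of "s i"] by simp
    qed
  qed
qed

end

section \<open>The dual problem\<close>

text \<open>Squaring the weak inequality at x / 2 gains the term x^2 / 4.\<close>

lemma exp_gt_tangent:
  fixes x :: real
  assumes "x \<noteq> 0"
  shows "1 + x < exp x"
proof (cases "1 + x / 2 \<ge> 0")
  case True
  have "0 < x\<^sup>2" using assms by simp
  then have "1 + x < (1 + x / 2)\<^sup>2" by (simp add: power2_eq_square field_simps)
  also have "\<dots> \<le> (exp (x / 2))\<^sup>2"
    using exp_ge_add_one_self[of "x / 2"] True by (intro power_mono) auto
  also have "\<dots> = exp x" by (simp add: exp_double[symmetric])
  finally show ?thesis .
next
  case False
  then show ?thesis using exp_gt_zero[of x] by linarith
qed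

text \<open>The inequality 1 + s < exp s at s = ln a - ln x, multiplied by x. At x = 0 the
  convention 0 log 0 = 0 leaves - a < 0.\<close>

lemma entropy_tangent:
  fixes x a :: real
  assumes "0 \<le> x" "0 < a"
  shows "a * ln a + (1 + ln a) * (x - a) \<le> x * ln x"
    and "x \<noteq> a \<Longrightarrow> a * ln a + (1 + ln a) * (x - a) < x * ln x"
proof -
  show strict: "a * ln a + (1 + ln a) * (x - a) < x * ln x" if "x \<noteq> a"
  proof (cases "x = 0")
    case True
    then show ?thesis using assms by (simp add: algebra_simps)
  next
    case False
    with assms have "0 < x" by simp
    have "ln a - ln x \<noteq> 0" using that \<open>0 < x\<close> assms by simp
    from exp_gt_tangent[OF this] have "x * (1 + (ln a - ln x)) < x * exp (ln a - ln x)"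
      using \<open>0 < x\<close> by simp
    also have "\<dots> = a" using \<open>0 < x\<close> assms by (simp add: exp_diff)
    finally show ?thesis by (simp add: algebra_simps)
  qed
  then show "a * ln a + (1 + ln a) * (x - a) \<le> x * ln x"
    by (cases "x = a") auto
qed

lemma linear_plus_exp_coercive:
  fixes a E :: real
  assumes "0 < a" "0 < E"
  obtains C where "\<And>s. a * \<bar>s\<bar> - C \<le> a * s + E * exp (- s)"
proof
  \<comment> \<open>Chosen so that E exp k = 2 a: for negative s the tangent of the exponential at k
    contributes 2 a |s|, and a |s| remains after adding a s.\<close>
  define k where "k = ln (2 * a / E)"
  fix s
  show "a * \<bar>s\<bar> - \<bar>2 * a * (1 - k)\<bar> \<le> a * s + E * exp (- s)"
  proof (cases "s \<ge> 0")
    case True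
    then show ?thesis using assms by (simp add: add_increasing2)
  next
    case False
    have "E * exp k = 2 * a" using assms by (simp add: k_def)
    then have "E * exp (- s) = 2 * a * exp (- s - k)"
      by (metis (no_types, opaque_lifting) exp_add diff_add_cancel mult.assoc mult.commute)
    moreover have "2 * a * (1 + (- s - k)) \<le> 2 * a * exp (- s - k)"
      using assms by (intro mult_left_mono) auto
    ultimately show ?thesis using False by (simp add: algebra_simps abs_if)
  qed
qed

context velocity_grid
begin

definition dens :: "'n rvec \<Rightarrow> 'm::{finite,linorder} rvec \<Rightarrow> 'n rvec" where
  "dens c y = (\<chi> l. exp (- 1 - c $ l - y \<bullet> pvec (v $ l)))"

text \<open>This is \<Phi>(y, c), with c standing for \<lambda> \<kappa> but not tied to any
  weighting.\<close>

definition dmom :: "'n rvec \<Rightarrow> 'm::{finite,linorder} rvec \<Rightarrow> 'm rvec" where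
  "dmom c y = (\<Sum>l\<in>UNIV. (dv $ l * dens c y $ l) *\<^sub>R pvec (v $ l))"

definition multiplier :: "'n rvec \<Rightarrow> 'm::{finite,linorder} rvec \<Rightarrow> 'm rvec" where
  "multiplier c m = (THE y. dmom c y = m)"

definition dual :: "'n rvec \<Rightarrow> 'm::{finite,linorder} rvec \<Rightarrow> 'm rvec \<Rightarrow> real" where
  "dual c m y = y \<bullet> m + (\<Sum>l\<in>UNIV. dv $ l * dens c y $ l)"

lemma dens_pos: "0 < dens c y $ l"
  by (simp add: dens_def)

lemma ln_dens: "ln (dens c y $ l) = - 1 - c $ l - y \<bullet> pvec (v $ l)"
  by (simp add: dens_def)

lemma inner_dmom: "a \<bullet> dmom c y = (\<Sum>l\<in>UNIV. dv $ l * dens c y $ l * (a \<bullet> pvec (v $ l)))"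
  by (simp add: dmom_def inner_sum_right)

lemma moment_mat_dens: "moment_mat v dv *v dens c y = dmom c y"
  by (simp add: moment_mat_vec dmom_def)

text \<open>Passing from y to y' multiplies the density by exp (s l). The tangent of exp at 0 leaves
  a linear term that the moment term of the dual absorbs, and some s k is not zero. So every y is
  the strict global minimizer for its own moments.\<close>

lemma dual_strict_min:
  fixes y y' :: "'m::{finite,linorder} rvec"
  assumes MN: "CARD('m) \<le> CARD('n)" and "y' \<noteq> y"
  shows "dual c (dmom c y) y < dual c (dmom c y) y'"
proof -
  define s where "s l = (y - y') \<bullet> pvec (v $ l)" for l
  have d': "dens c y' $ l = dens c y $ l * exp (s l)" for l
    by (simp add: dens_def s_def exp_add[symmetric] algebra_simps)
  obtain k where k: "s k \<noteq> 0"
    using pvec_zero_on_grid[OF MN, of "y - y'"] assms(2) unfolding s_def by auto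
  have "(\<Sum>l\<in>UNIV. dv $ l * dens c y $ l * (1 + s l)) < (\<Sum>l\<in>UNIV. dv $ l * dens c y' $ l)"
  proof (rule sum_strict_mono_ex1)
    show "\<forall>l\<in>UNIV. dv $ l * dens c y $ l * (1 + s l) \<le> dv $ l * dens c y' $ l"
      unfolding d' mult.assoc
      by (auto intro!: mult_left_mono less_imp_le[OF dv_pos] less_imp_le[OF dens_pos])
    have "dv $ k * dens c y $ k * (1 + s k) < dv $ k * dens c y' $ k"
      unfolding d' mult.assoc
      by (intro mult_strict_left_mono exp_gt_tangent k dv_pos dens_pos)
    then show "\<exists>l\<in>UNIV. dv $ l * dens c y $ l * (1 + s l) < dv $ l * dens c y' $ l" by blast
  qed simp
  then show ?thesis
    unfolding dual_def s_def inner_dmom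
    by (simp add: algebra_simps sum.distrib sum_subtractf)
qed

lemma dmom_inj:
  fixes y y' :: "'m::{finite,linorder} rvec"
  assumes "CARD('m) \<le> CARD('n)" "dmom c y = dmom c y'"
  shows "y = y'"
  using dual_strict_min[OF assms(1), of y y' c] dual_strict_min[OF assms(1), of y' y c] assms(2)
  by (metis less_asym)

lemma multiplier_dmom:
  fixes y :: "'m::{finite,linorder} rvec"
  assumes "CARD('m) \<le> CARD('n)"
  shows "multiplier c (dmom c y) = y"
  unfolding multiplier_def using dmom_inj[OF assms] by blast

lemma dens_has_derivative:
  fixes y :: "'m::{finite,linorder} rvec"
  shows "((\<lambda>p. dens (snd p) (fst p) $ l) has_derivative
    (\<lambda>d. - dens c y $ l * (snd d $ l + fst d \<bullet> pvec (v $ l)))) (at (y, c))"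
  unfolding dens_def
  by (auto intro!: derivative_eq_intros bounded_linear.has_derivative[OF bounded_linear_vec_nth]
      simp: algebra_simps)

text \<open>Writing \<open>m = \<A> f\<^sub>0\<close> with \<open>f\<^sub>0 > 0\<close>, the dual objective is a sum of coercive functions of the
  numbers \<open>y \<bullet> p(v\<^sub>l)\<close>.\<close>

theorem dual_solvable:
  fixes m :: "'m::{finite,linorder} rvec"
  assumes MN: "CARD('m) \<le> CARD('n)" and "m \<in> realizable v dv"
  obtains y where "dmom c y = m"
proof -
  obtain f0 where f0: "\<And>l. 0 < f0 $ l" and m: "m = moment_mat v dv *v f0"
    using assms(2) unfolding realizable_def by auto
  have "\<forall>l. \<exists>C. \<forall>s. f0 $ l * \<bar>s\<bar> - C \<le> f0 $ l * s + exp (- 1 - c $ l) * exp (- s)"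
    using linear_plus_exp_coercive[OF f0 exp_gt_zero] by metis
  then obtain C where C: "\<And>l s. f0 $ l * \<bar>s\<bar> - C l \<le> f0 $ l * s + exp (- 1 - c $ l) * exp (- s)"
    by metis
  define ev :: "'m rvec \<Rightarrow> 'n rvec" where "ev y = (\<chi> l. y \<bullet> pvec (v $ l))" for y
  have lin: "linear ev"
    by (intro linearI) (simp_all add: ev_def vec_eq_iff inner_simps)
  moreover have "inj ev"
    unfolding linear_injective_0[OF lin] using pvec_zero_on_grid[OF MN] by (simp add: ev_def vec_eq_iff)
  ultimately obtain B where B: "B > 0" "\<And>y. B * norm y \<le> norm (ev y)"
    using linear_inj_bounded_below_pos by blast
  define a where "a = Min (range (\<lambda>l. dv $ l * f0 $ l))"
  have a: "a > 0" unfolding a_def using dv_pos f0 by simp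
  have al: "a \<le> dv $ l * f0 $ l" for l unfolding a_def by simp
  define C0 where "C0 = (\<Sum>l\<in>UNIV. dv $ l * C l)"
  have lower: "a * B * norm y - C0 \<le> dual c m y" for y
  proof -
    have "a * B * norm y \<le> a * (\<Sum>l\<in>UNIV. \<bar>ev y $ l\<bar>)"
      using B(2)[of y] norm_le_l1_cart[of "ev y"] a by (simp add: mult.assoc)
    also have "\<dots> \<le> (\<Sum>l\<in>UNIV. dv $ l * f0 $ l * \<bar>ev y $ l\<bar>)"
      unfolding sum_distrib_left using al by (intro sum_mono mult_right_mono) auto
    also have "\<dots> - C0 = (\<Sum>l\<in>UNIV. dv $ l * (f0 $ l * \<bar>ev y $ l\<bar> - C l))"
      by (simp add: C0_def sum_subtractf[symmetric] algebra_simps)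
    also have "\<dots> \<le> (\<Sum>l\<in>UNIV. dv $ l * (f0 $ l * (ev y $ l) + exp (- 1 - c $ l) * exp (- (ev y $ l))))"
      using C dv_pos by (intro sum_mono mult_left_mono) (auto simp: less_imp_le)
    also have "\<dots> = dual c m y"
      unfolding dual_def m moment_mat_vec inner_sum_right dens_def ev_def
      by (simp add: sum.distrib[symmetric] algebra_simps mult_exp_exp)
    finally show ?thesis by simp
  qed
  have der: "((dual c m) has_derivative (\<lambda>h. h \<bullet> (m - dmom c y))) (at y)" for y
  proof -
    have d: "((\<lambda>y. dens c y $ l) has_derivative (\<lambda>h. - dens c y $ l * (h \<bullet> pvec (v $ l)))) (at y)" for l
      unfolding dens_def by (auto intro!: derivative_eq_intros simp: algebra_simps)
    show ?thesis
      unfolding dual_def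
      by (rule derivative_eq_intros d refl)+
         (simp add: inner_diff_right inner_dmom sum_negf mult_ac fun_eq_iff)
  qed
  \<comment> \<open>Outside the ball of radius R the lower bound exceeds the value at 0. The
    absolute value makes R non-negative, so 0 lies in the ball and the minimum over the ball is
    global.\<close>
  define R where "R = \<bar>dual c m 0 + C0\<bar> / (a * B)"
  have cont: "continuous_on (cball 0 R) (dual c m)"
    by (rule has_derivative_continuous_on) (rule has_derivative_at_withinI[OF der])
  have "0 \<le> R" using a B by (simp add: R_def)
  then have "cball 0 R \<noteq> ({} :: 'm rvec set)" by simp
  from continuous_attains_inf[OF compact_cball this cont]
  obtain y where y: "\<And>y'. y' \<in> cball 0 R \<Longrightarrow> dual c m y \<le> dual c m y'"
    by blast
  have min: "dual c m y \<le> dual c m y'" for y'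
  proof (cases "y' \<in> cball 0 R")
    case False
    then have "R < norm y'" by simp
    then have "dual c m 0 + C0 < a * B * norm y'"
      using a B unfolding R_def by (simp add: field_simps)
    then have "dual c m 0 < dual c m y'" using lower[of y'] by linarith
    moreover have "dual c m y \<le> dual c m 0" using y[of 0] \<open>0 \<le> R\<close> by simp
    ultimately show ?thesis by simp
  qed (rule y)
  have "(\<lambda>h. h \<bullet> (m - dmom c y)) = (\<lambda>h. 0)"
    by (rule differential_zero_maxmin[OF UNIV_I open_UNIV der]) (use min in blast)
  then have "m - dmom c y = 0"
    by (metis inner_eq_zero_iff)
  then show thesis using that[of y] by simp
qed

lemma dmom_multiplier:
  fixes m :: "'m::{finite,linorder} rvec"
  assumes "CARD('m) \<le> CARD('n)" "m \<in> realizable v dv"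
  shows "dmom c (multiplier c m) = m"
  using dual_solvable[OF assms] multiplier_dmom[OF assms(1)] by metis

lemma ystar_eq:
  fixes m :: "'m::{finite,linorder} rvec"
  assumes MN: "CARD('m) \<le> CARD('n)" and m: "m \<in> realizable v dv"
  shows "ystar lam v dv w m = multiplier (\<chi> l. lam * kappa dv w l) m"
proof -
  let ?c = "\<chi> l. lam * kappa dv w l"
  have eq: "dual_obj lam v dv w m = dual ?c m"
    by (simp add: fun_eq_iff dual_obj_def dual_def dens_def)
  have min: "dual ?c m (multiplier ?c m) < dual ?c m y" if "y \<noteq> multiplier ?c m" for y
    using dual_strict_min[OF MN that, of ?c] dmom_multiplier[OF MN m] by simp
  show ?thesis
    unfolding ystar_def eq is_arg_min_def
    by (rule the_equality) (use min less_asym less_irrefl in metis)+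
qed

text \<open>In terms of f = w g the penalty is linear, \<lambda> g = dv c f for g \<ge> 0. The
  tangents of x log x at the candidate differ from its own value by y paired with a difference of
  moments, which vanishes for every feasible competitor.\<close>

lemma fstar_eq:
  fixes m :: "'m::{finite,linorder} rvec" and w :: "'n rvec" and lam :: real
  assumes MN: "CARD('m) \<le> CARD('n)" and m: "m \<in> realizable v dv" and w: "\<And>l. 0 < w $ l"
  defines "c \<equiv> \<chi> l. lam * kappa dv w l"
  shows "fstar lam v dv w m = dens c (multiplier c m)"
proof -
  define y where "y = multiplier c m"
  have my: "dmom c y = m" using dmom_multiplier[OF MN m] by (simp add: y_def)
  define f where "f = dens c y"
  define g :: "'n rvec" where "g = (\<chi> l. f $ l / w $ l)"
  have fg: "f $ l = w $ l * g $ l" for l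
    using w[of l] by (simp add: g_def)
  have f0: "0 < f $ l" for l by (simp add: f_def dens_pos)
  have obj: "primal_obj lam dv w h = (\<Sum>l\<in>UNIV. dv $ l * ((w $ l * h $ l) * ln (w $ l * h $ l) + c $ l * (w $ l * h $ l)))"
    if "\<And>l. 0 \<le> h $ l" for h
  proof -
    have "lam * \<bar>h $ l\<bar> = dv $ l * (c $ l * (w $ l * h $ l))" for l
      using that[of l] dv_pos[of l] w[of l] by (simp add: c_def kappa_def field_simps)
    then show ?thesis
      by (simp add: primal_obj_def sum_distrib_left sum.distrib[symmetric] algebra_simps)
  qed
  have g0: "0 \<le> g $ l" for l using f0[of l] w[of l] by (simp add: g_def)
  have feas: "feasible v dv w m g"
    using g0 moment_mat_dens[of c y] my
    by (simp add: feasible_def fg[symmetric] f_def)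
  have min: "primal_obj lam dv w g < primal_obj lam dv w h" if h: "feasible v dv w m h" "h \<noteq> g" for h
  proof -
    have h0: "0 \<le> h $ l" for l using h by (simp add: feasible_def)
    define q where "q l = w $ l * h $ l" for l
    have q0: "0 \<le> q l" for l using h0[of l] w[of l] by (simp add: q_def)
    have qm: "(\<Sum>l\<in>UNIV. (dv $ l * q l) *\<^sub>R pvec (v $ l)) = m"
      using h(1) by (simp add: feasible_def moment_mat_vec q_def)
    obtain k where "h $ k \<noteq> g $ k" using h(2) by (auto simp: vec_eq_iff)
    then have k: "q k \<noteq> f $ k" using w[of k] by (simp add: q_def fg)
    let ?t = "\<lambda>l. f $ l * ln (f $ l) + (1 + ln (f $ l)) * (q l - f $ l) + c $ l * q l"
    have lt: "(\<Sum>l\<in>UNIV. dv $ l * ?t l) < (\<Sum>l\<in>UNIV. dv $ l * (q l * ln (q l) + c $ l * q l))"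
    proof (rule sum_strict_mono_ex1)
      show "\<forall>l\<in>UNIV. dv $ l * ?t l \<le> dv $ l * (q l * ln (q l) + c $ l * q l)"
        using entropy_tangent(1)[OF q0 f0] dv_pos
        by (auto intro!: mult_left_mono simp: less_imp_le)
      have "dv $ k * ?t k < dv $ k * (q k * ln (q k) + c $ k * q k)"
        using entropy_tangent(2)[OF q0 f0 k] dv_pos by (intro mult_strict_left_mono) auto
      then show "\<exists>l\<in>UNIV. dv $ l * ?t l < dv $ l * (q l * ln (q l) + c $ l * q l)" by blast
    qed simp
    have "?t l - (f $ l * ln (f $ l) + c $ l * f $ l) = (y \<bullet> pvec (v $ l)) * f $ l - (y \<bullet> pvec (v $ l)) * q l" for l
      by (simp add: f_def ln_dens algebra_simps)
    then have "(\<Sum>l\<in>UNIV. dv $ l * ?t l) - (\<Sum>l\<in>UNIV. dv $ l * (f $ l * ln (f $ l) + c $ l * f $ l))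
       = (\<Sum>l\<in>UNIV. dv $ l * ((y \<bullet> pvec (v $ l)) * f $ l - (y \<bullet> pvec (v $ l)) * q l))"
      by (simp add: sum_subtractf[symmetric] right_diff_distrib[symmetric])
    also have "\<dots> = y \<bullet> dmom c y - y \<bullet> (\<Sum>l\<in>UNIV. (dv $ l * q l) *\<^sub>R pvec (v $ l))"
      by (simp add: inner_dmom inner_sum_right sum_subtractf[symmetric] f_def algebra_simps)
    also have "\<dots> = 0" by (simp add: my qm)
    finally have "(\<Sum>l\<in>UNIV. dv $ l * (f $ l * ln (f $ l) + c $ l * f $ l)) = (\<Sum>l\<in>UNIV. dv $ l * ?t l)"
      by simp
    with lt show ?thesis
      unfolding obj[OF g0] obj[OF h0] fg[symmetric] q_def[symmetric] by simp
  qed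
  have "gstar lam v dv w m = g"
    unfolding gstar_def is_arg_min_def
    by (rule the_equality) (use min feas less_asym less_irrefl in metis)+
  then show ?thesis
    by (simp add: fstar_def fg[symmetric] vec_eq_iff f_def y_def)
qed

lemma open_realizable:
  assumes MN: "CARD('m) \<le> CARD('n)"
  shows "open (realizable v dv :: 'm::{finite,linorder} rvec set)"
proof -
  let ?A = "moment_mat v dv :: ('n, 'm) rmat"
  have "surj ((*v) ?A)"
    using full_rank_surjective[of ?A] rank_moment_mat[OF MN] by simp
  moreover have "open {f :: 'n rvec. \<forall>l. 0 < f $ l}"
    unfolding Collect_all_eq
    by (intro open_INT ballI finite open_Collect_less continuous_intros)
  moreover have "realizable v dv = (*v) ?A ` {f. \<forall>l. 0 < f $ l}"
    by (auto simp: realizable_def)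
  ultimately show ?thesis
    using open_surjective_linear_image[OF _ matrix_vector_mul_linear] by metis
qed

text \<open>The inverse function theorem for \<open>(y, c) \<mapsto> (m, c)\<close>.\<close>

lemma multiplier_has_derivative:
  fixes y :: "'m::{finite,linorder} rvec"
  assumes MN: "CARD('m) \<le> CARD('n)"
  shows "((\<lambda>p. multiplier (snd p) (fst p)) has_derivative
    (\<lambda>d. - (matrix_inv (gramH v dv (dens c y)) *v
       (fst d + (\<Sum>l\<in>UNIV. (dv $ l * dens c y $ l * snd d $ l) *\<^sub>R pvec (v $ l)))))) (at (dmom c y, c))"
proof -
  let ?H = "gramH v dv (dens c y) :: ('m, 'm) rmat"
  note inv = matrix_inv_mult[OF sym_pos_def_invertible[OF sym_pos_def_gramH[OF MN dens_pos]]]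
  let ?\<Psi> = "\<lambda>p :: 'm rvec \<times> 'n rvec. (dmom (snd p) (fst p), snd p)"
  let ?G = "\<lambda>p :: 'm rvec \<times> 'n rvec. (multiplier (snd p) (fst p), snd p)"
  let ?s = "\<lambda>e :: 'n rvec. (\<Sum>l\<in>UNIV. (dv $ l * dens c y $ l * e $ l) *\<^sub>R pvec (v $ l)) :: 'm rvec"
  have der: "(?\<Psi> has_derivative (\<lambda>d. (- (?s (snd d) + gramH v dv (dens c' y') *v fst d) , snd d))) (at (y', c'))"
    if "c' = c" "y' = y" for c' y'
    unfolding dmom_def that
    by (rule derivative_eq_intros dens_has_derivative refl)+
       (auto simp: fun_eq_iff gramH_vec sum_negf[symmetric] sum.distrib[symmetric] algebra_simps)
  have dens_cont: "continuous_on UNIV (\<lambda>p :: 'm rvec \<times> 'n rvec. dens (snd p) (fst p) $ l)" for l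
    unfolding dens_def by (simp, intro continuous_intros)
  have cont: "continuous_on UNIV ?\<Psi>"
    unfolding dmom_def by (intro continuous_intros dens_cont)
  let ?G' = "\<lambda>d. (- (matrix_inv ?H *v (fst d + ?s (snd d))), snd d)"
  \<comment> \<open>The left inverse \<open>?G\<close> is already known globally from injectivity,
    so the derivative at one point and a right inverse of it suffice.\<close>
  have "(?G has_derivative ?G') (at (?\<Psi> (y, c)))"
  proof (rule has_derivative_inverse_strong[OF open_UNIV UNIV_I cont _ der[OF refl refl]])
    show "?G (?\<Psi> p) = p" for p
      by (simp add: multiplier_dmom[OF MN])
    show "(\<lambda>d. (- (?s (snd d) + ?H *v fst d), snd d)) \<circ> ?G' = id"
      by (auto simp: fun_eq_iff matrix_vector_mul_assoc inv linear_neg[OF matrix_vector_mul_linear])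
  qed
  from has_derivative_fst[OF this] show ?thesis by simp
qed

text \<open>Differentiating the moment identity gives - H y' - sum dv f c' p = h, whose solution is
  \<open>y'\<close>. The differentiated quantity is the product \<open>lam * kappa\<close>: at
  \<open>lam = 0\<close> it has derivative 0 for any weighting, smooth or not, so both parts of the
  final result can use the lemma.\<close>

lemma reconstruction_has_derivative:
  fixes m :: "'m::{finite,linorder} rvec" and W :: "'m rvec \<Rightarrow> 'n rvec"
    and lam :: real and c' :: "'n \<Rightarrow> 'm rvec \<Rightarrow> real"
  assumes MN: "CARD('m) \<le> CARD('n)" and U: "open U" "m \<in> U" "U \<subseteq> realizable v dv"
    and W: "\<And>m' l. m' \<in> U \<Longrightarrow> 0 < W m' $ l"
    and c': "\<And>l. ((\<lambda>m'. lam * kappa dv (W m') l) has_derivative c' l) (at m)"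
  defines "f \<equiv> fstar lam v dv (W m) m"
  defines "y' \<equiv> \<lambda>h. - (matrix_inv (gramH v dv f) *v (h + (\<Sum>k\<in>UNIV. (dv $ k * f $ k * c' k h) *\<^sub>R pvec (v $ k))))"
  shows "((\<lambda>m'. ystar lam v dv (W m') m') has_derivative y') (at m)"
    and "((\<lambda>m'. fstar lam v dv (W m') m' $ l) has_derivative
       (\<lambda>h. - f $ l * (c' l h + y' h \<bullet> pvec (v $ l)))) (at m)"
proof -
  define c where "c m' = (\<chi> l. lam * kappa dv (W m') l)" for m'
  define y where "y m' = multiplier (c m') m'" for m'
  have f: "f = dens (c m) (y m)"
    unfolding f_def c_def y_def by (intro fstar_eq MN W subsetD[OF U(3)] U(2))
  have dm: "dmom (c m) (y m) = m"
    unfolding y_def by (intro dmom_multiplier MN subsetD[OF U(3)] U(2))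
  have dc: "(c has_derivative (\<lambda>h. \<chi> l. c' l h)) (at m)"
    unfolding has_derivative_componentwise_within[of c]
  proof
    fix b :: "'n rvec" assume "b \<in> Basis"
    then obtain i where "b = axis i 1" by (auto simp: Basis_vec_def)
    then show "((\<lambda>x. c x \<bullet> b) has_derivative (\<lambda>x. (\<chi> l. c' l x) \<bullet> b)) (at m)"
      using c'[of i] by (simp add: inner_axis c_def)
  qed
  have d: "((\<lambda>m'. (m', c m')) has_derivative (\<lambda>h. (h, \<chi> l. c' l h))) (at m)"
    by (intro has_derivative_Pair dc has_derivative_ident)
  have mul: "((\<lambda>p. multiplier (snd p) (fst p)) has_derivative
      (\<lambda>d. - (matrix_inv (gramH v dv f) *v
        (fst d + (\<Sum>l\<in>UNIV. (dv $ l * f $ l * snd d $ l) *\<^sub>R pvec (v $ l)))))) (at (m, c m))"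
    using multiplier_has_derivative[OF MN, of "c m" "y m"] unfolding dm f[symmetric] .
  have dy: "(y has_derivative y') (at m)"
    using has_derivative_compose[OF d mul]
    unfolding y_def[abs_def] y'_def fst_conv snd_conv vec_lambda_beta .
  then show "((\<lambda>m'. ystar lam v dv (W m') m') has_derivative y') (at m)"
    by (rule has_derivative_transform_within_open[OF _ U(1,2)])
       (use U(3) ystar_eq[OF MN] in \<open>auto simp: y_def c_def\<close>)
  have "((\<lambda>m'. (y m', c m')) has_derivative (\<lambda>h. (y' h, \<chi> l. c' l h))) (at m)"
    by (intro has_derivative_Pair dc dy)
  from has_derivative_compose[OF this dens_has_derivative]
  have "((\<lambda>m'. dens (c m') (y m') $ l) has_derivative (\<lambda>h. - f $ l * (c' l h + y' h \<bullet> pvec (v $ l)))) (at m)"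
    by (simp add: f)
  then show "((\<lambda>m'. fstar lam v dv (W m') m' $ l) has_derivative
       (\<lambda>h. - f $ l * (c' l h + y' h \<bullet> pvec (v $ l)))) (at m)"
    by (rule has_derivative_transform_within_open[OF _ U(1,2)])
       (use U(3) fstar_eq[OF MN _ W] in \<open>auto simp: y_def c_def\<close>)
qed

end

section \<open>Gradients and moments\<close>

lemma grad_eq:
  assumes "GDERIV f x :> D"
  shows "grad f x = D"
  unfolding grad_def
proof (rule the_equality)
  show "GDERIV f x :> D" by fact
next
  fix D' assume "GDERIV f x :> D'"
  then have "(\<lambda>h. h \<bullet> D') = (\<lambda>h. h \<bullet> D)"
    using assms has_derivative_unique unfolding gderiv_def by blast
  then have "D' \<bullet> (D' - D) = D \<bullet> (D' - D)"
    by (metis inner_commute)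
  then show "D' = D"
    by (metis eq_iff_diff_eq_0 inner_diff_left inner_eq_zero_iff)
qed

lemma has_derivative_grad:
  fixes f :: "'a::euclidean_space \<Rightarrow> real"
  assumes "f differentiable (at x)"
  shows "(f has_derivative (\<lambda>h. h \<bullet> grad f x)) (at x)"
proof -
  obtain D where D: "(f has_derivative D) (at x)"
    using assms differentiable_def by blast
  then have lin: "linear D" by (rule has_derivative_linear)
  define g where "g = (\<Sum>b\<in>Basis. D b *\<^sub>R b)"
  have "D h = h \<bullet> g" for h
  proof -
    have "D h = D (\<Sum>b\<in>Basis. (h \<bullet> b) *\<^sub>R b)" by (simp add: euclidean_representation)
    also have "\<dots> = h \<bullet> g"
      by (simp add: linear_sum[OF lin] linear_scale[OF lin] g_def inner_sum_right mult.commute)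
    finally show ?thesis .
  qed
  then have "D = (\<lambda>h. h \<bullet> g)" by blast
  with D have "GDERIV f x :> g" by (simp add: gderiv_def)
  from this grad_eq[OF this] show ?thesis by (simp add: gderiv_def)
qed

lemma jacobian_eq:
  fixes F :: "real ^ 'n \<Rightarrow> real ^ 'm"
  assumes "(F has_derivative (\<lambda>h. A *v h)) (at x)"
  shows "jacobian F (at x) = A"
  unfolding jacobian_def frechet_derivative_at[OF assms, symmetric]
  by (rule matrix_of_matrix_vector_mul)

lemma mom_has_derivative [derivative_intros]:
  assumes "(f has_derivative f') (at x within S)"
  shows "((\<lambda>x. mom (f x) j) has_derivative (\<lambda>h. mom (f' h) j)) (at x within S)"
  unfolding mom_def by (rule bounded_linear.has_derivative[OF bounded_linear_vec_nth assms])

lemma vbar_has_derivative: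
  assumes "mom m 0 \<noteq> 0"
  shows "(vbar has_derivative (\<lambda>h. (mom h 1 * mom m 0 - mom m 1 * mom h 0) / (mom m 0)\<^sup>2)) (at m)"
  unfolding vbar_def
  by (rule derivative_eq_intros refl assms)+ (simp add: fun_eq_iff power2_eq_square assms field_simps)

lemma inten_differentiable:
  assumes "mom m 0 \<noteq> 0"
  shows "inten differentiable (at m)"
proof -
  have "(\<lambda>m. mom m j) differentiable (at m)" for j
    by (rule differentiableI) (rule derivative_intros)+
  moreover have "vbar differentiable (at m)"
    using vbar_has_derivative[OF assms] differentiableI by blast
  ultimately show ?thesis
    unfolding inten_def using assms
    by (intro differentiable_diff differentiable_divide differentiable_power) auto
qed

lemma matrix_outer_vec:
  fixes g :: "'n::finite \<Rightarrow> real ^ 'm" and p :: "'n \<Rightarrow> real ^ 'k"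
  shows "(\<chi> i j. \<Sum>l\<in>UNIV. a l * p l $ i * g l $ j) *v h = (\<Sum>l\<in>UNIV. (a l * (h \<bullet> g l)) *\<^sub>R p l)"
proof -
  have "((\<chi> i j. \<Sum>l\<in>UNIV. a l * p l $ i * g l $ j) *v h) $ i =
    (\<Sum>j\<in>UNIV. \<Sum>l\<in>UNIV. a l * p l $ i * g l $ j * h $ j)" for i
    by (simp add: matrix_vector_mult_def sum_distrib_right)
  also have "\<dots> i = (\<Sum>l\<in>UNIV. (a l * (h \<bullet> g l)) *\<^sub>R p l) $ i" for i
    by (subst sum.swap) (simp add: inner_vec_def sum_distrib_left sum_distrib_right mult_ac)
  finally show ?thesis by (simp add: vec_eq_iff)
qed

section \<open>The state-dependent Maxwellian\<close>

context velocity_grid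
begin

lemma mom_realizable:
  fixes m :: "'m::{finite,linorder} rvec"
  assumes "m = moment_mat v dv *v f" "j < CARD('m)"
  shows "mom m j = (\<Sum>l\<in>UNIV. dv $ l * f $ l * v $ l ^ j)"
proof -
  obtain k :: 'm where "pos k = j" using assms(2) by (rule ex_pos)
  then show ?thesis
    using mom_pos[of m k] by (simp add: assms(1) moment_mat_vec pvec_def)
qed

lemma mom0_pos:
  fixes m :: "'m::{finite,linorder} rvec"
  assumes "m \<in> realizable v dv"
  shows "0 < mom m 0"
proof -
  obtain f where "\<And>l. 0 < f $ l" "m = moment_mat v dv *v f"
    using assms by (auto simp: realizable_def)
  then show ?thesis
    using mom_realizable[of m f 0] by (auto intro!: sum_pos mult_pos_pos dv_pos)
qed

text \<open>The sign of the excess decides whether the Maxwellian with parameter \<open>b\<close> has variance above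
  \<open>e\<close>. Multiplying by \<open>exp (b e)\<close> makes it strictly decreasing in \<open>b\<close>.\<close>

definition excess :: "real \<Rightarrow> real \<Rightarrow> real \<Rightarrow> real" where
  "excess u e b = (\<Sum>l\<in>UNIV. dv $ l * (((v $ l - u)\<^sup>2 - e) * exp (- b * ((v $ l - u)\<^sup>2 - e))))"

text \<open>Each function x exp (- b x) is weakly decreasing in b, and strictly so when x is not
  zero, as happens at the node k.\<close>

lemma excess_strict_antimono:
  assumes "(v $ k - u)\<^sup>2 < e" "b < b'"
  shows "excess u e b' < excess u e b"
  unfolding excess_def
proof (rule sum_strict_mono_ex1)
  have le: "x * exp (- b' * x) \<le> x * exp (- b * x)" for x
  proof (cases "0 \<le> x")
    case True
    then have "b * x \<le> b' * x" using assms(2) by (intro mult_right_mono) auto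
    then show ?thesis using True by (intro mult_left_mono) auto
  next
    case False
    then have "b' * x \<le> b * x" using assms(2) by (intro mult_right_mono_neg) auto
    then show ?thesis using False by (intro mult_left_mono_neg) auto
  qed
  show "\<forall>l\<in>UNIV. dv $ l * (((v $ l - u)\<^sup>2 - e) * exp (- b' * ((v $ l - u)\<^sup>2 - e)))
      \<le> dv $ l * (((v $ l - u)\<^sup>2 - e) * exp (- b * ((v $ l - u)\<^sup>2 - e)))"
    by (intro ballI mult_left_mono le less_imp_le[OF dv_pos])
  have "dv $ k * (((v $ k - u)\<^sup>2 - e) * exp (- b' * ((v $ k - u)\<^sup>2 - e)))
      < dv $ k * (((v $ k - u)\<^sup>2 - e) * exp (- b * ((v $ k - u)\<^sup>2 - e)))"
    using assms by (intro mult_strict_left_mono dv_pos mult_strict_left_mono_neg) auto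
  then show "\<exists>l\<in>UNIV. dv $ l * (((v $ l - u)\<^sup>2 - e) * exp (- b' * ((v $ l - u)\<^sup>2 - e)))
      < dv $ l * (((v $ l - u)\<^sup>2 - e) * exp (- b * ((v $ l - u)\<^sup>2 - e)))" by blast
qed simp

lemma excess_inj:
  assumes "(v $ k - u)\<^sup>2 < e" "excess u e b = excess u e b'"
  shows "b = b'"
  using excess_strict_antimono[OF assms(1), of b b'] excess_strict_antimono[OF assms(1), of b' b] assms(2)
  by (cases b b' rule: linorder_cases) auto

text \<open>At b = 0 the upper bound on e makes the excess positive; for large b the negative term
  of the node k dominates. A zero lies in between, and not at 0.\<close>

lemma excess_zero_exists:
  assumes k: "(v $ k - u)\<^sup>2 < e" and e: "e < (\<Sum>l\<in>UNIV. dv $ l * (v $ l - u)\<^sup>2) / (\<Sum>l\<in>UNIV. dv $ l)"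
  obtains b where "0 < b" "excess u e b = 0"
proof -
  have "0 < (\<Sum>l\<in>UNIV. dv $ l)" by (intro sum_pos) (auto simp: dv_pos)
  then have pos0: "0 < excess u e 0"
    using e unfolding excess_def
    by (simp add: right_diff_distrib sum_subtractf sum_distrib_right[symmetric] pos_less_divide_eq)
       (simp add: mult.commute)
  define x where "x l = (v $ l - u)\<^sup>2 - e" for l
  define a where "a = - x k"
  have a: "0 < a" using k by (simp add: a_def x_def)
  define A where "A = dv $ k * a"
  have A: "0 < A" using a dv_pos by (simp add: A_def)
  define B where "B = (\<Sum>l\<in>UNIV. dv $ l * \<bar>x l\<bar>)"
  have B: "0 \<le> B" unfolding B_def using dv_pos by (intro sum_nonneg) (simp add: less_imp_le)
  \<comment> \<open>Makes A (b a) = B + A a exceed B, which bounds the sum of all other terms; exp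
    (b a) \<ge> 1 + b a then makes the excess negative.\<close>
  define b where "b = B / (A * a) + 1"
  have b: "0 < b" using A a B by (simp add: b_def add_nonneg_pos)
  have bound: "x l * exp (- b * x l) \<le> \<bar>x l\<bar>" for l
  proof (cases "0 \<le> x l")
    case True
    then have "x l * exp (- b * x l) \<le> x l * 1" using b by (intro mult_left_mono) auto
    then show ?thesis using True by simp
  next
    case False
    then show ?thesis by (meson abs_ge_zero exp_ge_zero mult_nonpos_nonneg not_le order_trans less_imp_le)
  qed
  have "excess u e b = dv $ k * (x k * exp (- b * x k)) + (\<Sum>l\<in>UNIV - {k}. dv $ l * (x l * exp (- b * x l)))"
    unfolding excess_def x_def[symmetric] by (rule sum.remove) auto
  also have "\<dots> \<le> dv $ k * (x k * exp (- b * x k)) + (\<Sum>l\<in>UNIV - {k}. dv $ l * \<bar>x l\<bar>)"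
    by (intro add_left_mono sum_mono mult_left_mono bound less_imp_le[OF dv_pos])
  also have "\<dots> \<le> dv $ k * (x k * exp (- b * x k)) + B"
    unfolding B_def using dv_pos by (intro add_left_mono sum_mono2) (auto simp: less_imp_le)
  also have "\<dots> = - (A * exp (b * a)) + B"
    by (simp add: A_def a_def)
  also have "\<dots> < 0"
  proof -
    have "B < A * (b * a)" using A a by (simp add: b_def field_simps)
    also have "\<dots> \<le> A * exp (b * a)"
      using A exp_ge_add_one_self[of "b * a"] by (intro mult_left_mono) linarith+
    finally show ?thesis by simp
  qed
  finally have "excess u e b < 0" .
  moreover have "continuous_on {0..b} (excess u e)"
    unfolding excess_def by (intro continuous_intros)
  ultimately obtain b' where "0 \<le> b'" "excess u e b' = 0"
    using sign_change_root[of 0 b "excess u e"] b pos0 by (metis less_imp_le mult_pos_neg)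
  then show thesis using that[of b'] pos0 by (cases "b' = 0") auto
qed

lemma excess_zero_iff:
  "(\<Sum>l\<in>UNIV. dv $ l * (v $ l - u)\<^sup>2 * exp (- b * (v $ l - u)\<^sup>2)) / (\<Sum>l\<in>UNIV. dv $ l * exp (- b * (v $ l - u)\<^sup>2)) = e
    \<longleftrightarrow> excess u e b = 0"
proof -
  have "0 < (\<Sum>l\<in>UNIV. dv $ l * exp (- b * (v $ l - u)\<^sup>2))" by (intro sum_pos) (auto simp: dv_pos)
  moreover have "excess u e b = exp (b * e) * ((\<Sum>l\<in>UNIV. dv $ l * (v $ l - u)\<^sup>2 * exp (- b * (v $ l - u)\<^sup>2))
      - e * (\<Sum>l\<in>UNIV. dv $ l * exp (- b * (v $ l - u)\<^sup>2)))"
    unfolding excess_def sum_distrib_left sum_subtractf[symmetric]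
    by (intro sum.cong refl) (simp add: algebra_simps exp_add exp_diff exp_minus field_simps)
  ultimately show ?thesis by (auto simp: field_simps)
qed

lemma beta_eq:
  fixes m :: "'m::{finite,linorder} rvec"
  assumes "(v $ k - vbar m)\<^sup>2 < inten m" "0 < b" "excess (vbar m) (inten m) b = 0"
  shows "beta v dv m = b"
  unfolding beta_def excess_zero_iff
  by (rule the_equality) (use assms excess_inj[OF assms(1)] in auto)

lemma realizable_w_iff:
  "m \<in> realizable_w v dv \<longleftrightarrow> m \<in> realizable v dv \<and> (\<exists>k. (v $ k - vbar m)\<^sup>2 < inten m) \<and>
     inten m < (\<Sum>l\<in>UNIV. dv $ l * (v $ l - vbar m)\<^sup>2) / (\<Sum>l\<in>UNIV. dv $ l)"
  by (simp add: realizable_w_def Min_less_iff)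

lemma open_realizable_w:
  assumes MN: "CARD('m) \<le> CARD('n)"
  shows "open (realizable_w v dv :: 'm::{finite,linorder} rvec set)"
proof -
  let ?R = "realizable v dv :: 'm rvec set"
  have m0: "mom m 0 \<noteq> 0" if "m \<in> ?R" for m using mom0_pos[OF that] by simp
  have vb: "continuous_on ?R vbar"
    by (intro continuous_at_imp_continuous_on ballI has_derivative_continuous[OF vbar_has_derivative] m0)
  have it: "continuous_on ?R inten"
    by (intro continuous_at_imp_continuous_on ballI differentiable_imp_continuous_within inten_differentiable m0)
  define g where "g k m = inten m - (v $ k - vbar m)\<^sup>2" for k and m :: "'m rvec"
  define h where "h m = (\<Sum>l\<in>UNIV. dv $ l * (v $ l - vbar m)\<^sup>2) / (\<Sum>l\<in>UNIV. dv $ l) - inten m"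
    for m :: "'m rvec"
  have "0 < (\<Sum>l\<in>UNIV. dv $ l)" by (intro sum_pos) (auto simp: dv_pos)
  then have cont: "continuous_on ?R (g k)" "continuous_on ?R h" for k
    unfolding g_def h_def by (auto intro!: continuous_intros vb it)
  have "open (?R \<inter> g k -` {0<..})" "open (?R \<inter> h -` {0<..})" for k
    by (intro continuous_open_preimage cont open_realizable[OF MN] open_greaterThan)+
  then have "open ((\<Union>k. ?R \<inter> g k -` {0<..}) \<inter> (?R \<inter> h -` {0<..}))"
    by (intro open_Int[of "\<Union>k. ?R \<inter> g k -` {0<..}"] open_UN ballI) blast+
  moreover have "(\<Union>k. ?R \<inter> g k -` {0<..}) \<inter> (?R \<inter> h -` {0<..}) = realizable_w v dv"
    by (auto simp: realizable_w_iff g_def h_def)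
  ultimately show ?thesis by simp
qed

text \<open>The inverse function theorem for \<open>(u, e, b) \<mapsto> (u, e, excess u e b)\<close>.\<close>

lemma beta_differentiable:
  fixes m :: "'m::{finite,linorder} rvec"
  assumes MN: "CARD('m) \<le> CARD('n)" and m: "m \<in> realizable_w v dv"
  shows "beta v dv differentiable (at m)"
proof -
  \<comment> \<open>The third argument prescribes the value of the excess; \<open>beta\<close> is
    recovered by setting it to 0.\<close>
  define bsol where "bsol p = (THE b. excess (fst p) (fst (snd p)) b = snd (snd p))" for p
  let ?\<Phi> = "\<lambda>p. (fst p, fst (snd p), excess (fst p) (fst (snd p)) (snd (snd p)))"
  let ?G = "\<lambda>p. (fst p, fst (snd p), bsol p)"
  have mR: "m \<in> realizable v dv" using m by (simp add: realizable_w_def)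
  obtain k where k: "(v $ k - vbar m)\<^sup>2 < inten m" using m by (auto simp: realizable_w_iff)
  obtain b where b: "0 < b" "excess (vbar m) (inten m) b = 0"
    using excess_zero_exists[OF k] m by (auto simp: realizable_w_iff)
  \<comment> \<open>On this open set the fixed node k has x < 0, so the excess is injective in b and
    \<open>bsol\<close> is a left inverse.\<close>
  define S where "S = {p :: real \<times> real \<times> real. (v $ k - fst p)\<^sup>2 < fst (snd p)}"
  have S: "open S" unfolding S_def by (intro open_Collect_less continuous_intros)
  let ?p = "(vbar m, inten m, b)"
  have pS: "?p \<in> S" using k by (simp add: S_def)
  have sol: "bsol (u, e, excess u e b) = b" if "(v $ k - u)\<^sup>2 < e" for u e b
    unfolding bsol_def using excess_inj[OF that] by auto
  define x where "x l = (v $ l - vbar m)\<^sup>2 - inten m" for l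
  define dx where "dx l d = - 2 * (v $ l - vbar m) * fst d - fst (snd d)" for l and d :: "real \<times> real \<times> real"
  define r where "r d = (\<Sum>l\<in>UNIV. dv $ l * (exp (- b * x l) * (1 - b * x l) * dx l d))" for d
  \<comment> \<open>Minus the derivative of the excess in b. Its positivity at the node k makes the
    triangular derivative of \<open>?\<Phi>\<close> invertible.\<close>
  define \<delta> where "\<delta> = (\<Sum>l\<in>UNIV. dv $ l * exp (- b * x l) * (x l)\<^sup>2)"
  have \<delta>: "0 < \<delta>"
    unfolding \<delta>_def
  proof (rule sum_pos2[of _ k])
    show "0 < dv $ k * exp (- b * x k) * (x k)\<^sup>2" using dv_pos[of k] k by (simp add: x_def)
    show "0 \<le> dv $ l * exp (- b * x l) * (x l)\<^sup>2" for l using dv_pos[of l] by (simp add: less_imp_le)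
  qed auto
  have rl: "r d = r (fst d, fst (snd d), z)" for d z by (simp add: r_def dx_def)
  have der1: "((\<lambda>p. ((v $ l - fst p)\<^sup>2 - fst (snd p)) * exp (- snd (snd p) * ((v $ l - fst p)\<^sup>2 - fst (snd p))))
      has_derivative (\<lambda>d. exp (- b * x l) * (1 - b * x l) * dx l d - exp (- b * x l) * (x l)\<^sup>2 * snd (snd d))) (at ?p)" for l
    by (rule derivative_eq_intros refl)+
       (simp add: fun_eq_iff x_def dx_def power2_eq_square algebra_simps)
  have "((\<lambda>p. excess (fst p) (fst (snd p)) (snd (snd p))) has_derivative
      (\<lambda>d. \<Sum>l\<in>UNIV. dv $ l * (exp (- b * x l) * (1 - b * x l) * dx l d - exp (- b * x l) * (x l)\<^sup>2 * snd (snd d)))) (at ?p)"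
    unfolding excess_def by (intro has_derivative_sum has_derivative_mult_right der1)
  moreover have "(\<Sum>l\<in>UNIV. dv $ l * (exp (- b * x l) * (1 - b * x l) * dx l d - exp (- b * x l) * (x l)\<^sup>2 * snd (snd d)))
      = r d - \<delta> * snd (snd d)" for d
    by (simp add: r_def \<delta>_def right_diff_distrib sum_subtractf sum_distrib_right mult.assoc)
  ultimately have der: "((\<lambda>p. excess (fst p) (fst (snd p)) (snd (snd p))) has_derivative
      (\<lambda>d. r d - \<delta> * snd (snd d))) (at ?p)"
    by (simp only:)
  have d\<Phi>: "(?\<Phi> has_derivative (\<lambda>d. (fst d, fst (snd d), r d - \<delta> * snd (snd d)))) (at ?p)"
    by (rule derivative_intros der)+
  have cont: "continuous_on S ?\<Phi>"
    unfolding excess_def by (intro continuous_intros)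
  have inverse: "?G (?\<Phi> p) = p" if "p \<in> S" for p
    using that sol by (simp add: S_def)
  have comp: "(\<lambda>d. (fst d, fst (snd d), r d - \<delta> * snd (snd d))) \<circ>
      (\<lambda>d. (fst d, fst (snd d), (r d - snd (snd d)) / \<delta>)) = id"
  proof
    fix d
    show "((\<lambda>d. (fst d, fst (snd d), r d - \<delta> * snd (snd d))) \<circ>
      (\<lambda>d. (fst d, fst (snd d), (r d - snd (snd d)) / \<delta>))) d = id d"
      using \<delta> rl[of d "(r d - snd (snd d)) / \<delta>"] by (simp add: prod_eq_iff)
  qed
  have "(?G has_derivative (\<lambda>d. (fst d, fst (snd d), (r d - snd (snd d)) / \<delta>))) (at (?\<Phi> ?p))"
    by (rule has_derivative_inverse_strong[OF S pS cont inverse d\<Phi> comp])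
  then have "(?G has_derivative (\<lambda>d. (fst d, fst (snd d), (r d - snd (snd d)) / \<delta>))) (at (vbar m, inten m, 0))"
    by (simp add: b)
  then have "((\<lambda>p. snd (snd (?G p))) has_derivative (\<lambda>d. snd (snd (fst d, fst (snd d), (r d - snd (snd d)) / \<delta>)))) (at (vbar m, inten m, 0))"
    by (intro has_derivative_snd)
  then have dbsol: "bsol differentiable (at (vbar m, inten m, 0))"
    by (auto intro: differentiableI)
  have m0: "mom m 0 \<noteq> 0" using mom0_pos[OF mR] by simp
  obtain E where E: "(inten has_derivative E) (at m)"
    using inten_differentiable[OF m0] by (auto simp: differentiable_def)
  have "(\<lambda>m'. (vbar m', inten m', 0 :: real)) differentiable (at m)"
    by (rule differentiableI) (rule has_derivative_Pair vbar_has_derivative[OF m0] E has_derivative_const)+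
  from differentiable_compose[OF dbsol this]
  have "(\<lambda>m'. bsol (vbar m', inten m', 0)) differentiable (at m)" .
  then obtain D where "((\<lambda>m'. bsol (vbar m', inten m', 0)) has_derivative D) (at m)"
    by (auto simp: differentiable_def)
  then have "(beta v dv has_derivative D) (at m)"
  proof (rule has_derivative_transform_within_open[OF _ open_realizable_w[OF MN] m])
    fix m' :: "'m rvec" assume m': "m' \<in> realizable_w v dv"
    then obtain k' where k': "(v $ k' - vbar m')\<^sup>2 < inten m'" by (auto simp: realizable_w_iff)
    obtain b' where b': "0 < b'" "excess (vbar m') (inten m') b' = 0"
      using excess_zero_exists[OF k'] m' by (auto simp: realizable_w_iff)
    have "bsol (vbar m', inten m', 0) = b'"
      unfolding bsol_def using b' excess_inj[OF k'] by auto
    then show "bsol (vbar m', inten m', 0) = beta v dv m'"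
      using beta_eq[OF k' b'] by simp
  qed
  then show ?thesis by (rule differentiableI)
qed

section \<open>Derivative of the weights and the flux Jacobian\<close>

lemma maxw_pos: "0 < maxw v dv m $ l"
  by (simp add: maxw_def)

lemma kappa_maxw_has_derivative:
  fixes m :: "'m::{finite,linorder} rvec"
  assumes MN: "CARD('m) \<le> CARD('n)" and m: "m \<in> realizable_w v dv"
  shows "((\<lambda>m'. kappa dv (maxw v dv m') l) has_derivative
    (\<lambda>h. kappa dv (maxw v dv m) l * ((h \<bullet> grad (beta v dv) m) * (v $ l - vbar m)\<^sup>2
      - 2 * beta v dv m * (v $ l - vbar m) * ((mom h 1 * mom m 0 - mom m 1 * mom h 0) / (mom m 0)\<^sup>2)))) (at m)"
proof -
  have m0: "mom m 0 \<noteq> 0" using mom0_pos[of m] m by (simp add: realizable_w_def)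
  have k: "kappa dv (maxw v dv m') l = exp (beta v dv m' * (v $ l - vbar m')\<^sup>2) / dv $ l" for m' :: "'m rvec"
    by (simp add: kappa_def maxw_def exp_minus field_simps)
  show ?thesis
    unfolding k
    by (rule derivative_eq_intros has_derivative_grad[OF beta_differentiable[OF MN m]]
          vbar_has_derivative[OF m0] refl)+
       (use dv_pos[of l] in \<open>auto simp: fun_eq_iff field_simps power2_eq_square\<close>)
qed

text \<open>With f' = - f (\<lambda> \<kappa>' + y' . p) the derivative is - \<lambda> Gv h - K y'.
  Inserting y' = - H^-1 (h + \<lambda> G h) collects the terms in \<lambda> into R.\<close>

lemma flux_has_derivative:
  fixes m :: "'m::{finite,linorder} rvec" and W :: "'m rvec \<Rightarrow> 'n rvec" and lam :: real
  assumes MN: "CARD('m) \<le> CARD('n)" and U: "open U" "m \<in> U" "U \<subseteq> realizable v dv"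
    and W: "\<And>m' l. m' \<in> U \<Longrightarrow> 0 < W m' $ l"
    and g: "\<And>l. ((\<lambda>m'. lam * kappa dv (W m') l) has_derivative (\<lambda>h. lam * (h \<bullet> grad (\<lambda>m'. kappa dv (W m') l) m))) (at m)"
  defines "f \<equiv> fstar lam v dv (W m) m"
  shows "(flux lam v dv W has_derivative
    (\<lambda>h. (gramK v dv f ** matrix_inv (gramH v dv f) + lam *\<^sub>R matR v dv W f m) *v h)) (at m)"
proof -
  let ?g = "\<lambda>l. grad (\<lambda>m'. kappa dv (W m') l) m"
  let ?H = "gramH v dv f :: ('m, 'm) rmat" and ?K = "gramK v dv f :: ('m, 'm) rmat"
  have G: "matG v dv W f m *v h = (\<Sum>l\<in>UNIV. (dv $ l * f $ l * (h \<bullet> ?g l)) *\<^sub>R pvec (v $ l))" for h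
    unfolding matG_def by (rule matrix_outer_vec)
  have Gv: "matGv v dv W f m *v h = (\<Sum>l\<in>UNIV. (dv $ l * v $ l * f $ l * (h \<bullet> ?g l)) *\<^sub>R pvec (v $ l))" for h
    unfolding matGv_def by (rule matrix_outer_vec)
  define y' where "y' h = - (matrix_inv ?H *v (h + lam *\<^sub>R (matG v dv W f m *v h)))" for h
  have df: "((\<lambda>m'. fstar lam v dv (W m') m' $ l) has_derivative
       (\<lambda>h. - f $ l * (lam * (h \<bullet> ?g l) + y' h \<bullet> pvec (v $ l)))) (at m)" for l
    using reconstruction_has_derivative(2)[OF MN U W g, of l]
    unfolding y'_def G f_def[symmetric] by (simp add: scaleR_sum_right mult_ac)
  have "(flux lam v dv W has_derivative (\<lambda>h. \<Sum>l\<in>UNIV. (dv $ l * v $ l * (- f $ l * (lam * (h \<bullet> ?g l) + y' h \<bullet> pvec (v $ l)))) *\<^sub>R pvec (v $ l))) (at m)"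
    unfolding flux_def[abs_def]
    by (intro has_derivative_sum has_derivative_scaleR_left has_derivative_mult_right df)
  moreover have "(\<Sum>l\<in>UNIV. (dv $ l * v $ l * (- f $ l * (lam * (h \<bullet> ?g l) + y' h \<bullet> pvec (v $ l)))) *\<^sub>R pvec (v $ l))
      = (?K ** matrix_inv ?H + lam *\<^sub>R matR v dv W f m) *v h" for h
  proof -
    have "(\<Sum>l\<in>UNIV. (dv $ l * v $ l * (- f $ l * (lam * (h \<bullet> ?g l) + y' h \<bullet> pvec (v $ l)))) *\<^sub>R pvec (v $ l))
      = - (lam *\<^sub>R (matGv v dv W f m *v h)) - ?K *v y' h"
      unfolding Gv gramK_vec scaleR_sum_right sum_negf[symmetric] sum_subtractf[symmetric]
      by (intro sum.cong refl) (simp add: algebra_simps)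
    also have "\<dots> = (?K ** matrix_inv ?H + lam *\<^sub>R matR v dv W f m) *v h"
      unfolding y'_def matR_def
      by (simp add: algebra_simps linear_neg[OF matrix_vector_mul_linear]
          scaleR_matrix_vector_assoc[symmetric] matrix_vector_mul_assoc matrix_mul_assoc)
    finally show ?thesis .
  qed
  ultimately show ?thesis by (simp only:)
qed

section \<open>Strict hyperbolicity\<close>

lemma fstar_pos:
  fixes m :: "'m::{finite,linorder} rvec"
  assumes "CARD('m) \<le> CARD('n)" "m \<in> realizable v dv" "\<And>l. 0 < w $ l"
  shows "0 < fstar lam v dv w m $ l"
  by (simp add: fstar_eq[OF assms] dens_pos)

lemma add_matrix_mult: "(A + B) ** C = A ** C + B ** (C :: 'a::semiring_1 ^ 'k ^ 'm)"
  by (simp add: matrix_matrix_mult_def vec_eq_iff distrib_right sum.distrib)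

text \<open>Since H = S S, the product H^-1 S equals S^-1. The conjugation therefore symmetrizes K
  H^-1 and turns R into the matrix whose norm occurs in the smallness condition.\<close>

lemma similar_to_symmetric:
  fixes H K R S :: "('m::finite, 'm) rmat"
  assumes "sym_pos_def S" "S ** S = H"
  shows "matrix_inv S ** (K ** matrix_inv H + R) ** S =
    matrix_inv S ** K ** matrix_inv S + matrix_inv S ** R ** S"
proof -
  note S = matrix_inv_mult[OF sym_pos_def_invertible[OF assms(1)]]
  have "invertible H"
    using invertible_mult sym_pos_def_invertible[OF assms(1)] assms(2) by blast
  note H = matrix_inv_mult[OF this]
  have "matrix_inv H ** S = matrix_inv H ** (S ** S) ** matrix_inv S"
    by (simp add: matrix_mul_assoc[symmetric] S)
  also have "\<dots> = matrix_inv S"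
    by (simp add: assms(2) H)
  finally have HS: "matrix_inv H ** S = matrix_inv S" .
  have "matrix_inv S ** (K ** matrix_inv H + R) ** S =
      matrix_inv S ** K ** (matrix_inv H ** S) + matrix_inv S ** R ** S"
    by (simp add: matrix_add_ldistrib add_matrix_mult matrix_mul_assoc)
  then show ?thesis by (simp add: HS)
qed

lemma flux_maxw_has_derivative:
  fixes m :: "'m::{finite,linorder} rvec" and lam :: real
  assumes MN: "CARD('m) \<le> CARD('n)" and m: "m \<in> realizable_w v dv"
  defines "f \<equiv> fstar lam v dv (maxw v dv m) m"
  shows "(flux lam v dv (maxw v dv) has_derivative
    (\<lambda>h. (gramK v dv f ** matrix_inv (gramH v dv f) + lam *\<^sub>R matR v dv (maxw v dv) f m) *v h)) (at m)"
proof -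
  have "((\<lambda>m'. kappa dv (maxw v dv m') l) has_derivative
      (\<lambda>h. h \<bullet> grad (\<lambda>m'. kappa dv (maxw v dv m') l) m)) (at m)" for l
    by (intro has_derivative_grad differentiableI[OF kappa_maxw_has_derivative[OF MN m]])
  from has_derivative_mult_right[OF this] show ?thesis
    unfolding f_def
    by (intro flux_has_derivative[OF MN open_realizable_w[OF MN] m _ maxw_pos])
       (auto simp: realizable_w_def)
qed

lemma real_preimage_card:
  assumes "inj (t :: 'm::finite \<Rightarrow> real)" "X = complex_of_real ` range t"
  shows "card {x :: real. complex_of_real x \<in> X} = CARD('m)"
proof -
  have "{x :: real. complex_of_real x \<in> X} = range t"
    using assms(2) by auto
  then show ?thesis using assms(1) by (simp add: card_image)
qed

theorem maxwellian_closure_hyperbolic: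
  fixes m :: "'m::{finite,linorder} rvec"
  assumes MN: "CARD('m) < CARD('n)" and m: "m \<in> realizable_w v dv"
    and lam: "0 \<le> lam"
  shows "let W = maxw v dv;
           f = fstar lam v dv (W m) m;
           H = gramH v dv f;
           K = gramK v dv f;
           R = matR v dv W f m;
           F = flux lam v dv W;
           r = lam * spectral_norm (matrix_inv (msqrt H) ** R ** msqrt H)
       in (F has_derivative (\<lambda>h. (K ** matrix_inv H + lam *\<^sub>R R) *v h)) (at m) \<and>
          (\<exists>\<theta> :: 'm \<Rightarrow> real. gauss_nodes (mustar v dv f) \<theta> \<and>
             (r < 1 / 2 * Min {\<bar>\<theta> i - \<theta> j\<bar> | i j. i \<noteq> j} \<longrightarrow>
                strictly_hyperbolic_at F m \<and>
                (\<exists>\<theta>' :: 'm \<Rightarrow> real. inj \<theta>' \<and>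
                   eigenvalues (jacobian F (at m)) = complex_of_real ` range \<theta>' \<and>
                   (\<forall>i. \<bar>\<theta>' i - \<theta> i\<bar> \<le> r))))"
proof -
  define W where "W = (maxw v dv :: 'm rvec \<Rightarrow> 'n rvec)"
  define f where "f = fstar lam v dv (W m) m"
  define H where "H = (gramH v dv f :: ('m, 'm) rmat)"
  define K where "K = (gramK v dv f :: ('m, 'm) rmat)"
  define R where "R = matR v dv W f m"
  define F where "F = (flux lam v dv W :: 'm rvec \<Rightarrow> 'm rvec)"
  define S where "S = msqrt H"
  define r where "r = lam * spectral_norm (matrix_inv S ** R ** S)"
  have "m \<in> realizable v dv" using m by (simp add: realizable_w_def)
  then have f0: "0 < f $ l" for l
    unfolding f_def W_def by (rule fstar_pos[OF less_imp_le[OF MN] _ maxw_pos])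
  have dF: "(F has_derivative (\<lambda>h. (K ** matrix_inv H + lam *\<^sub>R R) *v h)) (at m)"
    using flux_maxw_has_derivative[OF less_imp_le[OF MN] m]
    unfolding F_def K_def H_def R_def f_def W_def .
  have S: "sym_pos_def S" "S ** S = H"
    using msqrt[OF sym_pos_def_gramH[OF less_imp_le[OF MN] f0]] by (simp_all add: S_def H_def)
  define J where "J = matrix_inv S ** K ** matrix_inv S"
  obtain \<theta> :: "'m \<Rightarrow> real" and u :: "'m \<Rightarrow> 'm rvec" where
    \<theta>: "gauss_nodes (mustar v dv f) \<theta>" and u: "orthonormal_family u"
    and J: "\<And>i. J *v u i = \<theta> i *\<^sub>R u i"
    using gauss_nodes_eigenbasis[where f = f, OF MN f0]
    unfolding J_def S_def H_def K_def by metis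
  define E where "E = lam *\<^sub>R (matrix_inv S ** R ** S)"
  have E: "norm (E *v x) \<le> r * norm x" for x
  proof -
    have "norm ((matrix_inv S ** R ** S) *v x) \<le> spectral_norm (matrix_inv S ** R ** S) * norm x"
      unfolding spectral_norm_def by (rule onorm[OF matrix_vector_mul_bounded_linear])
    then show ?thesis
      using lam by (simp add: E_def r_def scaleR_matrix_vector_assoc[symmetric] mult.assoc mult_left_mono)
  qed
  have JE: "matrix_inv S ** (K ** matrix_inv H + lam *\<^sub>R R) ** S = J + E"
    unfolding similar_to_symmetric[OF S] J_def E_def
    by (simp add: matrix_scalar_ac scalar_matrix_assoc)
  have "strictly_hyperbolic_at F m \<and> (\<exists>\<theta>' :: 'm \<Rightarrow> real. inj \<theta>' \<and>
      eigenvalues (jacobian F (at m)) = complex_of_real ` range \<theta>' \<and> (\<forall>i. \<bar>\<theta>' i - \<theta> i\<bar> \<le> r))"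
    if small: "r < 1 / 2 * Min {\<bar>\<theta> i - \<theta> j\<bar> | i j. i \<noteq> j}"
  proof -
    \<comment> \<open>Half the smallest gap, so that the smallness condition reads r < d.\<close>
    define d where "d = 1 / 2 * Min {\<bar>\<theta> i - \<theta> j\<bar> | i j. i \<noteq> j}"
    have fin: "finite {\<bar>\<theta> i - \<theta> j\<bar> | i j. i \<noteq> j}"
      by (rule finite_subset[of _ "(\<lambda>(i, j). \<bar>\<theta> i - \<theta> j\<bar>) ` UNIV"]) auto
    have gap: "2 * d \<le> \<bar>\<theta> i - \<theta> j\<bar>" if "i \<noteq> j" for i j
      using Min_le[OF fin, of "\<bar>\<theta> i - \<theta> j\<bar>"] that by (auto simp: d_def)
    obtain \<theta>' :: "'m \<Rightarrow> real" where \<theta>': "inj \<theta>'" "eigenvalues (J + E) = complex_of_real ` range \<theta>'"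
      "\<And>i. \<bar>\<theta>' i - \<theta> i\<bar> \<le> r"
      using simple_spectrum_perturbation[where d = d, OF u J E gap small[folded d_def]] by blast
    have ev: "eigenvalues (jacobian F (at m)) = complex_of_real ` range \<theta>'"
      using eigenvalues_similar[OF sym_pos_def_invertible[OF S(1)], of "K ** matrix_inv H + lam *\<^sub>R R"]
      unfolding JE jacobian_eq[OF dF] \<theta>'(2) by simp
    show ?thesis
      using \<theta>' ev real_preimage_card[OF \<theta>'(1) ev] differentiableI[OF dF]
      by (auto simp: strictly_hyperbolic_at_def)
  qed
  with dF \<theta> show ?thesis
    unfolding Let_def S_def r_def W_def f_def H_def K_def R_def F_def by blast
qed

section \<open>The closure without regularization\<close>

text \<open>At \<lambda> = 0 the shift c is zero whatever the weights, hence the closure does not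
  see them.\<close>

lemma fstar_zero:
  fixes m :: "'m::{finite,linorder} rvec"
  assumes "CARD('m) \<le> CARD('n)" "m \<in> realizable v dv" "\<And>l. 0 < w $ l"
  shows "fstar 0 v dv w m = dens 0 (multiplier 0 m)"
  using fstar_eq[OF assms, where lam = 0] by (simp add: zero_vec_def)

lemma ystar_zero:
  fixes m :: "'m::{finite,linorder} rvec"
  assumes "CARD('m) \<le> CARD('n)" "m \<in> realizable v dv"
  shows "ystar 0 v dv w m = multiplier 0 m"
  using ystar_eq[OF assms, where lam = 0] by (simp add: zero_vec_def)

lemma convex_realizable: "convex (realizable v dv :: 'm::{finite,linorder} rvec set)"
proof -
  have "convex {f :: 'n rvec. \<forall>l. 0 < f $ l}"
  proof (rule convexI)
    fix x y :: "'n rvec" and a b :: real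
    assume "x \<in> {f. \<forall>l. 0 < f $ l}" "y \<in> {f. \<forall>l. 0 < f $ l}" "0 \<le> a" "0 \<le> b" "a + b = 1"
    then show "a *\<^sub>R x + b *\<^sub>R y \<in> {f. \<forall>l. 0 < f $ l}"
      by (cases "a = 0") (auto intro: add_pos_nonneg simp: less_imp_le)
  qed
  moreover have "realizable v dv = (*v) (moment_mat v dv :: ('n, 'm) rmat) ` {f. \<forall>l. 0 < f $ l}"
    by (auto simp: realizable_def)
  ultimately show ?thesis
    by (simp add: convex_linear_image)
qed

context
  fixes W :: "'m::{finite,linorder} rvec \<Rightarrow> 'n rvec"
  assumes MN: "CARD('m) \<le> CARD('n)" and W_pos: "\<forall>m \<in> realizable v dv. \<forall>l. 0 < W m $ l"
begin

lemma weight_pos: "m \<in> realizable v dv \<Longrightarrow> 0 < W m $ l"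
  using W_pos by blast

text \<open>Summing the nodewise tangents of x log x, the slope 1 + ln f = - y . p turns the linear
  part into - y . (m' - m). Strictness holds because different moments force different
  densities.\<close>

lemma eta_tangent:
  assumes m: "m \<in> realizable v dv" and m': "m' \<in> realizable v dv" and ne: "m' \<noteq> m"
  shows "eta 0 v dv W m - multiplier 0 m \<bullet> (m' - m) < eta 0 v dv W m'"
proof -
  define y where "y = multiplier 0 m"
  define f where "f = dens 0 y"
  define f' where "f' = dens 0 (multiplier 0 m')"
  have mf: "dmom 0 y = m" unfolding y_def by (rule dmom_multiplier[OF MN m])
  have mf': "dmom 0 (multiplier 0 m') = m'" by (rule dmom_multiplier[OF MN m'])
  have f: "0 < f $ l" "0 < f' $ l" for l by (simp_all add: f_def f'_def dens_pos)
  have "f' \<noteq> f"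
    using ne mf mf' by (metis f_def f'_def moment_mat_dens)
  then obtain k where k: "f' $ k \<noteq> f $ k" by (auto simp: vec_eq_iff)
  let ?t = "\<lambda>l. f $ l * ln (f $ l) + (1 + ln (f $ l)) * (f' $ l - f $ l)"
  have "(\<Sum>l\<in>UNIV. dv $ l * ?t l) < (\<Sum>l\<in>UNIV. dv $ l * (f' $ l * ln (f' $ l)))"
  proof (rule sum_strict_mono_ex1)
    show "\<forall>l\<in>UNIV. dv $ l * ?t l \<le> dv $ l * (f' $ l * ln (f' $ l))"
      using entropy_tangent(1)[OF less_imp_le[OF f(2)] f(1)] dv_pos
      by (auto intro!: mult_left_mono simp: less_imp_le)
    have "dv $ k * ?t k < dv $ k * (f' $ k * ln (f' $ k))"
      using entropy_tangent(2)[OF less_imp_le[OF f(2)] f(1) k] dv_pos by (intro mult_strict_left_mono) auto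
    then show "\<exists>l\<in>UNIV. dv $ l * ?t l < dv $ l * (f' $ l * ln (f' $ l))" by blast
  qed simp
  moreover have "(\<Sum>l\<in>UNIV. dv $ l * ?t l) = (\<Sum>l\<in>UNIV. dv $ l * (f $ l * ln (f $ l))) - y \<bullet> (m' - m)"
  proof -
    have "1 + ln (f $ l) = - (y \<bullet> pvec (v $ l))" for l by (simp add: f_def ln_dens)
    moreover have "y \<bullet> (m' - m) = (\<Sum>l\<in>UNIV. dv $ l * f' $ l * (y \<bullet> pvec (v $ l))) - (\<Sum>l\<in>UNIV. dv $ l * f $ l * (y \<bullet> pvec (v $ l)))"
      unfolding inner_diff_right f_def f'_def inner_dmom[symmetric] mf mf' ..
    ultimately show ?thesis
      by (simp add: sum_subtractf[symmetric] algebra_simps)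
  qed
  ultimately show ?thesis
    by (simp add: eta_def fstar_zero[OF MN m weight_pos[OF m]] fstar_zero[OF MN m' weight_pos[OF m']] f_def f'_def y_def mult.assoc)
qed

text \<open>The tangent at the intermediate point z is applied towards both ends; the linear terms
  cancel because (1 - t)(x - z) + t (y - z) = 0.\<close>

lemma eta_strictly_convex: "strictly_convex_on (realizable v dv) (eta 0 v dv W)"
  unfolding strictly_convex_on_def
proof (intro conjI convex_realizable ballI allI impI)
  fix x y :: "'m rvec" and t :: real
  assume x: "x \<in> realizable v dv" and y: "y \<in> realizable v dv" and "x \<noteq> y" and t: "0 < t" "t < 1"
  define z where "z = (1 - t) *\<^sub>R x + t *\<^sub>R y"
  define Y where "Y = multiplier 0 z"
  have z: "z \<in> realizable v dv"
    unfolding z_def using convex_realizable x y t by (intro convexD) auto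
  have xz: "x - z = t *\<^sub>R (x - y)" and yz: "y - z = (1 - t) *\<^sub>R (y - x)"
    by (simp_all add: z_def algebra_simps)
  have "x \<noteq> z" "y \<noteq> z"
    using xz yz t \<open>x \<noteq> y\<close> by auto
  have "(1 - t) * (eta 0 v dv W z - Y \<bullet> (x - z)) < (1 - t) * eta 0 v dv W x"
    using eta_tangent[OF z x \<open>x \<noteq> z\<close>] t by (simp add: Y_def)
  moreover have "t * (eta 0 v dv W z - Y \<bullet> (y - z)) < t * eta 0 v dv W y"
    using eta_tangent[OF z y \<open>y \<noteq> z\<close>] t by (simp add: Y_def)
  moreover have "(1 - t) * (eta 0 v dv W z - Y \<bullet> (x - z)) + t * (eta 0 v dv W z - Y \<bullet> (y - z)) = eta 0 v dv W z"
    unfolding xz yz by (simp add: inner_simps algebra_simps)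
  ultimately show "eta 0 v dv W ((1 - t) *\<^sub>R x + t *\<^sub>R y) < (1 - t) * eta 0 v dv W x + t * eta 0 v dv W y"
    unfolding z_def[symmetric] by linarith
qed

section \<open>Derivatives of entropy and fluxes at a fixed state\<close>

context
  fixes m :: "'m rvec" and f :: "'n rvec" and H K :: "('m, 'm) rmat"
  assumes m: "m \<in> realizable v dv"
  defines "f \<equiv> fstar 0 v dv (W m) m" and "H \<equiv> gramH v dv f" and "K \<equiv> gramK v dv f"
begin

lemma fstar_zero_pos: "0 < f $ l"
  unfolding f_def by (rule fstar_pos[OF MN m weight_pos[OF m]])

lemma gramH_inverse: "H ** matrix_inv H = mat 1" "sym_pos_def (matrix_inv H)"
proof -
  have "sym_pos_def H" unfolding H_def by (rule sym_pos_def_gramH[OF MN fstar_zero_pos])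
  then show "H ** matrix_inv H = mat 1" "sym_pos_def (matrix_inv H)"
    by (simp_all add: matrix_inv_mult sym_pos_def_invertible sym_pos_def_matrix_inv)
qed

lemma ystar_zero_has_derivative:
  "((\<lambda>m'. ystar 0 v dv (W m') m') has_derivative (\<lambda>h. - (matrix_inv H *v h))) (at m)"
  using reconstruction_has_derivative(1)[OF MN open_realizable[OF MN] m order_refl weight_pos, where lam = 0 and c' = "\<lambda>_ _. 0"]
  by (simp add: f_def H_def)

lemma fstar_zero_has_derivative:
  "((\<lambda>m'. fstar 0 v dv (W m') m' $ l) has_derivative (\<lambda>h. f $ l * ((matrix_inv H *v h) \<bullet> pvec (v $ l)))) (at m)"
  using reconstruction_has_derivative(2)[OF MN open_realizable[OF MN] m order_refl weight_pos, where lam = 0 and c' = "\<lambda>_ _. 0"]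
  by (simp add: f_def H_def)

lemma entropy_zero_has_derivative:
  "((\<lambda>m'. fstar 0 v dv (W m') m' $ l * ln (fstar 0 v dv (W m') m' $ l)) has_derivative
    (\<lambda>h. - (f $ l * ((matrix_inv H *v h) \<bullet> pvec (v $ l)) * (ystar 0 v dv (W m) m \<bullet> pvec (v $ l))))) (at m)"
proof -
  have ln: "ln (f $ l) = - 1 - ystar 0 v dv (W m) m \<bullet> pvec (v $ l)"
    unfolding f_def fstar_zero[OF MN m weight_pos[OF m]] ystar_zero[OF MN m] by (simp add: ln_dens)
  have "((\<lambda>m'. fstar 0 v dv (W m') m' $ l * ln (fstar 0 v dv (W m') m' $ l)) has_derivative
    (\<lambda>h. f $ l * ((f $ l * ((matrix_inv H *v h) \<bullet> pvec (v $ l))) * inverse (f $ l))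
      + f $ l * ((matrix_inv H *v h) \<bullet> pvec (v $ l)) * ln (f $ l))) (at m)"
    using fstar_zero_pos[of l] unfolding f_def
    by (intro has_derivative_mult has_derivative_ln fstar_zero_has_derivative[unfolded f_def])
       simp_all
  moreover have "f $ l * ((f $ l * a) * inverse (f $ l)) + f $ l * a * ln (f $ l)
      = - (f $ l * a * (ystar 0 v dv (W m) m \<bullet> pvec (v $ l)))" for a
    using fstar_zero_pos[of l] unfolding ln by (simp add: field_simps)
  ultimately show ?thesis by (simp only:)
qed

lemma eta_gradient: "GDERIV (eta 0 v dv W) m :> - ystar 0 v dv (W m) m"
proof -
  have "((\<lambda>m'. \<Sum>l\<in>UNIV. dv $ l * (fstar 0 v dv (W m') m' $ l * ln (fstar 0 v dv (W m') m' $ l))) has_derivative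
    (\<lambda>h. \<Sum>l\<in>UNIV. dv $ l * - (f $ l * ((matrix_inv H *v h) \<bullet> pvec (v $ l)) * (ystar 0 v dv (W m) m \<bullet> pvec (v $ l))))) (at m)"
    by (intro has_derivative_sum has_derivative_mult_right entropy_zero_has_derivative)
  moreover have "(\<Sum>l\<in>UNIV. dv $ l * - (f $ l * ((matrix_inv H *v h) \<bullet> pvec (v $ l)) * (ystar 0 v dv (W m) m \<bullet> pvec (v $ l))))
      = h \<bullet> - ystar 0 v dv (W m) m" for h
  proof -
    \<comment> \<open>Inserting H H^-1 turns the pairing with h into the sum over nodes produced by
      differentiating f ln f.\<close>
    have "h \<bullet> - ystar 0 v dv (W m) m = - (ystar 0 v dv (W m) m \<bullet> (H *v (matrix_inv H *v h)))"
      by (simp add: matrix_vector_mul_assoc gramH_inverse inner_commute)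
    also have "\<dots> = (\<Sum>l\<in>UNIV. dv $ l * - (f $ l * ((matrix_inv H *v h) \<bullet> pvec (v $ l)) * (ystar 0 v dv (W m) m \<bullet> pvec (v $ l))))"
      unfolding H_def[symmetric] unfolding H_def gramH_vec inner_sum_right sum_negf[symmetric]
      by (simp add: mult_ac)
    finally show ?thesis by simp
  qed
  ultimately show ?thesis
    unfolding gderiv_def eta_def[abs_def] by (simp only: mult.assoc)
qed

lemma flux_zero_has_derivative:
  "(flux 0 v dv W has_derivative (\<lambda>h. (K ** matrix_inv H) *v h)) (at m)"
proof -
  have "(flux 0 v dv W has_derivative
      (\<lambda>h. \<Sum>l\<in>UNIV. (dv $ l * v $ l * (f $ l * ((matrix_inv H *v h) \<bullet> pvec (v $ l)))) *\<^sub>R pvec (v $ l))) (at m)"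
    unfolding flux_def[abs_def]
    by (intro has_derivative_sum has_derivative_scaleR_left has_derivative_mult_right fstar_zero_has_derivative)
  then show ?thesis
    unfolding matrix_vector_mul_assoc[symmetric] unfolding K_def gramK_vec by (simp add: mult.assoc)
qed

text \<open>The extra factor v l replaces H by K in the computation for \<open>eta\<close>, and the
  product K H^-1 is moved to the other side of the pairing as a transpose.\<close>

lemma psi_gradient:
  "GDERIV (psi 0 v dv W) m :> transpose (K ** matrix_inv H) *v - ystar 0 v dv (W m) m"
proof -
  have "((\<lambda>m'. \<Sum>l\<in>UNIV. dv $ l * v $ l * (fstar 0 v dv (W m') m' $ l * ln (fstar 0 v dv (W m') m' $ l))) has_derivative
    (\<lambda>h. \<Sum>l\<in>UNIV. dv $ l * v $ l * - (f $ l * ((matrix_inv H *v h) \<bullet> pvec (v $ l)) * (ystar 0 v dv (W m) m \<bullet> pvec (v $ l))))) (at m)"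
    by (intro has_derivative_sum has_derivative_mult_right entropy_zero_has_derivative)
  moreover have "(\<Sum>l\<in>UNIV. dv $ l * v $ l * - (f $ l * ((matrix_inv H *v h) \<bullet> pvec (v $ l)) * (ystar 0 v dv (W m) m \<bullet> pvec (v $ l))))
      = h \<bullet> (transpose (K ** matrix_inv H) *v - ystar 0 v dv (W m) m)" for h
  proof -
    have "h \<bullet> (transpose (K ** matrix_inv H) *v - ystar 0 v dv (W m) m)
        = - (ystar 0 v dv (W m) m \<bullet> (K *v (matrix_inv H *v h)))"
      unfolding inner_matrix_transpose[symmetric]
      by (simp add: matrix_vector_mul_assoc inner_commute)
    also have "\<dots> = (\<Sum>l\<in>UNIV. dv $ l * v $ l * - (f $ l * ((matrix_inv H *v h) \<bullet> pvec (v $ l)) * (ystar 0 v dv (W m) m \<bullet> pvec (v $ l))))"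
      unfolding K_def gramK_vec inner_sum_right sum_negf[symmetric]
      by (simp add: mult_ac)
    finally show ?thesis by simp
  qed
  ultimately show ?thesis
    unfolding gderiv_def psi_def[abs_def] by (simp only: mult.assoc)
qed

lemma flux_zero_symmetrizer: "symmetrizer (matrix_inv H) (K ** matrix_inv H)"
  using gramH_inverse(2) unfolding symmetrizer_def sym_pos_def_def matrix_transpose_mul K_def
  by (simp add: transpose_gram matrix_mul_assoc)

end

text \<open>On the open realizable set the gradient is - \<open>ystar\<close>, so the Hessian is
  minus the derivative of the multiplier.\<close>

lemma grad_eta_has_derivative:
  assumes m: "m \<in> realizable v dv"
  shows "(grad (eta 0 v dv W) has_derivative (\<lambda>h. matrix_inv (gramH v dv (fstar 0 v dv (W m) m)) *v h)) (at m)"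
proof -
  have "((\<lambda>m'. - ystar 0 v dv (W m') m') has_derivative
      (\<lambda>h. matrix_inv (gramH v dv (fstar 0 v dv (W m) m)) *v h)) (at m)"
    using has_derivative_minus[OF ystar_zero_has_derivative[OF m]] by simp
  then show ?thesis
    by (rule has_derivative_transform_within_open[OF _ open_realizable[OF MN] m])
       (simp add: grad_eq[OF eta_gradient])
qed

end

lemma flux_zero_spectrum:
  fixes f :: "'n rvec"
  assumes MN: "CARD('m::{finite,linorder}) < CARD('n)" and f: "\<And>l. 0 < f $ l"
  obtains \<theta> :: "'m::{finite,linorder} \<Rightarrow> real" where "gauss_nodes (mustar v dv f) \<theta>"
    "eigenvalues (gramK v dv f ** matrix_inv (gramH v dv f) :: ('m, 'm) rmat) = complex_of_real ` range \<theta>"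
    "\<And>i. \<exists>k. v $ k < \<theta> i" "\<And>i. \<exists>k. \<theta> i < v $ k"
proof -
  let ?H = "gramH v dv f :: ('m, 'm) rmat" and ?K = "gramK v dv f :: ('m, 'm) rmat"
  let ?S = "msqrt ?H"
  note S = msqrt[OF sym_pos_def_gramH[where 'm='m, OF less_imp_le[OF MN] f]]
  obtain \<theta> :: "'m \<Rightarrow> real" and u :: "'m \<Rightarrow> 'm rvec" where
    th: "gauss_nodes (mustar v dv f) \<theta>" "inj \<theta>" and u: "orthonormal_family u"
    and J: "\<And>i. (matrix_inv ?S ** ?K ** matrix_inv ?S) *v u i = \<theta> i *\<^sub>R u i"
    and bd: "\<And>i. \<exists>k. v $ k < \<theta> i" "\<And>i. \<exists>k. \<theta> i < v $ k"
    using gauss_nodes_eigenbasis[where f = f, OF MN f] by metis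
  have "u i \<noteq> 0" for i
    using u unfolding orthonormal_family_def by (metis inner_zero_left zero_neq_one)
  from eigenvalues_eq[OF th(2) this J]
  have "eigenvalues (matrix_inv ?S ** (?K ** matrix_inv ?H) ** ?S) = complex_of_real ` range \<theta>"
    using similar_to_symmetric[OF S, of ?K 0] by simp
  then have "eigenvalues (?K ** matrix_inv ?H) = complex_of_real ` range \<theta>"
    by (simp add: eigenvalues_similar sym_pos_def_invertible[OF S(1)])
  with that th bd show thesis by blast
qed

end

section \<open>A state at which the symmetrizer fails\<close>

text \<open>Four nodes with \<open>f = w = exp (- v\<^sup>2)\<close> and \<open>\<beta> = \<lambda> = 1\<close>; the masses \<open>dv\<^sub>l f\<^sub>l = dv\<^sub>l w\<^sub>l\<close> are
  \<open>1, 2, 2, 1\<close>. They must not all be equal: for constant \<open>\<kappa>\<close> the gradients of \<open>\<kappa>\<^sub>l\<close> are values of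
  a quadratic polynomial at \<open>v\<^sub>l\<close> and \<open>R = 0\<close>.\<close>

definition ex_v :: "real ^ 4" where "ex_v = (\<chi> l. [-2, -1, 1, 2] ! pos l)"
definition ex_mass :: "4 \<Rightarrow> real" where "ex_mass l = [1, 2, 2, 1] ! pos l"
definition ex_f :: "real ^ 4" where "ex_f = (\<chi> l. exp (- (ex_v $ l)\<^sup>2))"
definition ex_dv :: "real ^ 4" where "ex_dv = (\<chi> l. ex_mass l * exp ((ex_v $ l)\<^sup>2))"
definition ex_m :: "real ^ 3" where "ex_m = moment_mat ex_v ex_dv *v ex_f"

lemma pos4_cases: "pos (l :: 4) = 0 \<or> pos l = 1 \<or> pos l = 2 \<or> pos l = 3"
  using pos_less[of l] by auto

lemma pos3_cases: "pos (i :: 3) = 0 \<or> pos i = 1 \<or> pos i = 2"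
  using pos_less[of i] by auto

lemma ex_mass_pos: "0 < ex_mass l"
  using pos4_cases[of l] by (auto simp: ex_mass_def numeral_2_eq_2 numeral_3_eq_3)

lemma strict_mono_ex_v: "strict_mono (\<lambda>l. ex_v $ l)"
proof (rule strict_monoI)
  fix l l' :: 4
  assume "l < l'"
  then have "pos l < pos l'" by (rule strict_monoD[OF strict_mono_pos])
  moreover have "sorted_wrt (<) [-2, -1, 1, 2 :: real]" by simp
  ultimately show "ex_v $ l < ex_v $ l'"
    using pos_less[of l'] unfolding ex_v_def
    by (simp only: vec_lambda_beta) (rule sorted_wrt_nth_less, auto)
qed

lemma ex_dv_pos: "0 < ex_dv $ l"
  by (simp add: ex_dv_def ex_mass_pos)

interpretation ex: velocity_grid ex_v ex_dv
proof
  show "inj (\<lambda>l. ex_v $ l)"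
    using strict_mono_ex_v strict_mono_imp_inj_on by blast
qed (rule ex_dv_pos)

lemma ex_mass: "ex_dv $ l * ex_f $ l = ex_mass l"
  by (simp add: ex_dv_def ex_f_def exp_minus)

text \<open>The function g receives mass and node separately, so all sums of the example are
  instances.\<close>

lemma ex_sum: "(\<Sum>l\<in>UNIV. g (ex_mass l) (ex_v $ l)) = g 1 (-2) + g 2 (-1) + g 2 1 + g 1 2"
proof -
  have "(\<Sum>l\<in>UNIV. g (ex_mass l) (ex_v $ l)) = (\<Sum>j<CARD(4). g ([1, 2, 2, 1] ! j) ([-2, -1, 1, 2] ! j))"
    unfolding ex_mass_def ex_v_def vec_lambda_beta by (rule sum_over_pos)
  then show ?thesis by (simp add: eval_nat_numeral)
qed

lemma ex_m_realizable: "ex_m \<in> realizable ex_v ex_dv"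
  unfolding realizable_def ex_m_def by (auto simp: ex_f_def)

lemma ex_mom: "j < 3 \<Longrightarrow> mom ex_m j = (-2) ^ j + 2 * (-1) ^ j + 2 + 2 ^ j"
  using ex.mom_realizable[OF ex_m_def, of j] ex_sum[where g = "\<lambda>w x. w * x ^ j"]
  by (simp add: ex_mass)

lemma ex_state: "mom ex_m 0 = 6" "mom ex_m 1 = 0" "vbar ex_m = 0" "inten ex_m = 2"
  by (simp_all add: vbar_def inten_def ex_mom)

lemma ex_near: "(ex_v $ l)\<^sup>2 < 2" if "pos l = 1"
  using that by (simp add: ex_v_def)

lemma ex_m_realizable_w: "ex_m \<in> realizable_w ex_v ex_dv"
proof -
  obtain k :: 4 where k: "pos k = 1" using ex_pos[where 'm = 4, of 1] by auto
  have "(\<Sum>l\<in>UNIV. ex_dv $ l) = 2 * exp 4 + 4 * exp 1"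
    unfolding ex_dv_def vec_lambda_beta ex_sum[where g = "\<lambda>w x. w * exp (x\<^sup>2)"] by simp
  moreover have "(\<Sum>l\<in>UNIV. ex_dv $ l * (ex_v $ l)\<^sup>2) = 8 * exp 4 + 4 * exp 1"
    unfolding ex_dv_def vec_lambda_beta ex_sum[where g = "\<lambda>w x. w * exp (x\<^sup>2) * x\<^sup>2"] by simp
  moreover have "0 < 2 * exp 4 + 4 * exp (1 :: real)" by (intro add_pos_pos) auto
  moreover have "exp 1 < exp (4 :: real)" by simp
  ultimately show ?thesis
    unfolding ex.realizable_w_iff ex_state
    using ex_m_realizable ex_near[OF k] by (auto simp: pos_less_divide_eq)
qed

text \<open>For b = 1 the products dv w are the masses, and the mean of v^2 under them is 12 / 6 =
  2, the prescribed variance.\<close>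

lemma ex_beta: "beta ex_v ex_dv ex_m = 1"
proof -
  obtain k :: 4 where k: "pos k = 1" using ex_pos[where 'm = 4, of 1] by auto
  have dv: "ex_dv $ l = ex_mass l * exp ((ex_v $ l)\<^sup>2)" for l
    by (simp add: ex_dv_def)
  have "ex.excess 0 2 1 = 0"
    unfolding ex.excess_def dv
      ex_sum[where g = "\<lambda>w x. w * exp (x\<^sup>2) * (((x - 0)\<^sup>2 - 2) * exp (- 1 * ((x - 0)\<^sup>2 - 2)))"]
    by (simp add: mult_exp_exp algebra_simps)
  then show ?thesis
    using ex.beta_eq[of k ex_m 1] ex_near[OF k] by (simp add: ex_state)
qed

lemma ex_maxw: "maxw ex_v ex_dv ex_m = ex_f"
  by (simp add: maxw_def ex_f_def ex_beta ex_state)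

lemma ex_kappa: "kappa ex_dv ex_f l = 1 / ex_mass l"
  by (simp add: kappa_def ex_mass)

lemma inner_pvec3:
  "(\<chi> k. [a, b, c] ! pos k) \<bullet> (pvec x :: real ^ 3) = a + b * x + c * x\<^sup>2"
proof -
  have "(\<chi> k. [a, b, c] ! pos k) \<bullet> (pvec x :: real ^ 3) = (\<Sum>k\<in>UNIV. [a, b, c] ! pos (k :: 3) * x ^ pos k)"
    by (simp add: inner_vec_def pvec_def)
  also have "\<dots> = (\<Sum>j<CARD(3). [a, b, c] ! j * x ^ j)"
    by (rule sum_over_pos)
  finally show ?thesis by (simp add: eval_nat_numeral)
qed

text \<open>The multiplier solves \<open>- 1 - \<kappa>\<^sub>l - y\<^sub>0 - y\<^sub>2 v\<^sub>l\<^sup>2 = - v\<^sub>l\<^sup>2\<close> at the nodes \<open>\<plusminus>1\<close> and \<open>\<plusminus>2\<close>.\<close>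

lemma ex_fstar: "fstar 1 ex_v ex_dv (maxw ex_v ex_dv ex_m) ex_m = ex_f"
proof -
  define c :: "real ^ 4" where "c = (\<chi> l. 1 * kappa ex_dv ex_f l)"
  \<comment> \<open>As \<kappa> is 1 at the outer and 1/2 at the inner nodes, the equations are y0 +
    4 y2 = 2 and y0 + y2 = - 1/2.\<close>
  define y :: "real ^ 3" where "y = (\<chi> k. [-4/3, 0, 5/6] ! pos k)"
  have "- 1 - c $ l - y \<bullet> pvec (ex_v $ l) = - (ex_v $ l)\<^sup>2" for l
    using pos4_cases[of l] unfolding y_def inner_pvec3
    by (auto simp: c_def ex_kappa ex_mass_def ex_v_def numeral_2_eq_2 numeral_3_eq_3 power2_eq_square)
  then have f: "ex.dens c y = ex_f"
    by (simp add: ex.dens_def ex_f_def vec_eq_iff)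
  then have "ex.dmom c y = ex_m"
    using ex.moment_mat_dens[of c y] by (simp add: ex_m_def)
  then have "ex.multiplier c ex_m = y"
    using ex.multiplier_dmom[of c y] by simp
  then show ?thesis
    unfolding ex_maxw using ex.fstar_eq[of ex_m ex_f 1] ex_m_realizable f
    by (simp add: c_def ex_f_def)
qed

lemma ex_moments:
  fixes q :: "real \<Rightarrow> real"
  shows "(\<Sum>l\<in>UNIV. (ex_mass l * q (ex_v $ l)) *\<^sub>R (pvec (ex_v $ l) :: real ^ 3)) $ i =
    q (-2) * (-2) ^ pos i + 2 * q (-1) * (-1) ^ pos i + 2 * q 1 + q 2 * 2 ^ pos i"
    "(\<Sum>l\<in>UNIV. q (ex_v $ l) *\<^sub>R (pvec (ex_v $ l) :: real ^ 3)) $ i =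
    q (-2) * (-2) ^ pos i + q (-1) * (-1) ^ pos i + q 1 + q 2 * 2 ^ pos i"
  using ex_sum[where g = "\<lambda>w x. w * q x * x ^ pos i"] ex_sum[where g = "\<lambda>w x. q x * x ^ pos i"]
  by (simp_all add: pvec_def)

text \<open>The gradient of \<beta> is never computed: it enters only through the number
  \<open>B\<close>, which cancels between K H^-1 G and Gv. By parity of the nodes and masses a
  single entry of R survives.\<close>

lemma ex_matR:
  fixes h :: "real ^ 3"
  shows "matR ex_v ex_dv (maxw ex_v ex_dv) ex_f ex_m *v h = (\<chi> i. if pos i = 2 then 4 / 3 * mom h 1 else 0)"
proof -
  let ?H = "gramH ex_v ex_dv ex_f :: real ^ 3 ^ 3" and ?K = "gramK ex_v ex_dv ex_f :: real ^ 3 ^ 3"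
  let ?g = "\<lambda>l. grad (\<lambda>m' :: real ^ 3. kappa ex_dv (maxw ex_v ex_dv m') l) ex_m"
  define B where "B = h \<bullet> grad (beta ex_v ex_dv) ex_m"
  define t where "t = mom h 1"
  have g: "ex_mass l * (h \<bullet> ?g l) = B * (ex_v $ l)\<^sup>2 - t / 3 * ex_v $ l" for l
  proof -
    have D: "((\<lambda>m' :: real ^ 3. kappa ex_dv (maxw ex_v ex_dv m') l) has_derivative
      (\<lambda>h. kappa ex_dv ex_f l * ((h \<bullet> grad (beta ex_v ex_dv) ex_m) * (ex_v $ l)\<^sup>2 - 2 * ex_v $ l * (mom h 1 * 6 / 36)))) (at ex_m)"
      using ex.kappa_maxw_has_derivative[OF _ ex_m_realizable_w, of l]
      by (simp add: ex_state ex_beta ex_maxw del: One_nat_def)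
    have "h \<bullet> ?g l = kappa ex_dv ex_f l * ((h \<bullet> grad (beta ex_v ex_dv) ex_m) * (ex_v $ l)\<^sup>2 - 2 * ex_v $ l * (mom h 1 * 6 / 36))"
      using has_derivative_unique[OF has_derivative_grad[OF differentiableI[OF D]] D] by meson
    then show ?thesis
      using ex_mass_pos[of l] by (simp add: ex_kappa B_def t_def)
  qed
  have f0: "0 < ex_f $ l" for l by (simp add: ex_f_def)
  have G: "matG ex_v ex_dv (maxw ex_v ex_dv) ex_f ex_m *v h =
      (\<Sum>l\<in>UNIV. (B * (ex_v $ l)\<^sup>2 - t / 3 * ex_v $ l) *\<^sub>R pvec (ex_v $ l))"
    unfolding matG_def matrix_outer_vec ex_mass g ..
  have Gv: "matGv ex_v ex_dv (maxw ex_v ex_dv) ex_f ex_m *v h =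
      (\<Sum>l\<in>UNIV. (ex_v $ l * (B * (ex_v $ l)\<^sup>2 - t / 3 * ex_v $ l)) *\<^sub>R pvec (ex_v $ l))"
  proof -
    have "ex_dv $ l * ex_v $ l * ex_f $ l * (h \<bullet> ?g l) = ex_v $ l * (B * (ex_v $ l)\<^sup>2 - t / 3 * ex_v $ l)" for l
      unfolding g[symmetric] ex_mass[symmetric] by simp
    then show ?thesis unfolding matGv_def matrix_outer_vec by (simp only:)
  qed
  \<comment> \<open>The solution of H x = G h, which splits by parity into 6 x0 + 12 x2 = 10 B, 12
    x0 + 36 x2 = 34 B and 12 x1 = - 10 t / 3.\<close>
  define x :: "real ^ 3" where "x = (\<chi> k. [- (2 * B / 3), - (5 * t / 18), 7 * B / 6] ! pos k)"
  have xp: "x \<bullet> pvec z = - (2 * B / 3) + - (5 * t / 18) * z + 7 * B / 6 * z\<^sup>2" for z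
    unfolding x_def by (rule inner_pvec3)
  have "?H *v x = matG ex_v ex_dv (maxw ex_v ex_dv) ex_f ex_m *v h"
    unfolding vec_eq_iff
  proof
    fix i :: 3
    show "(?H *v x) $ i = (matG ex_v ex_dv (maxw ex_v ex_dv) ex_f ex_m *v h) $ i"
      unfolding ex.gramH_vec ex_mass ex_moments(1)[where q = "\<lambda>z. x \<bullet> pvec z"]
        G ex_moments(2)[where q = "\<lambda>z. B * z\<^sup>2 - t / 3 * z"]
      using pos3_cases[of i] by (auto simp: xp field_simps)
  qed
  moreover have "sym_pos_def ?H" by (rule ex.sym_pos_def_gramH) (simp_all add: f0)
  ultimately have "matrix_inv ?H *v (matG ex_v ex_dv (maxw ex_v ex_dv) ex_f ex_m *v h) = x"
    using matrix_inv_mult(2)[OF sym_pos_def_invertible]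
    by (metis matrix_vector_mul_assoc matrix_vector_mul_lid)
  then have R: "matR ex_v ex_dv (maxw ex_v ex_dv) ex_f ex_m *v h =
      ?K *v x - matGv ex_v ex_dv (maxw ex_v ex_dv) ex_f ex_m *v h"
    unfolding matR_def by (simp add: matrix_vector_mult_diff_rdistrib matrix_vector_mul_assoc[symmetric])
  have K: "?K *v x = (\<Sum>l\<in>UNIV. (ex_mass l * (ex_v $ l * (x \<bullet> pvec (ex_v $ l)))) *\<^sub>R pvec (ex_v $ l))"
    unfolding ex.gramK_vec ex_mass[symmetric] by (simp add: mult_ac)
  show ?thesis
    unfolding R vec_eq_iff
  proof
    fix i :: 3
    show "(?K *v x - matGv ex_v ex_dv (maxw ex_v ex_dv) ex_f ex_m *v h) $ i =
        (\<chi> i. if pos i = 2 then 4 / 3 * mom h 1 else 0) $ i"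
      unfolding vector_minus_component K ex_moments(1)[where q = "\<lambda>z. z * (x \<bullet> pvec z)"]
        Gv ex_moments(2)[where q = "\<lambda>z. z * (B * z\<^sup>2 - t / 3 * z)"]
      using pos3_cases[of i] by (auto simp: xp t_def field_simps)
  qed
qed

text \<open>Evaluated on vectors H a and H b, the form of H^-1 (K H^-1 + R) has the symmetric part
  K, so a symmetrizer would make R H symmetric. Its entries for the orders 1 and 2 are 4/3 * 12 = 16
  on one side of the diagonal and 0 on the other.\<close>

lemma ex_not_symmetrizer:
  "\<not> symmetrizer (matrix_inv (gramH ex_v ex_dv ex_f :: real ^ 3 ^ 3))
     (jacobian (flux 1 ex_v ex_dv (maxw ex_v ex_dv)) (at ex_m))"
proof
  let ?H = "gramH ex_v ex_dv ex_f :: real ^ 3 ^ 3" and ?K = "gramK ex_v ex_dv ex_f :: real ^ 3 ^ 3"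
  let ?R = "matR ex_v ex_dv (maxw ex_v ex_dv) ex_f ex_m"
  let ?A = "?K ** matrix_inv ?H + ?R"
  have A: "jacobian (flux 1 ex_v ex_dv (maxw ex_v ex_dv)) (at ex_m) = ?A"
    using jacobian_eq[OF ex.flux_maxw_has_derivative[OF _ ex_m_realizable_w, where lam = 1]]
    by (simp add: ex_fstar)
  assume "symmetrizer (matrix_inv ?H) (jacobian (flux 1 ex_v ex_dv (maxw ex_v ex_dv)) (at ex_m))"
  then have sym: "transpose (matrix_inv ?H ** ?A) = matrix_inv ?H ** ?A"
    unfolding A symmetrizer_def by blast
  have f0: "0 < ex_f $ l" for l by (simp add: ex_f_def)
  have Hpd: "sym_pos_def ?H" by (rule ex.sym_pos_def_gramH) (simp_all add: f0)
  note inv = matrix_inv_mult[OF sym_pos_def_invertible[OF Hpd]]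
  have cancel: "?H *v (matrix_inv ?H *v z) = z" "matrix_inv ?H *v (?H *v z) = z" for z
    by (simp_all add: matrix_vector_mul_assoc inv)
  have HA: "((matrix_inv ?H ** ?A) *v (?H *v a)) \<bullet> (?H *v b) = (?K *v a) \<bullet> b + (?R *v (?H *v a)) \<bullet> b" for a b
  proof -
    have "((matrix_inv ?H ** ?A) *v (?H *v a)) \<bullet> (?H *v b) = (?H *v (matrix_inv ?H *v (?A *v (?H *v a)))) \<bullet> b"
      unfolding matrix_vector_mul_assoc[symmetric]
      by (rule inner_symmetric_matrix[OF ex.transpose_gram(1), symmetric])
    also have "\<dots> = (?A *v (?H *v a)) \<bullet> b"
      by (simp only: cancel)
    also have "?A *v (?H *v a) = ?K *v (matrix_inv ?H *v (?H *v a)) + ?R *v (?H *v a)"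
      by (simp add: matrix_vector_mult_add_rdistrib matrix_vector_mul_assoc[symmetric])
    also have "matrix_inv ?H *v (?H *v a) = a"
      by (rule cancel)
    finally show ?thesis by (simp add: inner_add_left)
  qed
  have RH: "(?R *v (?H *v a)) \<bullet> b = (?R *v (?H *v b)) \<bullet> a" for a b
    using inner_symmetric_matrix[OF sym, of "?H *v a" "?H *v b"] HA[of a b] HA[of b a]
      inner_symmetric_matrix[OF ex.transpose_gram(2), where x = a and y = b]
    by (simp add: inner_commute)
  obtain i :: 3 where i: "pos i = 1" using ex_pos[where 'm = 3, of 1] by auto
  obtain j :: 3 where j: "pos j = 2" using ex_pos[where 'm = 3, of 2] by auto
  have R: "(?R *v h) \<bullet> axis k 1 = (if pos k = 2 then 4 / 3 * mom h 1 else 0)" for h k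
    by (simp add: ex_matR inner_axis)
  have "?H $ i $ i = 12" "?H $ i $ j = 0"
    using ex_sum[where g = "\<lambda>w x. w * x * x"] ex_sum[where g = "\<lambda>w x. w * x * x\<^sup>2"]
    by (simp_all add: gramH_def ex_mass pvec_def i j)
  then have "mom (?H *v axis i 1) 1 = 12" "mom (?H *v axis j 1) 1 = 0"
    using mom_pos[of "?H *v axis i 1" i] mom_pos[of "?H *v axis j 1" i]
    by (simp_all add: i matrix_vector_mult_basis column_def)
  with RH[of "axis i 1" "axis j 1"] show False
    by (simp add: R i j)
qed

text \<open>The claim that H^-1 is in general no symmetrizer is rendered as existence of one
  admissible grid and state. Spectra are given as equalities of complex eigenvalue sets, which rules
  out non-real eigenvalues.\<close>

theorem theorem4:
  fixes v dv :: "'n::{finite,linorder} rvec" and lam :: real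
  assumes "3 \<le> CARD('m::{finite,linorder})" and "CARD('m) < CARD('n)"
    and "strict_mono (\<lambda>l. v $ l)" and "\<forall>l. 0 < dv $ l" and "0 \<le> lam"
    and "rank (moment_mat v dv :: ('n, 'm) rmat) = CARD('m)"
  shows
    "(\<forall>m \<in> (realizable_w v dv :: ('m rvec) set).
       let W = maxw v dv;
           f = fstar lam v dv (W m) m;
           H = gramH v dv f;
           K = gramK v dv f;
           R = matR v dv W f m;
           F = flux lam v dv W;
           r = lam * spectral_norm (matrix_inv (msqrt H) ** R ** msqrt H)
       in (F has_derivative (\<lambda>h. (K ** matrix_inv H + lam *\<^sub>R R) *v h)) (at m) \<and>
          (\<exists>\<theta> :: 'm \<Rightarrow> real. gauss_nodes (mustar v dv f) \<theta> \<and>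
             (r < 1 / 2 * Min {\<bar>\<theta> i - \<theta> j\<bar> | i j. i \<noteq> j} \<longrightarrow>
                strictly_hyperbolic_at F m \<and>
                (\<exists>\<theta>' :: 'm \<Rightarrow> real. inj \<theta>' \<and>
                   eigenvalues (jacobian F (at m)) = complex_of_real ` range \<theta>' \<and>
                   (\<forall>i. \<bar>\<theta>' i - \<theta> i\<bar> \<le> r))))) \<and>
     (\<exists>(v\<^sub>0 :: real ^ 4) (dv\<^sub>0 :: real ^ 4) lam\<^sub>0 (m :: real ^ 3).
       strict_mono (\<lambda>l. v\<^sub>0 $ l) \<and> (\<forall>l. 0 < dv\<^sub>0 $ l) \<and> 0 \<le> lam\<^sub>0 \<and>
       rank (moment_mat v\<^sub>0 dv\<^sub>0 :: real ^ 4 ^ 3) = 3 \<and> m \<in> realizable_w v\<^sub>0 dv\<^sub>0 \<and>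
       (let W = maxw v\<^sub>0 dv\<^sub>0;
            H = gramH v\<^sub>0 dv\<^sub>0 (fstar lam\<^sub>0 v\<^sub>0 dv\<^sub>0 (W m) m)
        in \<not> symmetrizer (matrix_inv H) (jacobian (flux lam\<^sub>0 v\<^sub>0 dv\<^sub>0 W) (at m)))) \<and>
     (\<forall>W W' :: 'm rvec \<Rightarrow> 'n rvec.
       (\<forall>m \<in> realizable v dv. \<forall>l. 0 < W m $ l \<and> 0 < W' m $ l) \<longrightarrow>
       (\<forall>m \<in> realizable v dv.
          fstar 0 v dv (W m) m = fstar 0 v dv (W' m) m \<and>
          flux 0 v dv W m = flux 0 v dv W' m)) \<and>
     (\<forall>W :: 'm rvec \<Rightarrow> 'n rvec.
       (\<forall>m \<in> realizable v dv. \<forall>l. 0 < W m $ l) \<longrightarrow>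
       strictly_convex_on (realizable v dv) (eta 0 v dv W) \<and>
       (\<forall>m \<in> realizable v dv.
          let f = fstar 0 v dv (W m) m;
              H = gramH v dv f;
              K = gramK v dv f;
              F = flux 0 v dv W
          in GDERIV (eta 0 v dv W) m :> - ystar 0 v dv (W m) m \<and>
             (grad (eta 0 v dv W) has_derivative (\<lambda>h. matrix_inv H *v h)) (at m) \<and>
             sym_pos_def (matrix_inv H) \<and>
             GDERIV (psi 0 v dv W) m :>
               transpose (jacobian F (at m)) *v grad (eta 0 v dv W) m \<and>
             (F has_derivative (\<lambda>h. (K ** matrix_inv H) *v h)) (at m) \<and>
             symmetrizer (matrix_inv H) (jacobian F (at m)) \<and>
             (\<exists>\<theta> :: 'm \<Rightarrow> real. gauss_nodes (mustar v dv f) \<theta> \<and>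
                eigenvalues (jacobian F (at m)) = complex_of_real ` range \<theta> \<and>
                (\<forall>i. v $ Min UNIV < \<theta> i \<and> \<theta> i < v $ Max UNIV))))"
proof (intro conjI, goal_cases)
  interpret velocity_grid v dv
    using assms(3,4) strict_mono_imp_inj_on by unfold_locales auto
  note MN = less_imp_le[OF assms(2)]
  {
    case 1
    show ?case
      using maxwellian_closure_hyperbolic[where 'm = 'm, OF assms(2) _ assms(5)] by blast
  next
    case 2
    show ?case
      using strict_mono_ex_v ex_dv_pos ex.rank_moment_mat[where 'm = 3] ex_m_realizable_w ex_not_symmetrizer
      by (intro exI[of _ ex_v] exI[of _ ex_dv] exI[of _ 1] exI[of _ ex_m]) (simp add: Let_def ex_fstar)
  next
    case 3
    show ?case
    proof (intro allI impI ballI)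
      fix W W' :: "'m rvec \<Rightarrow> 'n rvec" and m :: "'m rvec"
      assume "\<forall>m \<in> realizable v dv. \<forall>l. 0 < W m $ l \<and> 0 < W' m $ l" and m: "m \<in> realizable v dv"
      then have "fstar 0 v dv (W m) m = fstar 0 v dv (W' m) m"
        using fstar_zero[OF MN m, of "W m"] fstar_zero[OF MN m, of "W' m"] by simp
      then show "fstar 0 v dv (W m) m = fstar 0 v dv (W' m) m \<and> flux 0 v dv W m = flux 0 v dv W' m"
        by (simp add: flux_def)
    qed
  next
    case 4
    show ?case
    proof (intro allI impI conjI ballI, goal_cases)
      case (1 W)
      then show ?case by (rule eta_strictly_convex[OF MN])
    next
      case (2 W m)
      note W = 2(1) and m = 2(2)
      define f where "f = fstar 0 v dv (W m) m"
      define C where "C = gramK v dv f ** (matrix_inv (gramH v dv f) :: ('m, 'm) rmat)"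
      have J: "jacobian (flux 0 v dv W) (at m) = C"
        unfolding C_def f_def by (rule jacobian_eq[OF flux_zero_has_derivative[OF MN W m]])
      have f0: "0 < f $ l" for l
        unfolding f_def by (rule fstar_zero_pos[OF MN W m])
      have bounds: "v $ Min UNIV \<le> v $ k" "v $ k \<le> v $ Max UNIV" for k
        using assms(3) by (simp_all add: strict_mono_less_eq)
      obtain \<theta> :: "'m \<Rightarrow> real" where \<theta>: "gauss_nodes (mustar v dv f) \<theta>"
        "eigenvalues C = complex_of_real ` range \<theta>"
        "\<And>i. \<exists>k. v $ k < \<theta> i" "\<And>i. \<exists>k. \<theta> i < v $ k"
        using flux_zero_spectrum[where 'm = 'm and f = f, OF assms(2) f0] unfolding C_def by metis
      have "v $ Min UNIV < \<theta> i \<and> \<theta> i < v $ Max UNIV" for i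
        using \<theta>(3,4)[of i] bounds by (meson le_less_trans less_le_trans)
      with \<theta>(1,2) eta_gradient[OF MN W m] grad_eta_has_derivative[OF MN W m] gramH_inverse(2)[OF MN W m]
        psi_gradient[OF MN W m] flux_zero_has_derivative[OF MN W m] flux_zero_symmetrizer[OF MN W m]
      show ?case
        unfolding Let_def J grad_eq[OF eta_gradient[OF MN W m]] unfolding C_def f_def by blast
    qed
  }
qed

end
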